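(* Let $k\in\mathbb{N}$ and $N\in\mathbb{N}^{\ast}$. Let $I\subseteq\mathcal{R}^{k}(\mathbb{R}^{N})$ be an ideal. Then $$\sqrt{I}=\mathcal{I}(\mathcal{Z}(I)).$$
   Context: $\mathbb{N}=\{0,1,2,\dots\}$ and $\mathbb{N}^{\ast}=\{1,2,\dots\}$. A function $f:\mathbb{R}^N\to\mathbb{R}$ is called $k$-regulous if it is of class $\mathcal{C}^k$ on $\mathbb{R}^N$ and is rational, i.e. there are polynomials $p,q\in\mathbb{R}[x_1,\dots,x_N]$ with $q\not\equiv 0$ such that $f=p/q$ on a nonempty Zariski open subset of $\mathbb{R}^N$ on which $q$ does not vanish. $\mathcal{R}^k(\mathbb{R}^N)$ is the (commutative, unital) ring of $k$-regulous functions on $\mathbb{R}^N$ with pointwise operations. For an ideal $I\subseteq \mathcal{R}^k(\mathbb{R}^N)$, $\mathcal{Z}(I)=\{x\in\mathbb{R}^N \mid f(x)=0 \text{ for all } f\in I\}$; for a subset $F\subseteq\mathbb{R}^N$, $\mathcal{I}(F)=\{f\in\mathcal{R}^k(\mathbb{R}^N)\mid f(x)=0\text{ for all }x\in F\}$. $\sqrt{I}$ denotes the radical of $I$. *)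

theory Defs
  imports "HOL-Analysis.Analysis" "HOL-Algebra.Ideal"
begin

section \<open>Functions of class $C^k$ on $\mathbf{R}^N$\<close>

text \<open>The term \<open>frechet_derivative f (at x) (axis i 1)\<close> is the \<open>i\<close>-th partial derivative at \<open>x\<close>.\<close>

primrec class_C :: "nat \<Rightarrow> (real ^ 'n \<Rightarrow> real) \<Rightarrow> bool" where
  "class_C 0 f \<longleftrightarrow> continuous_on UNIV f"
| "class_C (Suc k) f \<longleftrightarrow>
     f differentiable_on UNIV \<and>
     (\<forall>i. class_C k (\<lambda>x. frechet_derivative f (at x) (axis i 1)))"


section \<open>Zariski open sets and regulous functions\<close>

definition zariski_closed :: "(real ^ 'n) set \<Rightarrow> bool" where
  "zariski_closed F \<longleftrightarrow>
     (\<exists>P. (\<forall>p\<in>P. real_polynomial_function p) \<and> F = {x. \<forall>p\<in>P. p x = 0})"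

definition zariski_open :: "(real ^ 'n) set \<Rightarrow> bool" where
  "zariski_open U \<longleftrightarrow> zariski_closed (- U)"

text \<open>Since the real field is infinite, a polynomial is nonzero iff the polynomial function it
  induces is not identically zero.\<close>

definition rational_function :: "(real ^ 'n \<Rightarrow> real) \<Rightarrow> bool" where
  "rational_function f \<longleftrightarrow>
     (\<exists>p q. real_polynomial_function p \<and> real_polynomial_function q \<and> q \<noteq> (\<lambda>x. 0) \<and>
        (\<exists>U. zariski_open U \<and> U \<noteq> {} \<and> (\<forall>x\<in>U. q x \<noteq> 0 \<and> f x = p x / q x)))"

definition regulous :: "nat \<Rightarrow> (real ^ 'n \<Rightarrow> real) \<Rightarrow> bool" where
  "regulous k f \<longleftrightarrow> class_C k f \<and> rational_function f"

definition regulous_ring :: "nat \<Rightarrow> (real ^ 'n \<Rightarrow> real) ring" where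
  "regulous_ring k =
     \<lparr>carrier = {f. regulous k f},
      mult = (\<lambda>f g x. f x * g x),
      one = (\<lambda>x. 1),
      zero = (\<lambda>x. 0),
      add = (\<lambda>f g x. f x + g x)\<rparr>"


section \<open>Zero sets, vanishing ideals, radicals\<close>

definition zero_set :: "(real ^ 'n \<Rightarrow> real) set \<Rightarrow> (real ^ 'n) set" where
  "zero_set I = {x. \<forall>f\<in>I. f x = 0}"

definition vanishing_ideal :: "nat \<Rightarrow> (real ^ 'n) set \<Rightarrow> (real ^ 'n \<Rightarrow> real) set" where
  "vanishing_ideal k F = {f \<in> carrier (regulous_ring k). \<forall>x\<in>F. f x = 0}"

definition ideal_radical :: "('a, 'b) ring_scheme \<Rightarrow> 'a set \<Rightarrow> 'a set" where
  "ideal_radical R I = {f \<in> carrier R. \<exists>m::nat. m \<ge> 1 \<and> f [^]\<^bsub>R\<^esub> m \<in> I}"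


section \<open>The regulous functions form a commutative ring\<close>

text \<open>In particular the hypothesis \<open>ideal I (regulous_ring k)\<close>, which includes the ring axioms,
  is satisfiable.\<close>

lemma class_C_const: "class_C k (\<lambda>x. c)"
  by (induction k arbitrary: c) auto

lemma class_C_Suc_imp: "class_C (Suc k) f \<Longrightarrow> class_C k f"
proof (induction k arbitrary: f)
  case 0
  then show ?case by (simp add: differentiable_imp_continuous_on)
next
  case (Suc k)
  then show ?case by (meson class_C.simps(2))
qed

lemma class_C_add: "class_C k f \<Longrightarrow> class_C k g \<Longrightarrow> class_C k (\<lambda>x. f x + g x)"
proof (induction k arbitrary: f g)
  case 0
  then show ?case by (simp add: continuous_on_add)
next
  case (Suc k)
  then have d: "f differentiable at x" "g differentiable at x" for x
    by (simp_all add: differentiable_on_eq_differentiable_at)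
  have "frechet_derivative (\<lambda>x. f x + g x) (at x) =
      (\<lambda>v. frechet_derivative f (at x) v + frechet_derivative g (at x) v)" for x
    by (rule frechet_derivative_at[symmetric])
      (intro has_derivative_add d[unfolded frechet_derivative_works])
  then show ?case
    using Suc by (auto simp: differentiable_on_add)
qed

lemma class_C_mult: "class_C k f \<Longrightarrow> class_C k g \<Longrightarrow> class_C k (\<lambda>x. f x * g x)"
proof (induction k arbitrary: f g)
  case 0
  then show ?case by (simp add: continuous_on_mult)
next
  case (Suc k)
  then have d: "f differentiable at x" "g differentiable at x" for x
    by (simp_all add: differentiable_on_eq_differentiable_at)
  have "frechet_derivative (\<lambda>x. f x * g x) (at x) =
      (\<lambda>v. f x * frechet_derivative g (at x) v + frechet_derivative f (at x) v * g x)" for x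
    by (rule frechet_derivative_at[symmetric])
      (intro has_derivative_mult d[unfolded frechet_derivative_works])
  moreover have "class_C k f" "class_C k g"
    using Suc.prems by (blast intro: class_C_Suc_imp)+
  ultimately show ?case
    using Suc by (auto simp: differentiable_on_mult intro!: class_C_add)
qed

lemma real_polynomial_function_mult_nonzero:
  fixes p q :: "real ^ 'n \<Rightarrow> real"
  assumes p: "real_polynomial_function p" "p x \<noteq> 0"
    and q: "real_polynomial_function q" "q y \<noteq> 0"
  shows "\<exists>z. p z \<noteq> 0 \<and> q z \<noteq> 0"
proof -
  define l where "l = (\<lambda>t::real. x + t *\<^sub>R (y - x))"
  have l: "polynomial_function l"
    unfolding l_def
    by (intro polynomial_function_add polynomial_function_const polynomial_function_mult
        polynomial_function_id[unfolded id_def])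
  have fin: "finite {t. r (l t) = 0}"
    if r: "real_polynomial_function r" and nz: "r (l s) \<noteq> 0" for r s
  proof -
    have "real_polynomial_function (r \<circ> l)"
      using polynomial_function_compose[OF l] r by (simp add: real_polynomial_function_eq)
    then obtain a n where a: "r \<circ> l = (\<lambda>t. \<Sum>i\<le>n. a i * t ^ i)"
      using real_polynomial_function_iff_sum by blast
    then have e: "r (l t) = (\<Sum>i\<le>n. a i * t ^ i)" for t
      by (metis comp_apply)
    have "\<exists>i\<le>n. a i \<noteq> 0"
      using nz e by (metis (no_types, lifting) atMost_iff mult_zero_left sum.neutral)
    then show ?thesis
      unfolding e by (simp add: polyfun_finite_roots)
  qed
  have "finite ({t. p (l t) = 0} \<union> {t. q (l t) = 0})"
    using fin[of p 0] fin[of q 1] p q by (simp add: l_def)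
  then have "{t. p (l t) = 0} \<union> {t. q (l t) = 0} \<noteq> UNIV"
    using infinite_UNIV_char_0 by metis
  then show ?thesis by blast
qed

lemma zariski_openE:
  assumes "zariski_open U" "x \<in> U"
  obtains p where "real_polynomial_function p" "p x \<noteq> 0" "\<And>y. p y \<noteq> 0 \<Longrightarrow> y \<in> U"
proof -
  obtain P where P: "\<forall>p\<in>P. real_polynomial_function p" "- U = {x. \<forall>p\<in>P. p x = 0}"
    using assms by (auto simp: zariski_open_def zariski_closed_def)
  then obtain p where "p \<in> P" "p x \<noteq> 0" using assms(2) by blast
  then show thesis using that P by blast
qed

lemma zariski_open_nonzero:
  assumes "real_polynomial_function p"
  shows "zariski_open {x. p x \<noteq> 0}"
  unfolding zariski_open_def zariski_closed_def
  using assms by (intro exI[of _ "{p}"]) auto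

lemma rational_function_iff:
  "rational_function f \<longleftrightarrow>
     (\<exists>p q. real_polynomial_function p \<and> real_polynomial_function q \<and>
        (\<exists>x. q x \<noteq> 0) \<and> (\<forall>x. q x \<noteq> 0 \<longrightarrow> f x = p x / q x))"
proof
  assume "rational_function f"
  then obtain p q U a where pq: "real_polynomial_function p" "real_polynomial_function q"
    and U: "zariski_open U" "a \<in> U" "\<And>x. x \<in> U \<Longrightarrow> q x \<noteq> 0 \<and> f x = p x / q x"
    unfolding rational_function_def by blast
  obtain r where r: "real_polynomial_function r" "r a \<noteq> 0" "\<And>y. r y \<noteq> 0 \<Longrightarrow> y \<in> U"
    using zariski_openE[OF U(1,2)] by blast
  show "\<exists>p q. real_polynomial_function p \<and> real_polynomial_function q \<and>
        (\<exists>x. q x \<noteq> 0) \<and> (\<forall>x. q x \<noteq> 0 \<longrightarrow> f x = p x / q x)"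
    by (rule exI[of _ "\<lambda>x. p x * r x"], rule exI[of _ "\<lambda>x. q x * r x"])
      (use pq r U in auto)
next
  assume "\<exists>p q. real_polynomial_function p \<and> real_polynomial_function q \<and>
        (\<exists>x. q x \<noteq> 0) \<and> (\<forall>x. q x \<noteq> 0 \<longrightarrow> f x = p x / q x)"
  then obtain p q where "real_polynomial_function p" "real_polynomial_function q"
    "\<exists>x. q x \<noteq> 0" "\<forall>x. q x \<noteq> 0 \<longrightarrow> f x = p x / q x" by blast
  then show "rational_function f"
    unfolding rational_function_def
    by (intro exI[of _ p] exI[of _ q] exI[of _ "{x. q x \<noteq> 0}"] conjI)
      (auto intro: zariski_open_nonzero)
qed

lemma rational_function_const: "rational_function (\<lambda>x. c)"
  unfolding rational_function_iff
  by (intro exI[of _ "\<lambda>x. c"] exI[of _ "\<lambda>x. 1"]) auto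

lemma
  assumes "rational_function f" "rational_function g"
  shows rational_function_add: "rational_function (\<lambda>x. f x + g x)"
    and rational_function_mult: "rational_function (\<lambda>x. f x * g x)"
proof -
  obtain p q where pq: "real_polynomial_function p" "real_polynomial_function q"
    "\<exists>x. q x \<noteq> 0" "\<And>x. q x \<noteq> 0 \<Longrightarrow> f x = p x / q x"
    using assms(1) unfolding rational_function_iff by blast
  obtain r s where rs: "real_polynomial_function r" "real_polynomial_function s"
    "\<exists>x. s x \<noteq> 0" "\<And>x. s x \<noteq> 0 \<Longrightarrow> g x = r x / s x"
    using assms(2) unfolding rational_function_iff by blast
  have nz: "\<exists>x. q x * s x \<noteq> 0"
    using real_polynomial_function_mult_nonzero[OF pq(2) _ rs(2)] pq(3) rs(3) by auto
  show "rational_function (\<lambda>x. f x + g x)"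
    unfolding rational_function_iff
    by (rule exI[of _ "\<lambda>x. p x * s x + r x * q x"], rule exI[of _ "\<lambda>x. q x * s x"])
      (use pq rs nz in \<open>auto simp: add_frac_eq\<close>)
  show "rational_function (\<lambda>x. f x * g x)"
    unfolding rational_function_iff
    by (rule exI[of _ "\<lambda>x. p x * r x"], rule exI[of _ "\<lambda>x. q x * s x"])
      (use pq rs nz in auto)
qed

lemma regulous_const: "regulous k (\<lambda>x. c)"
  by (simp add: regulous_def class_C_const rational_function_const)

lemma regulous_add: "regulous k f \<Longrightarrow> regulous k g \<Longrightarrow> regulous k (\<lambda>x. f x + g x)"
  by (simp add: regulous_def class_C_add rational_function_add)

lemma regulous_mult: "regulous k f \<Longrightarrow> regulous k g \<Longrightarrow> regulous k (\<lambda>x. f x * g x)"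
  by (simp add: regulous_def class_C_mult rational_function_mult)

lemma cring_regulous_ring: "cring (regulous_ring k)"
proof (rule cringI)
  show "abelian_group (regulous_ring k)"
  proof (rule abelian_groupI)
    fix f assume "f \<in> carrier (regulous_ring k)"
    then show "\<exists>g\<in>carrier (regulous_ring k). g \<oplus>\<^bsub>regulous_ring k\<^esub> f = \<zero>\<^bsub>regulous_ring k\<^esub>"
      using regulous_mult[OF regulous_const[of k "-1"], of f]
      by (intro bexI[of _ "\<lambda>x. - 1 * f x"]) (auto simp: regulous_ring_def)
  qed (auto simp: regulous_ring_def regulous_const algebra_simps intro: regulous_add)
  show "comm_monoid (regulous_ring k)"
    by (rule comm_monoidI)
      (auto simp: regulous_ring_def regulous_const algebra_simps intro: regulous_mult)
qed (auto simp: regulous_ring_def algebra_simps)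

end

theory Submission
  imports Defs
begin

text \<open>There are two steps. First, some single \<open>f \<in> I\<close> satisfies \<open>Z(f) \<subseteq> Z(g)\<close> for a given \<open>g\<close>
  vanishing on \<open>Z(I)\<close>. Otherwise take a Zariski closed set \<open>V\<close> minimal among those on which no element of
  \<open>I\<close> achieves this. Then \<open>V\<close> is irreducible. The restriction to \<open>V\<close> of a continuous rational function is
  again rational on \<open>V\<close>, and by minimality every \<open>f \<in> I\<close> vanishes on a nonempty Zariski open subset of
  \<open>V\<close>, while \<open>g\<close> does not. The Zariski open subsets of \<open>V\<close> have a common point in their Euclidean
  closures outside \<open>Z(g)\<close>, because \<open>V\<close> is not a countable union of proper algebraic subsets; this point
  lies in \<open>Z(I)\<close>, a contradiction.

  Second, the Lojasiewicz inequality \<open>|g|\<^sup>M \<le> C |f|\<close> on bounded sets, with \<open>M\<close> independent of the set,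
  shows that \<open>g\<^sup>m / f\<close>, extended by zero, is of class \<open>C\<^sup>k\<close> for large \<open>m\<close>. Hence
  \<open>g\<^sup>m = (g\<^sup>m / f) f \<in> I\<close>.

  Both steps rest on the Tarski-Seidenberg theorem, proved by the Cohen-Hoermander algorithm.\<close>

section \<open>Sign patterns of univariate polynomials\<close>

text \<open>Zero sets of regulous functions are in general not Zariski closed, so the Noetherian
  property of the Zariski topology does not by itself replace \<open>I\<close> by one function; it
  is applied to the closed sets on which the replacement fails. Over the reals a nonempty Zariski
  open part of an irreducible set need not be dense for the Euclidean topology (think of the stick
  of an umbrella), so a continuous function vanishing on such a part may be nonzero elsewhere on
  \<open>V\<close>; hence the search for a point adherent to all these parts at once. Dimension
  theory is bypassed: algebraically independent coordinates, projection and Baire's theorem take its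
  place, and projection is where Tarski-Seidenberg enters. Sums of squares merge several members of
  \<open>I\<close> into one. The size of \<open>m\<close> comes from differentiation: each
  derivative of \<open>g\<^sup>m / f\<^sup>j\<close> may cost one factor \<open>g\<close> and add
  one factor \<open>1/f\<close>, and the latter is paid for by \<open>M\<close> factors
  \<open>g\<close>.\<close>

lemma poly_pos_on_gap:
  fixes q :: "real poly"
  assumes "poly q a > 0" "\<And>y. a < y \<Longrightarrow> y \<le> b \<Longrightarrow> poly q y \<noteq> 0" "a \<le> b"
  shows "poly q b > 0"
proof (rule ccontr)
  assume "\<not> poly q b > 0"
  moreover have "poly q b \<noteq> 0" using assms by (cases "a = b") auto
  ultimately have n: "poly q b < 0" by simp
  then have "a < b" using assms by (cases "a = b") auto
  from poly_IVT_neg[OF this assms(1) n] show False using assms(2) by force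
qed

lemma poly_less_of_pderiv_pos:
  fixes p :: "real poly"
  assumes "a < b" "\<And>y. a < y \<Longrightarrow> y < b \<Longrightarrow> poly (pderiv p) y > 0"
  shows "poly p a < poly p b"
  by (rule DERIV_pos_imp_increasing_open[OF assms(1)])
    (use assms(2) poly_DERIV in \<open>blast, auto intro: continuous_intros\<close>)

text \<open>The map is piecewise linear with a single kink, and exchanging \<open>u\<close> and
  \<open>v\<close> gives its inverse. It serves to move the image of one root without disturbing
  anything outside the interval.\<close>

lemma bump_bijection:
  fixes a b u v :: real
  assumes "a < u" "u < b" "a < v" "v < b"
  shows "\<exists>g. strict_mono g \<and> surj g \<and> g u = v \<and> (\<forall>t. \<not> (a < t \<and> t < b) \<longrightarrow> g t = t)
     \<and> (\<forall>t. a < t \<and> t < b \<longrightarrow> a < g t \<and> g t < b)"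
proof -
  define G where "G = (\<lambda>u v t. if t \<le> a \<or> b \<le> t then t
     else if t \<le> u then a + (t - a) * ((v - a) / (u - a))
     else b - (b - t) * ((b - v) / (b - u)))"
  have G1: "G u v t = a + (t - a) * ((v - a) / (u - a))" if "a < t" "t < b" "t \<le> u" for u v t
    using that by (simp add: G_def)
  have G2: "G u v t = b - (b - t) * ((b - v) / (b - u))" if "a < t" "t < b" "t > u" for u v t
    using that by (simp add: G_def)
  have inG: "a < G u v t \<and> G u v t < b \<and> (t \<le> u \<longrightarrow> G u v t \<le> v) \<and> (t > u \<longrightarrow> G u v t > v)"
    if "a < u" "u < b" "a < v" "v < b" "a < t" "t < b" for u v t
  proof (cases "t \<le> u")
    case True
    have "(v - a) * ((t - a) / (u - a)) \<le> v - a"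
      by (rule mult_left_le) (use True that in auto)
    moreover have "(t - a) * ((v - a) / (u - a)) = (v - a) * ((t - a) / (u - a))" by simp
    moreover have "(v - a) * ((t - a) / (u - a)) > 0" using that by simp
    ultimately show ?thesis using True that G1[of t u v] by linarith
  next
    case False
    have "(b - v) * ((b - t) / (b - u)) < (b - v) * 1"
      by (rule mult_strict_left_mono) (use False that in auto)
    moreover have "(b - t) * ((b - v) / (b - u)) = (b - v) * ((b - t) / (b - u))" by simp
    moreover have "(b - v) * ((b - t) / (b - u)) > 0" using that by simp
    ultimately show ?thesis using False that G2[of t u v] by (simp add: algebra_simps)
  qed
  have inv: "G v u (G u v t) = t" if "a < u" "u < b" "a < v" "v < b" for u v t
  proof (cases "t \<le> a \<or> b \<le> t")
    case True then show ?thesis by (simp add: G_def)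
  next
    case False
    then have t: "a < t" "t < b" by auto
    show ?thesis
    proof (cases "t \<le> u")
      case True
      then have e: "G u v t = a + (t - a) * ((v - a) / (u - a))" using t by (simp add: G_def)
      have "G v u (G u v t) = a + (G u v t - a) * ((u - a) / (v - a))"
        using inG[OF that t] True by (intro G1) auto
      then show ?thesis unfolding e using that by simp
    next
      case False
      then have e: "G u v t = b - (b - t) * ((b - v) / (b - u))" using t by (simp add: G_def)
      have "G v u (G u v t) = b - (b - G u v t) * ((b - u) / (b - v))"
        using inG[OF that t] False by (intro G2) auto
      then show ?thesis unfolding e using that by simp
    qed
  qed
  have "strict_mono (G u v)"
  proof (rule strict_monoI)
    fix s t :: real assume st: "s < t"
    consider "s \<le> a \<or> b \<le> t" | "a < s" "t < b" "t \<le> u" | "a < s" "t < b" "s \<le> u" "u < t"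
      | "a < s" "t < b" "u < s" by linarith
    then show "G u v s < G u v t"
    proof cases
      case 1
      then show ?thesis
      proof
        assume s: "s \<le> a"
        then have "G u v s = s" by (simp add: G_def)
        moreover have "G u v t = t \<or> a < G u v t" using inG[OF assms, of t] by (auto simp: G_def)
        ultimately show ?thesis using s st by auto
      next
        assume s: "b \<le> t"
        then have "G u v t = t" by (simp add: G_def)
        moreover have "G u v s = s \<or> b > G u v s" using inG[OF assms, of s] by (auto simp: G_def)
        ultimately show ?thesis using s st by auto
      qed
    next
      case 2
      have "(v - a) / (u - a) > 0" using assms by simp
      then show ?thesis using 2 st
        by (simp add: G_def mult_strict_right_mono del: times_divide_eq_right)
    next
      case 3
      then show ?thesis using inG[OF assms, of s] inG[OF assms, of t] st by auto
    next
      case 4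
      have "(b - v) / (b - u) > 0" using assms by simp
      then show ?thesis using 4 st
        by (simp add: G_def mult_strict_right_mono del: times_divide_eq_right)
    qed
  qed
  moreover have "surj (G u v)"
    by (rule surjI[of _ "G v u"]) (use inv[of v u] assms in auto)
  moreover have "G u v u = v" using assms by (simp add: G_def)
  moreover have "\<forall>t. a < t \<and> t < b \<longrightarrow> a < G u v t \<and> G u v t < b" using inG[OF assms] by blast
  ultimately show ?thesis
    by (intro exI[of _ "G u v"]) (auto simp: G_def)
qed

lemma sgn_eq_0: "sgn (x::real) = sgn y \<Longrightarrow> x = 0 \<longleftrightarrow> y = 0"
  by (metis sgn_0_0)

lemma sgn_eq_pos: "sgn (x::real) = sgn y \<Longrightarrow> x > 0 \<longleftrightarrow> y > 0"
  by (metis sgn_greater)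

lemma sgn_eq_neg: "sgn (x::real) = sgn y \<Longrightarrow> x < 0 \<longleftrightarrow> y < 0"
  by (metis sgn_less)

text \<open>To the right of \<open>t\<close> the polynomial \<open>p\<close> increases up to the
  next point \<open>z\<close> of \<open>Z\<close>. So \<open>p\<close> is positive at
  \<open>z\<close>, hence \<open>p2\<close> is positive at \<open>h z\<close>, and the intermediate
  value theorem applies. If no such \<open>z\<close> exists, the derivative of \<open>p2\<close>
  stays positive on the half-line beyond \<open>h t\<close>, so the leading coefficient of
  \<open>p2\<close> is positive and \<open>p2\<close> becomes positive eventually.\<close>

lemma match_root_up:
  fixes p p2 :: "real poly" and h :: "real \<Rightarrow> real"
  assumes h: "strict_mono h" "surj h" and fin: "finite Z"
    and Zp: "\<And>z. z \<in> Z \<Longrightarrow> sgn (poly p z) = sgn (poly p2 (h z))"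
    and d: "\<And>t. sgn (poly (pderiv p) t) = sgn (poly (pderiv p2) (h t))"
    and dz: "\<And>t. poly (pderiv p) t = 0 \<Longrightarrow> t \<in> Z"
    and pt: "poly p t \<ge> 0" and p2t: "poly p2 (h t) < 0" and up: "poly (pderiv p) t > 0"
    and tZ: "t \<notin> Z"
  shows "\<exists>s>t. poly p2 (h s) = 0 \<and> poly p s > 0 \<and> (\<forall>z\<in>Z. \<not> (t \<le> z \<and> z \<le> s))"
proof -
  have pos: "poly (pderiv p) y > 0" if "t \<le> y" "\<forall>z\<in>Z. \<not> (t \<le> z \<and> z \<le> y)" for y
    by (rule poly_pos_on_gap[of _ t]) (use that dz up in force)+
  have incr: "poly p t < poly p y" if "t < y" "\<forall>z\<in>Z. \<not> (t \<le> z \<and> z < y)" for y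
    by (rule poly_less_of_pderiv_pos) (use that in \<open>auto intro!: pos\<close>)
  obtain w where w: "t < w" "\<forall>z\<in>Z. \<not> (t \<le> z \<and> z < w)" "poly p2 (h w) > 0"
  proof (cases "{z\<in>Z. t < z} = {}")
    case True
    then have pos2: "poly (pderiv p2) (h y) > 0" if "y \<ge> t" for y
      using pos[of y] that d[of y] tZ sgn_eq_pos by (metis (mono_tags, lifting) empty_Collect_eq order_le_less)
    have nz: "pderiv p2 \<noteq> 0" using pos2[of t] by auto
    have deg: "degree p2 \<noteq> 0" using nz pderiv_eq_0_iff by blast
    have "lead_coeff p2 > 0"
    proof (rule ccontr)
      assume "\<not> lead_coeff p2 > 0"
      moreover have "lead_coeff p2 \<noteq> 0" using deg by (metis degree_0 leading_coeff_0_iff)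
      ultimately have "lead_coeff p2 < 0" by linarith
      then have "lead_coeff (- pderiv p2) > 0"
        using deg by (simp add: degree_pderiv coeff_pderiv mult_pos_neg)
      then obtain n where n: "\<And>x. x \<ge> n \<Longrightarrow> poly (- pderiv p2) x > 0"
        using poly_pinfty_gt_lc by (metis less_le_trans)
      obtain y where y: "h y = max n (h t)" using h(2) by (metis surjD)
      then have "y \<ge> t" using h(1) by (metis max.cobounded2 strict_mono_less_eq)
      with pos2[of y] n[of "h y"] y show False by auto
    qed
    then obtain n where n: "\<And>x. x \<ge> n \<Longrightarrow> poly p2 x > 0"
      using poly_pinfty_gt_lc by (metis less_le_trans)
    obtain w where w: "h w = max n (h t + 1)" using h(2) by (metis surjD)
    then have "h t < h w" by auto
    then have "t < w" using h(1) by (metis strict_mono_less)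
    then show thesis using that[of w] n[of "h w"] w True tZ by force
  next
    case False
    define z where "z = Min {z\<in>Z. t < z}"
    have z: "z \<in> Z" "t < z" using Min_in[of "{z\<in>Z. t < z}"] False fin by (auto simp: z_def)
    have m: "z \<le> y" if "y \<in> Z" "t < y" for y using that fin by (auto simp: z_def)
    have g: "\<forall>y\<in>Z. \<not> (t \<le> y \<and> y < z)" using m tZ by (metis order_le_less not_le)
    have "poly p z > 0" using incr[OF z(2) g] pt by simp
    then have "poly p2 (h z) > 0" using Zp[OF z(1)] sgn_eq_pos by blast
    then show thesis using that z g by blast
  qed
  have "h t < h w" using w(1) h(1) by (metis strict_mono_less)
  from poly_IVT_pos[OF this p2t w(3)] obtain v where v: "h t < v" "v < h w" "poly p2 v = 0" by blast
  obtain s where s: "v = h s" using h(2) by (metis surjD)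
  have st: "t < s" "s < w" using v s h(1) by (metis strict_mono_less)+
  then have g: "\<forall>z\<in>Z. \<not> (t \<le> z \<and> z \<le> s)" using w(2) by force
  then have "poly p t < poly p s" using incr[OF st(1)] by force
  then show ?thesis using st s v g pt by (intro exI[of _ s]) auto
qed

text \<open>A negative derivative at \<open>t\<close> is made positive by the reflection of the
  line, applied to both polynomials and to both sides of \<open>h\<close>.\<close>

lemma match_root:
  fixes p p2 :: "real poly" and h :: "real \<Rightarrow> real"
  assumes h: "strict_mono h" "surj h" and fin: "finite Z"
    and Zp: "\<And>z. z \<in> Z \<Longrightarrow> sgn (poly p z) = sgn (poly p2 (h z))"
    and d: "\<And>t. sgn (poly (pderiv p) t) = sgn (poly (pderiv p2) (h t))"
    and dz: "\<And>t. poly (pderiv p) t = 0 \<Longrightarrow> t \<in> Z"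
    and pt: "poly p t \<ge> 0" and p2t: "poly p2 (h t) < 0"
    and tZ: "t \<notin> Z"
  shows "\<exists>s. s \<noteq> t \<and> poly p2 (h s) = 0 \<and> poly p s > 0 \<and> (\<forall>z\<in>Z. \<not> (min t s \<le> z \<and> z \<le> max t s))"
proof (cases "poly (pderiv p) t > 0")
  case True
  show ?thesis using match_root_up[OF h fin Zp d dz pt p2t True tZ] by (force simp: min_def max_def)
next
  case False
  then have neg: "poly (pderiv p) t < 0" using dz tZ by force
  let ?r = "\<lambda>p::real poly. pcompose p [:0, -1:]"
  have "\<exists>s>-t. poly (?r p2) (- h (- s)) = 0 \<and> poly (?r p) s > 0 \<and> (\<forall>z\<in>uminus ` Z. \<not> (-t \<le> z \<and> z \<le> s))"
  proof (rule match_root_up)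
    show "strict_mono (\<lambda>s. - h (- s))" using h(1) by (simp add: strict_mono_def)
    have "\<exists>x. y = - h (- x)" for y
      using h(2) by (metis minus_minus surjD)
    then show "surj (\<lambda>s. - h (- s))" by (simp add: surj_def)
    show "finite (uminus ` Z)" using fin by simp
    show "sgn (poly (?r p) z) = sgn (poly (?r p2) (- h (- z)))" if "z \<in> uminus ` Z" for z
      using that Zp by (auto simp: poly_pcompose)
    show "sgn (poly (pderiv (?r p)) t) = sgn (poly (pderiv (?r p2)) (- h (- t)))" for t
      using d[of "-t"] by (simp add: poly_pcompose pderiv_pcompose pderiv_pCons sgn_mult sgn_minus)
    show "poly (pderiv (?r p)) t = 0 \<Longrightarrow> t \<in> uminus ` Z" for t
      using dz[of "-t"] by (force simp: poly_pcompose pderiv_pcompose pderiv_pCons)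
    show "- t \<notin> uminus ` Z" using tZ by auto
  qed (use pt p2t neg in \<open>auto simp: poly_pcompose pderiv_pcompose pderiv_pCons\<close>)
  then obtain s where s: "s > - t" "poly p2 (h (- s)) = 0" "poly p (- s) > 0"
    "\<forall>z\<in>uminus ` Z. \<not> (-t \<le> z \<and> z \<le> s)"
    by (auto simp: poly_pcompose)
  then show ?thesis by (intro exI[of _ "-s"]) (auto simp: min_def max_def)
qed


lemma sgn_poly_const_on_interval:
  fixes q :: "real poly"
  assumes "\<And>y. a < y \<Longrightarrow> y < b \<Longrightarrow> poly q y \<noteq> 0" "a < s" "s < b" "a < t" "t < b"
  shows "sgn (poly q s) = sgn (poly q t)"
proof -
  have *: "sgn (poly q s) = sgn (poly q t)"
    if "s < t" "a < s" "t < b" for s t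
  proof (rule ccontr)
    assume "sgn (poly q s) \<noteq> sgn (poly q t)"
    moreover have "poly q s \<noteq> 0" "poly q t \<noteq> 0"
      using assms(1)[of s] assms(1)[of t] that by linarith+
    ultimately
    consider "poly q s > 0" "poly q t < 0" | "poly q s < 0" "poly q t > 0"
      by (smt (verit) sgn_pos sgn_neg)
    then show False
    proof cases
      case 1
      then obtain x where "s < x" "x < t" "poly q x = 0" using poly_IVT_neg[OF \<open>s < t\<close>] by blast
      then show False using assms(1)[of x] that by linarith
    next
      case 2
      then obtain x where "s < x" "x < t" "poly q x = 0" using poly_IVT_pos[OF \<open>s < t\<close>] by blast
      then show False using assms(1)[of x] that by linarith
    qed
  qed
  show ?thesis using *[of s t] *[of t s] assms(2-5) by (metis linorder_less_linear)
qed

lemma finite_avoid_widen: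
  fixes W :: "real set"
  assumes "finite W" "\<forall>w\<in>W. \<not> (m \<le> w \<and> w \<le> M)"
  obtains a b where "a < m" "M < b" "\<forall>w\<in>W. \<not> (a < w \<and> w < b)"
proof -
  have "\<exists>a b. a < m \<and> M < b \<and> (\<forall>w\<in>W. \<not> (a < w \<and> w < b))"
    using assms
  proof (induction W rule: finite_induct)
    case empty
    then show ?case using lt_ex gt_ex by auto
  next
    case (insert w W)
    then obtain a b where ab: "a < m" "M < b" "\<forall>w\<in>W. \<not> (a < w \<and> w < b)" by auto
    consider "w < m" | "M < w" using insert.prems by force
    then show ?case
    proof cases
      case 1
      then show ?thesis using ab by (intro exI[of _ "max a w"] exI[of _ b]) auto
    next
      case 2
      then show ?thesis using ab by (intro exI[of _ a] exI[of _ "min b w"]) auto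
    qed
  qed
  then show thesis using that by blast
qed

text \<open>The induction step of the Cohen-Hoermander algorithm: an increasing bijection of the line matching
  the signs of the derivative of \<open>p\<close> and of polynomials whose roots see the sign of \<open>p\<close> (through the
  remainders of \<open>p\<close>) can be deformed, one root of \<open>p\<close> at a time, into one that also matches \<open>p\<close>.\<close>

lemma match_extend:
  fixes q q2 :: "'i \<Rightarrow> real poly" and p p2 :: "real poly"
  assumes fin: "finite J" and h: "strict_mono h" "surj h"
    and match: "\<And>j t. j \<in> J \<Longrightarrow> sgn (poly (q j) t) = sgn (poly (q2 j) (h t))"
    and k: "k \<in> J" "q k = pderiv p" "q2 k = pderiv p2"
    and nz: "pderiv p \<noteq> 0"
    and roots: "\<And>j z. j \<in> J \<Longrightarrow> q j \<noteq> 0 \<Longrightarrow> poly (q j) z = 0 \<Longrightarrow> sgn (poly p z) = sgn (poly p2 (h z))"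
  shows "\<exists>h'. strict_mono h' \<and> surj h' \<and>
    (\<forall>j\<in>J. \<forall>t. sgn (poly (q j) t) = sgn (poly (q2 j) (h' t))) \<and>
    (\<forall>t. sgn (poly p t) = sgn (poly p2 (h' t)))"
proof -
  define Z where "Z = (\<Union>j\<in>{j\<in>J. q j \<noteq> 0}. {z. poly (q j) z = 0})"
  have finZ: "finite Z" unfolding Z_def using fin by (auto simp: poly_roots_finite)
  have dZ: "t \<in> Z" if "poly (pderiv p) t = 0" for t
    using that k nz by (auto simp: Z_def)
  \<comment> \<open>Freezing the bijection on \<open>Z\<close> keeps the known agreement of
    \<open>p\<close> and \<open>p2\<close> at the roots of the other polynomials through all
    deformations.\<close>
  define good where "good g \<longleftrightarrow> strict_mono g \<and> surj g \<and>
      (\<forall>j\<in>J. \<forall>t. sgn (poly (q j) t) = sgn (poly (q2 j) (g t))) \<and> (\<forall>z\<in>Z. g z = h z)" for g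
  have good_p: "sgn (poly p z) = sgn (poly p2 (g z))" if "good g" "z \<in> Z" for g z
    using that roots by (auto simp: good_def Z_def)
  have good_d: "sgn (poly (pderiv p) t) = sgn (poly (pderiv p2) (g t))" if "good g" for g t
    using that k by (auto simp: good_def)
  have step: "\<exists>s. s \<noteq> t \<and> poly p2 (g s) = 0 \<and> poly p s \<noteq> 0 \<and> (\<forall>z\<in>Z. \<not> (min t s \<le> z \<and> z \<le> max t s))"
    if g: "good g" and t: "t \<notin> Z" "poly p t \<ge> 0 \<and> poly p2 (g t) < 0 \<or> poly p t \<le> 0 \<and> poly p2 (g t) > 0"
    for g t
  proof -
    have g': "strict_mono g" "surj g" using g by (auto simp: good_def)
    from t(2) show ?thesis
    proof
      assume a: "poly p t \<ge> 0 \<and> poly p2 (g t) < 0"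
      have "\<exists>s. s \<noteq> t \<and> poly p2 (g s) = 0 \<and> poly p s > 0 \<and> (\<forall>z\<in>Z. \<not> (min t s \<le> z \<and> z \<le> max t s))"
        by (rule match_root[OF g' finZ good_p[OF g] good_d[OF g] dZ]) (use a t(1) in auto)
      then show ?thesis by (metis less_irrefl)
    next
      assume a: "poly p t \<le> 0 \<and> poly p2 (g t) > 0"
      have "\<exists>s. s \<noteq> t \<and> poly (-p2) (g s) = 0 \<and> poly (-p) s > 0 \<and> (\<forall>z\<in>Z. \<not> (min t s \<le> z \<and> z \<le> max t s))"
        by (rule match_root[OF g' finZ])
          (use a t(1) good_p[OF g] good_d[OF g] dZ in \<open>auto simp: pderiv_minus sgn_minus\<close>)
      then show ?thesis by (metis less_irrefl neg_equal_0_iff_equal poly_minus neg_0_less_iff_less)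
    qed
  qed
  have ext: "\<exists>g. good g \<and> (\<forall>z\<in>F. poly p2 (g z) = 0)"
    if "finite F" "\<forall>z\<in>F. poly p z = 0 \<and> z \<notin> Z" for F
    using that
  proof (induction F rule: finite_induct)
    case empty
    have "good h" using h match by (auto simp: good_def)
    then show ?case by auto
  next
    case (insert x F)
    then obtain g where g: "good g" "\<forall>z\<in>F. poly p2 (g z) = 0" by auto
    have x: "poly p x = 0" "x \<notin> Z" using insert.prems by auto
    show ?case
    proof (cases "poly p2 (g x) = 0")
      case True
      then show ?thesis using g by auto
    next
      case False
      then obtain s where s: "s \<noteq> x" "poly p2 (g s) = 0" "\<forall>z\<in>Z. \<not> (min x s \<le> z \<and> z \<le> max x s)"
        using step[OF g(1) x(2)] x(1) by force
      \<comment> \<open>By Rolle's theorem a root of the derivative, hence a point of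
        \<open>Z\<close>, separates two roots of \<open>p\<close>; so the interval to be deformed
        contains no root treated earlier.\<close>
      have "\<not> (min x s \<le> y \<and> y \<le> max x s)" if y: "y \<in> F" for y
      proof
        assume yy: "min x s \<le> y \<and> y \<le> max x s"
        have "x \<noteq> y" using y insert by auto
        then have xy: "min x y < max x y" by auto
        have "poly p (min x y) = 0" "poly p (max x y) = 0"
          using x y insert.prems by (auto simp: min_def max_def)
        then obtain z where z: "min x y < z" "z < max x y" "poly (pderiv p) z = 0"
          using poly_MVT[OF xy, of p] xy by auto
        then show False using dZ[OF z(3)] s(3) yy by force
      qed
      then have "\<forall>w\<in>Z \<union> F. \<not> (min x s \<le> w \<and> w \<le> max x s)" using s(3) by auto
      then obtain a b where ab: "a < min x s" "max x s < b" "\<forall>w\<in>Z \<union> F. \<not> (a < w \<and> w < b)"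
        using finite_avoid_widen[of "Z \<union> F"] finZ insert.hyps by blast
      have mg: "g y < g z \<longleftrightarrow> y < z" for y z
        using g(1) by (simp add: good_def strict_mono_less)
      have gs: "g a < g x" "g x < g b" "g a < g s" "g s < g b"
        using ab(1,2) mg by simp_all
      obtain f where f: "strict_mono f" "surj f" "f (g x) = g s"
        "\<forall>t. \<not> (g a < t \<and> t < g b) \<longrightarrow> f t = t" "\<forall>t. g a < t \<and> t < g b \<longrightarrow> g a < f t \<and> f t < g b"
        using bump_bijection[OF gs] by (elim exE conjE) (rule that)
      have fx: "f (g w) = g w" if "w \<in> Z \<union> F" for w
        using f(4) ab(3) that mg by blast
      have "sgn (poly (q j) t) = sgn (poly (q2 j) (f (g t)))" if j: "j \<in> J" for j t
      proof -
        have gj: "sgn (poly (q j) t) = sgn (poly (q2 j) (g t))" for t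
          using g(1) j by (auto simp: good_def)
        show ?thesis
        proof (cases "a < t \<and> t < b")
          case False
          then show ?thesis using f(4) mg gj by metis
        next
          case True
          then have "g a < f (g t) \<and> f (g t) < g b" using f(5) mg by blast
          moreover obtain t' where t': "f (g t) = g t'" using g(1) by (metis good_def surjD)
          ultimately have ab': "a < t'" "t' < b" using mg by auto
          \<comment> \<open>The deformation moves points only within an interval free of
            \<open>Z\<close>, where each nonzero \<open>q j\<close> keeps its sign.\<close>
          have "sgn (poly (q j) t) = sgn (poly (q j) t')"
          proof (cases "q j = 0")
            case False
            then show ?thesis
              using True ab' ab(3) j by (intro sgn_poly_const_on_interval[of a b]) (auto simp: Z_def)
          qed simp
          then show ?thesis using gj t' by simp
        qed
      qed
      moreover have "strict_mono (f \<circ> g)"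
        using f(1) mg by (simp add: strict_mono_def)
      moreover have "surj (f \<circ> g)"
        using f(2) g(1) comp_surj unfolding good_def by blast
      moreover have "(f \<circ> g) z = h z" if "z \<in> Z" for z
        using fx[of z] that g(1) by (simp add: good_def)
      ultimately have "good (f \<circ> g)" unfolding good_def by simp
      moreover have "\<forall>z\<in>insert x F. poly p2 ((f \<circ> g) z) = 0" using g(2) fx f(3) s(2) by auto
      ultimately show ?thesis by blast
    qed
  qed
  have p0: "p \<noteq> 0" using nz by auto
  have "finite {z. poly p z = 0 \<and> z \<notin> Z}" using poly_roots_finite[OF p0] by (rule rev_finite_subset) auto
  from ext[OF this] obtain g where g: "good g" and g0: "\<And>z. poly p z = 0 \<Longrightarrow> z \<notin> Z \<Longrightarrow> poly p2 (g z) = 0"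
    by auto
  have r1: "poly p2 (g z) = 0" if "poly p z = 0" for z
    using g0[OF that] good_p[OF g, of z] that by (metis sgn_eq_0)
  have gb: "strict_mono g" "surj g" "inj g" using g by (auto simp: good_def strict_mono_imp_inj_on)
  define g_inv where "g_inv = inv_into UNIV g"
  have ig: "g (g_inv y) = y" "g_inv (g y) = y" for y using gb by (auto simp: g_inv_def surj_f_inv_f)
  \<comment> \<open>The root-matching argument is run with the inverse bijection and with
    \<open>p\<close> and \<open>p2\<close> exchanged: a surplus root of \<open>p2\<close> would
    produce a root of \<open>p\<close> whose image is no root of \<open>p2\<close>, contrary to
    \<open>r1\<close>.\<close>
  have r2: "poly p t = 0" if t: "poly p2 (g t) = 0" for t
  proof (rule ccontr)
    assume nt: "poly p t \<noteq> 0"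
    then have tZ: "t \<notin> Z" using good_p[OF g] t by (metis sgn_eq_0)
    have mi: "strict_mono g_inv" using gb ig by (metis strict_mono_def strict_mono_less)
    have si: "surj g_inv" using gb by (simp add: g_inv_def inj_imp_surj_inv)
    have "\<exists>s. poly p (g_inv s) = 0 \<and> poly p2 s \<noteq> 0"
    proof (cases "poly p t < 0")
      case True
      have "\<exists>s. s \<noteq> g t \<and> poly p (g_inv s) = 0 \<and> 0 < poly p2 s \<and> (\<forall>z\<in>g ` Z. \<not> (min (g t) s \<le> z \<and> z \<le> max (g t) s))"
      proof (rule match_root[OF mi si, of "g ` Z"])
        show "poly (pderiv p2) t = 0 \<Longrightarrow> t \<in> g ` Z" for t
          using dZ[of "g_inv t"] good_d[OF g, of "g_inv t"] ig by (metis image_eqI sgn_eq_0)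
      qed (use finZ good_p[OF g] good_d[OF g, of "g_inv _"] ig t tZ True gb(3) in \<open>auto simp: inj_image_mem_iff\<close>)
      then show ?thesis by force
    next
      case False
      have "\<exists>s. s \<noteq> g t \<and> poly (-p) (g_inv s) = 0 \<and> 0 < poly (-p2) s \<and> (\<forall>z\<in>g ` Z. \<not> (min (g t) s \<le> z \<and> z \<le> max (g t) s))"
      proof (rule match_root[OF mi si, of "g ` Z"])
        show "poly (pderiv (-p2)) t = 0 \<Longrightarrow> t \<in> g ` Z" for t
          using dZ[of "g_inv t"] good_d[OF g, of "g_inv t"] ig
          by (metis image_eqI sgn_eq_0 pderiv_minus poly_minus neg_equal_0_iff_equal)
      qed (use finZ good_p[OF g] good_d[OF g, of "g_inv _"] ig t tZ False nt gb(3)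
          in \<open>auto simp: inj_image_mem_iff pderiv_minus sgn_minus\<close>)
      then show ?thesis by force
    qed
    then show False using r1 ig by metis
  qed
  have "sgn (poly p t) = sgn (poly p2 (g t))" for t
  proof (cases "poly p t = 0 \<or> t \<in> Z")
    case True
    then show ?thesis using r1 good_p[OF g] by auto
  next
    case False
    then have "poly p2 (g t) \<noteq> 0" using r2 by blast
    moreover have "\<not> (poly p t > 0 \<and> poly p2 (g t) < 0 \<or> poly p t < 0 \<and> poly p2 (g t) > 0)"
      using step[OF g, of t] False r2 by (metis order_less_imp_le)
    ultimately show ?thesis using False by (auto simp: sgn_real_def)
  qed
  then show ?thesis using g unfolding good_def by blast
qed

section \<open>The Tarski-Seidenberg theorem\<close>

locale function_ring =
  fixes A :: "('x \<Rightarrow> real) set"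
  assumes const [intro, simp]: "(\<lambda>x. c) \<in> A"
    and add [intro]: "f \<in> A \<Longrightarrow> g \<in> A \<Longrightarrow> (\<lambda>x. f x + g x) \<in> A"
    and mult [intro]: "f \<in> A \<Longrightarrow> g \<in> A \<Longrightarrow> (\<lambda>x. f x * g x) \<in> A"
begin

lemma diff [intro]: "f \<in> A \<Longrightarrow> g \<in> A \<Longrightarrow> (\<lambda>x. f x - g x) \<in> A"
  using add[of f "\<lambda>x. (-1) * g x"] mult[OF const[of "-1"]] by simp

lemma sum: "(\<And>i. i \<in> I \<Longrightarrow> f i \<in> A) \<Longrightarrow> (\<lambda>x. \<Sum>i\<in>I. f i x) \<in> A"
  by (induction I rule: infinite_finite_induct) auto

lemma prod: "(\<And>i. i \<in> I \<Longrightarrow> f i \<in> A) \<Longrightarrow> (\<lambda>x. \<Prod>i\<in>I. f i x) \<in> A"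
  by (induction I rule: infinite_finite_induct) auto

lemma power: "f \<in> A \<Longrightarrow> (\<lambda>x. f x ^ n) \<in> A"
  by (induction n) auto

end

text \<open>A polynomial in one variable whose coefficients are functions of the parameter
  \<open>x\<close>. The bound \<open>n\<close> is strict and uniform in \<open>x\<close>; the actual
  degree may drop for particular \<open>x\<close>, which is the source of all case distinctions on
  leading coefficients below.\<close>

definition poly_over :: "('x \<Rightarrow> real) set \<Rightarrow> nat \<Rightarrow> ('x \<Rightarrow> real poly) set" where
  "poly_over A n = {P. (\<forall>i. (\<lambda>x. coeff (P x) i) \<in> A) \<and> (\<forall>x. \<forall>i\<ge>n. coeff (P x) i = 0)}"

lemma poly_over_mono: "m \<le> n \<Longrightarrow> poly_over A m \<subseteq> poly_over A n"
  by (auto simp: poly_over_def)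

lemma poly_overD: "P \<in> poly_over A n \<Longrightarrow> (\<lambda>x. coeff (P x) i) \<in> A"
  "P \<in> poly_over A n \<Longrightarrow> n \<le> i \<Longrightarrow> coeff (P x) i = 0"
  by (auto simp: poly_over_def)

context function_ring
begin

lemma poly_over_const:
  assumes "f \<in> A"
  shows "(\<lambda>x. [:f x:]) \<in> poly_over A 1"
proof -
  have "(\<lambda>x. coeff [:f x:] i) \<in> A" for i using assms by (cases i) auto
  then show ?thesis by (auto simp: poly_over_def coeff_pCons split: nat.split)
qed

lemma poly_over_X: "(\<lambda>x. [:0, 1:]) \<in> poly_over A 2"
  by (auto simp: poly_over_def coeff_pCons split: nat.split)

lemma poly_over_add: "P \<in> poly_over A m \<Longrightarrow> Q \<in> poly_over A n \<Longrightarrow> (\<lambda>x. P x + Q x) \<in> poly_over A (max m n)"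
  by (auto simp: poly_over_def)

lemma poly_over_mult:
  assumes "P \<in> poly_over A m" "Q \<in> poly_over A n"
  shows "(\<lambda>x. P x * Q x) \<in> poly_over A (m + n)"
proof -
  have "(\<lambda>x. coeff (P x * Q x) i) \<in> A" for i
    unfolding coeff_mult by (rule sum) (use assms in \<open>auto simp: poly_over_def\<close>)
  moreover have "coeff (P x * Q x) i = 0" if "m + n \<le> i" for i x
    unfolding coeff_mult
  proof (rule sum.neutral, rule ballI)
    fix k assume "k \<in> {..i}"
    show "coeff (P x) k * coeff (Q x) (i - k) = 0"
      using poly_overD(2)[OF assms(1), of k x] poly_overD(2)[OF assms(2), of "i - k" x] that
      by (cases "k < m") auto
  qed
  ultimately show ?thesis by (auto simp: poly_over_def)
qed

lemma poly_over_pderiv: "P \<in> poly_over A (Suc n) \<Longrightarrow> (\<lambda>x. pderiv (P x)) \<in> poly_over A n"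
  by (auto simp: poly_over_def coeff_pderiv simp del: of_nat_Suc)

lemma poly_over_cutoff:
  assumes "P \<in> poly_over A n"
  shows "(\<lambda>x. poly_cutoff m (P x)) \<in> poly_over A m"
proof -
  have "(\<lambda>x. coeff (poly_cutoff m (P x)) i) \<in> A" for i
    using poly_overD(1)[OF assms] by (cases "i < m") (auto simp: coeff_poly_cutoff)
  then show ?thesis by (auto simp: poly_over_def coeff_poly_cutoff)
qed

text \<open>Division without denominators: multiplying by the coefficient of index \<open>m\<close>
  allows the top term to be cancelled while all coefficients stay in \<open>A\<close>. The identity
  holds at every \<open>x\<close>, including those where that coefficient vanishes.\<close>

lemma pseudo_remainder:
  assumes Q: "Q \<in> poly_over A (Suc m)" and P: "P \<in> poly_over A n"
  shows "\<exists>R k S. R \<in> poly_over A m \<and>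
    (\<forall>x. smult (coeff (Q x) m ^ k) (P x) = S x * Q x + R x)"
  using P
proof (induction n arbitrary: P)
  case 0
  then have "P \<in> poly_over A m" using poly_over_mono by blast
  then show ?case by (intro exI[of _ P] exI[of _ 0] exI[of _ "\<lambda>x. 0"]) auto
next
  case (Suc n)
  show ?case
  proof (cases "Suc n \<le> m")
    case True
    then have "P \<in> poly_over A m" using poly_over_mono Suc.prems by blast
    then show ?thesis by (intro exI[of _ P] exI[of _ 0] exI[of _ "\<lambda>x. 0"]) auto
  next
    case False
    then have mn: "m \<le> n" by simp
    define P1 where "P1 = (\<lambda>x. smult (coeff (Q x) m) (P x) - monom (coeff (P x) n) (n - m) * Q x)"
    have "P1 \<in> poly_over A n"
    proof -
      have "(\<lambda>x. coeff (P1 x) i) \<in> A" for i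
        unfolding P1_def coeff_diff coeff_smult coeff_monom_mult
        using poly_overD(1)[OF Suc.prems] poly_overD(1)[OF Q]
        by (cases "n - m \<le> i") (simp_all add: diff mult)
      moreover have "coeff (P1 x) i = 0" if "n \<le> i" for i x
        unfolding P1_def coeff_diff coeff_smult coeff_monom_mult
        using poly_overD(2)[OF Suc.prems, of i x] poly_overD(2)[OF Q, of "i - (n - m)" x] that mn
        by (cases "i = n") auto
      ultimately show ?thesis by (auto simp: poly_over_def)
    qed
    from Suc.IH[OF this] obtain R k S where R: "R \<in> poly_over A m"
      "\<And>x. smult (coeff (Q x) m ^ k) (P1 x) = S x * Q x + R x" by blast
    have "smult (coeff (Q x) m ^ Suc k) (P x) =
        (S x + smult (coeff (Q x) m ^ k) (monom (coeff (P x) n) (n - m))) * Q x + R x" for x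
      using R(2)[of x] by (simp add: P1_def algebra_simps smult_diff_right)
    then show ?thesis using R(1)
      by (intro exI[of _ R] exI[of _ "Suc k"]
          exI[of _ "\<lambda>x. S x + smult (coeff (Q x) m ^ k) (monom (coeff (P x) n) (n - m))"]) blast
  qed
qed

end

definition same_signs :: "('x \<Rightarrow> real) set \<Rightarrow> 'x \<Rightarrow> 'x \<Rightarrow> bool" where
  "same_signs B x y \<longleftrightarrow> (\<forall>b\<in>B. sgn (b x) = sgn (b y))"

text \<open>An increasing bijection of the line encodes equality of sign diagrams without
  enumerating roots or intervals.\<close>

definition sign_iso :: "('x \<Rightarrow> real poly) set \<Rightarrow> 'x \<Rightarrow> 'x \<Rightarrow> bool" where
  "sign_iso F x y \<longleftrightarrow> (\<exists>h. strict_mono h \<and> surj h \<and>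
     (\<forall>P\<in>F. \<forall>t. sgn (poly (P x) t) = sgn (poly (P y) (h t))))"

definition tame :: "('x \<Rightarrow> real) set \<Rightarrow> ('x \<Rightarrow> real poly) set \<Rightarrow> bool" where
  "tame A F \<longleftrightarrow> (\<exists>B\<subseteq>A. finite B \<and> (\<forall>x y. same_signs B x y \<longrightarrow> sign_iso F x y))"

lemma same_signs_Un: "same_signs (B \<union> C) x y \<longleftrightarrow> same_signs B x y \<and> same_signs C x y"
  by (auto simp: same_signs_def)

lemma poly_cutoff_eq: "(\<And>i. i \<ge> n \<Longrightarrow> coeff p i = 0) \<Longrightarrow> poly_cutoff n p = p"
  by (rule poly_eqI) (simp add: coeff_poly_cutoff)

context function_ring
begin

text \<open>At a root of \<open>Q\<close> the polynomial \<open>P\<close> has, up to a power of the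
  leading coefficient of \<open>Q\<close>, the value of its pseudo-remainder. So the signs of
  coefficients, together with the diagram of the derivative and of the remainders, which all have
  smaller degree bound, determine the diagram of \<open>P\<close> by \<open>match_extend\<close>.
  Where the top coefficient of \<open>P\<close> vanishes, \<open>P\<close> agrees with its
  truncation and the induction hypothesis applies directly.\<close>

lemma tame_insert:
  assumes F: "finite F" "F \<subseteq> poly_over A (Suc n)" and P: "P \<in> poly_over A (Suc n)"
    and IH: "\<And>L. finite L \<Longrightarrow> L \<subseteq> poly_over A n \<Longrightarrow> tame A (L \<union> F)"
  shows "tame A (insert P F)"
proof -
  define D where "D = (\<lambda>x. pderiv (P x))"
  have D: "D \<in> poly_over A n" unfolding D_def by (rule poly_over_pderiv[OF P])
  define G where "G = insert D F"
  have G: "finite G" "G \<subseteq> poly_over A (Suc n)"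
    using F D poly_over_mono[of n "Suc n" A] by (auto simp: G_def)
  have "\<exists>R k S. R \<in> poly_over A i \<and>
      (\<forall>x. smult (coeff (poly_cutoff (Suc i) (Q x)) i ^ k) (P x) = S x * poly_cutoff (Suc i) (Q x) + R x)"
    if "Q \<in> G" for Q i
    by (rule pseudo_remainder[OF poly_over_cutoff P]) (use that G in blast)
  then obtain R k S where R: "\<And>Q i. Q \<in> G \<Longrightarrow> R Q i \<in> poly_over A i"
    and RS: "\<And>Q i x. Q \<in> G \<Longrightarrow> smult (coeff (poly_cutoff (Suc i) (Q x)) i ^ k Q i) (P x)
        = S Q i x * poly_cutoff (Suc i) (Q x) + R Q i x"
    by metis
  \<comment> \<open>The degree of \<open>Q x\<close> depends on \<open>x\<close>, so the remainder
    modulo each truncation of \<open>Q\<close> is included.\<close>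
  define L where "L = insert D ((\<lambda>(Q, i). R Q i) ` (G \<times> {..n}))"
  have "finite L" using G by (simp add: L_def)
  moreover have "L \<subseteq> poly_over A n"
    using D R poly_over_mono[of _ n A] by (force simp: L_def)
  ultimately have "tame A (L \<union> F)" by (rule IH)
  then obtain B1 where B1: "B1 \<subseteq> A" "finite B1" "\<And>x y. same_signs B1 x y \<Longrightarrow> sign_iso (L \<union> F) x y"
    unfolding tame_def by blast
  have "tame A ({\<lambda>x. poly_cutoff n (P x)} \<union> F)"
    by (rule IH) (use poly_over_cutoff[OF P] in auto)
  then obtain B2 where B2: "B2 \<subseteq> A" "finite B2"
    "\<And>x y. same_signs B2 x y \<Longrightarrow> sign_iso ({\<lambda>x. poly_cutoff n (P x)} \<union> F) x y"
    unfolding tame_def by blast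
  define B3 where "B3 = (\<lambda>(Q, i). (\<lambda>x. coeff (Q x) i)) ` (insert P G \<times> {..n})"
  have B3: "finite B3" "B3 \<subseteq> A"
    using G P poly_overD(1)[where A = A and n = "Suc n"] by (auto simp: B3_def)
  have "sign_iso (insert P F) x y" if ss: "same_signs (B1 \<union> B2 \<union> B3) x y" for x y
  proof -
    have cs: "sgn (coeff (Q x) i) = sgn (coeff (Q y) i)" if Q: "Q \<in> insert P G" for Q i
    proof (cases "i \<le> n")
      case True
      then have "(\<lambda>x. coeff (Q x) i) \<in> B3" using Q by (force simp: B3_def)
      then show ?thesis
        using bspec[OF ss[unfolded same_signs_def], of "\<lambda>x. coeff (Q x) i"] by simp
    next
      case False
      then show ?thesis using poly_overD(2)[of Q A "Suc n" i] Q G P by auto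
    qed
    have c0: "coeff (Q x) i = 0 \<longleftrightarrow> coeff (Q y) i = 0" if "Q \<in> insert P G" for Q i
      by (rule sgn_eq_0[OF cs[OF that]])
    show ?thesis
    proof (cases "coeff (P x) n = 0")
      case True
      then have "coeff (P y) n = 0" using c0[of P n] by simp
      then have "poly_cutoff n (P z) = P z" if "z \<in> {x, y}" for z
        using that True poly_overD(2)[OF P]
        by (intro poly_cutoff_eq) (metis Suc_leI empty_iff insert_iff le_neq_implies_less)
      moreover have "sign_iso ({\<lambda>x. poly_cutoff n (P x)} \<union> F) x y"
        using B2(3) ss by (simp add: same_signs_Un)
      ultimately show ?thesis by (auto simp: sign_iso_def)
    next
      case nz: False
      have "sign_iso (L \<union> F) x y" using B1(3) ss by (simp add: same_signs_Un)
      then obtain h where h: "strict_mono h" "surj h"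
        "\<And>Q t. Q \<in> L \<union> F \<Longrightarrow> sgn (poly (Q x) t) = sgn (poly (Q y) (h t))"
        unfolding sign_iso_def by blast
      show ?thesis
      proof (cases "pderiv (P x) = 0")
        case True
        then have dx: "degree (P x) = 0" by (simp add: pderiv_eq_0_iff)
        then have "coeff (P y) i = 0" if "i \<noteq> 0" for i
          using c0[of P i] that coeff_eq_0[of "P x" i] by simp
        then have dy: "degree (P y) = 0" by (metis degree_0 leading_coeff_0_iff)
        have "sgn (poly (P x) t) = sgn (poly (P y) (h t))" for t
          using cs[of P 0] dx dy by (auto elim!: degree_eq_zeroE)
        then show ?thesis using h unfolding sign_iso_def by blast
      next
        case False
        have "\<exists>h'. strict_mono h' \<and> surj h' \<and>
          (\<forall>Q\<in>G. \<forall>t. sgn (poly (Q x) t) = sgn (poly (Q y) (h' t))) \<and>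
          (\<forall>t. sgn (poly (P x) t) = sgn (poly (P y) (h' t)))"
        proof (rule match_extend[OF G(1) h(1,2)])
          show "sgn (poly (Q x) t) = sgn (poly (Q y) (h t))" if "Q \<in> G" for Q t
            using h(3) that by (auto simp: G_def L_def)
          show "D \<in> G" "D x = pderiv (P x)" "D y = pderiv (P y)" by (auto simp: G_def D_def)
          show "pderiv (P x) \<noteq> 0" by fact
          fix Q z assume Q: "Q \<in> G" "Q x \<noteq> 0" "poly (Q x) z = 0"
          define i where "i = degree (Q x)"
          have "coeff (Q x) i \<noteq> 0" using Q by (simp add: i_def)
          then have i: "i \<le> n" using poly_overD(2)[of Q A "Suc n" i x] Q G by force
          have cx: "poly_cutoff (Suc i) (Q x) = Q x"
            by (rule poly_cutoff_eq) (simp add: i_def coeff_eq_0)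
          have "coeff (Q y) j = 0" if "j \<ge> Suc i" for j
            using c0[of Q j] Q(1) that coeff_eq_0[of "Q x" j] by (simp add: i_def)
          then have cy: "poly_cutoff (Suc i) (Q y) = Q y" by (rule poly_cutoff_eq)
          have "sgn (poly (Q x) z) = sgn (poly (Q y) (h z))"
            using h(3) Q(1) by (auto simp: G_def L_def)
          then have Qy: "poly (Q y) (h z) = 0" using Q(3) sgn_eq_0 by blast
          have "R Q i \<in> L" using Q i by (force simp: L_def)
          then have "sgn (poly (R Q i x) z) = sgn (poly (R Q i y) (h z))" using h(3) by blast
          moreover have "coeff (Q x) i ^ k Q i * poly (P x) z = poly (R Q i x) z"
            using arg_cong[OF RS[OF Q(1), of i x], of "\<lambda>p. poly p z"] cx Q(3) by simp
          moreover have "coeff (Q y) i ^ k Q i * poly (P y) (h z) = poly (R Q i y) (h z)"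
            using arg_cong[OF RS[OF Q(1), of i y], of "\<lambda>p. poly p (h z)"] cy Qy by simp
          ultimately have "sgn (coeff (Q x) i) ^ k Q i * sgn (poly (P x) z)
              = sgn (coeff (Q y) i) ^ k Q i * sgn (poly (P y) (h z))"
            by (metis power_sgn sgn_mult)
          moreover have "sgn (coeff (Q x) i) = sgn (coeff (Q y) i)" using cs Q(1) by blast
          moreover have "sgn (coeff (Q x) i) ^ k Q i \<noteq> 0"
            using \<open>coeff (Q x) i \<noteq> 0\<close> by (simp add: sgn_0_0)
          ultimately show "sgn (poly (P x) z) = sgn (poly (P y) (h z))" by auto
        qed
        then show ?thesis unfolding sign_iso_def G_def by blast
      qed
    qed
  qed
  moreover have "finite (B1 \<union> B2 \<union> B3)" "B1 \<union> B2 \<union> B3 \<subseteq> A" using B1 B2 B3 by auto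
  ultimately show ?thesis unfolding tame_def by blast
qed

text \<open>The outer induction is on the degree bound, the inner one on the number of polynomials
  of the top bound. Since an insertion adds a derivative and remainders, the inner statement allows
  an arbitrary finite set of polynomials of smaller bound.\<close>

lemma tame_finite:
  assumes "finite F" "F \<subseteq> poly_over A n"
  shows "tame A F"
  using assms
proof (induction n arbitrary: F)
  case 0
  have z: "P x = 0" if "P \<in> F" for P x
    by (rule poly_eqI) (use poly_overD(2)[of P A 0] that 0 in auto)
  have "strict_mono (id :: real \<Rightarrow> real)" by (simp add: strict_mono_def)
  then show ?case
    unfolding tame_def sign_iso_def
    by (intro exI[of _ "{}"] conjI allI impI exI[of _ id]) (auto simp: z)
next
  case (Suc n)
  have "tame A (L \<union> H)" if "finite H" "H \<subseteq> poly_over A (Suc n)" "finite L" "L \<subseteq> poly_over A n" for L H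
    using that
  proof (induction H arbitrary: L rule: finite_induct)
    case empty
    then show ?case using Suc.IH by simp
  next
    case (insert P H)
    have "tame A (insert P (L \<union> H))"
    proof (rule tame_insert)
      show "finite (L \<union> H)" "P \<in> poly_over A (Suc n)" using insert by auto
      show "L \<union> H \<subseteq> poly_over A (Suc n)"
        using insert poly_over_mono[of n "Suc n" A] by auto
      show "tame A (M \<union> (L \<union> H))" if "finite M" "M \<subseteq> poly_over A n" for M
        using insert.IH[of "M \<union> L"] insert.prems that by (simp add: Un_assoc)
    qed
    then show ?case by simp
  qed
  from this[of F "{}"] Suc.prems show ?case by simp
qed

end

section \<open>Polynomials in named variables, semialgebraic sets and their projections\<close>

inductive_set pol :: "'v set \<Rightarrow> (('v \<Rightarrow> real) \<Rightarrow> real) set" for V where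
  pol_const: "(\<lambda>x. c) \<in> pol V"
| pol_var: "i \<in> V \<Longrightarrow> (\<lambda>x. x i) \<in> pol V"
| pol_add: "f \<in> pol V \<Longrightarrow> g \<in> pol V \<Longrightarrow> (\<lambda>x. f x + g x) \<in> pol V"
| pol_mult: "f \<in> pol V \<Longrightarrow> g \<in> pol V \<Longrightarrow> (\<lambda>x. f x * g x) \<in> pol V"

interpretation pol: function_ring "pol V"
  by unfold_locales (auto intro: pol.intros)

lemma pol_mono: "V \<subseteq> W \<Longrightarrow> pol V \<subseteq> pol W"
proof
  fix f assume VW: "V \<subseteq> W" and "f \<in> pol V"
  from this(2) show "f \<in> pol W" by induction (use VW in \<open>auto intro: pol.intros\<close>)
qed

lemma pol_cong: "f \<in> pol V \<Longrightarrow> (\<And>i. i \<in> V \<Longrightarrow> x i = y i) \<Longrightarrow> f x = f y"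
  by (induction f rule: pol.induct) auto

lemma pol_insert_poly:
  assumes "f \<in> pol (insert j V)"
  shows "\<exists>P n. P \<in> poly_over (pol V) n \<and> (\<forall>x t. f (x(j := t)) = poly (P x) t)"
  using assms
proof (induction f rule: pol.induct)
  case (pol_const c)
  then show ?case
    by (intro exI[of _ "\<lambda>x. [:c:]"] exI[of _ 1])
      (auto simp del: One_nat_def intro!: pol.poly_over_const)
next
  case (pol_var i)
  show ?case
  proof (cases "i = j")
    case True
    then show ?thesis
      by (intro exI[of _ "\<lambda>x. [:0, 1:]"] exI[of _ 2]) (auto intro: pol.poly_over_X)
  next
    case False
    then show ?thesis using pol_var
      by (intro exI[of _ "\<lambda>x. [:x i:]"] exI[of _ 1])
        (auto simp del: One_nat_def intro!: pol.poly_over_const pol.intros)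
  qed
next
  case (pol_add f g)
  then obtain P m Q n where PQ: "P \<in> poly_over (pol V) m" "\<And>x t. f (x(j := t)) = poly (P x) t"
    "Q \<in> poly_over (pol V) n" "\<And>x t. g (x(j := t)) = poly (Q x) t" by blast
  show ?case
    by (rule exI[of _ "\<lambda>x. P x + Q x"], rule exI[of _ "max m n"], intro conjI allI)
      (rule pol.poly_over_add[OF PQ(1,3)], simp only: PQ poly_add)
next
  case (pol_mult f g)
  then obtain P m Q n where PQ: "P \<in> poly_over (pol V) m" "\<And>x t. f (x(j := t)) = poly (P x) t"
    "Q \<in> poly_over (pol V) n" "\<And>x t. g (x(j := t)) = poly (Q x) t" by blast
  show ?case
    by (rule exI[of _ "\<lambda>x. P x * Q x"], rule exI[of _ "m + n"], intro conjI allI)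
      (rule pol.poly_over_mult[OF PQ(1,3)], simp only: PQ poly_mult)
qed

text \<open>Being determined by the signs of finitely many polynomials is equivalent to being a boolean
  combination of polynomial inequalities, and avoids normal forms.\<close>

definition semialg :: "'v set \<Rightarrow> ('v \<Rightarrow> real) set \<Rightarrow> bool" where
  "semialg V S \<longleftrightarrow>
     (\<exists>C\<subseteq>pol V. finite C \<and> (\<forall>x y. same_signs C x y \<longrightarrow> (x \<in> S \<longleftrightarrow> y \<in> S)))"

lemma semialg_mono:
  assumes "semialg V S" "V \<subseteq> W"
  shows "semialg W S"
proof -
  obtain C where C: "C\<subseteq>pol V" "finite C" "\<And>x y. same_signs C x y \<Longrightarrow> (x \<in> S \<longleftrightarrow> y \<in> S)"
    using assms(1) unfolding semialg_def by blast
  have "C \<subseteq> pol W" using C(1) pol_mono[OF assms(2)] by (rule subset_trans)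
  with C(2,3) show ?thesis unfolding semialg_def by blast
qed

lemma semialg_Compl:
  assumes "semialg V S"
  shows "semialg V (- S)"
proof -
  obtain C where C: "C\<subseteq>pol V" "finite C" "\<And>x y. same_signs C x y \<Longrightarrow> (x \<in> S \<longleftrightarrow> y \<in> S)"
    using assms unfolding semialg_def by blast
  have "x \<in> - S \<longleftrightarrow> y \<in> - S" if "same_signs C x y" for x y
    using C(3)[OF that] by blast
  with C(1,2) show ?thesis unfolding semialg_def by blast
qed

lemma semialg_Int:
  assumes "semialg V S" "semialg V T"
  shows "semialg V (S \<inter> T)"
proof -
  obtain C where C: "C\<subseteq>pol V" "finite C" "\<And>x y. same_signs C x y \<Longrightarrow> (x \<in> S \<longleftrightarrow> y \<in> S)"
    using assms(1) unfolding semialg_def by blast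
  obtain D where D: "D\<subseteq>pol V" "finite D" "\<And>x y. same_signs D x y \<Longrightarrow> (x \<in> T \<longleftrightarrow> y \<in> T)"
    using assms(2) unfolding semialg_def by blast
  show ?thesis
    unfolding semialg_def
  proof (intro exI[of _ "C \<union> D"] conjI allI impI)
    fix x y assume "same_signs (C \<union> D) x y"
    then have xy: "same_signs C x y" "same_signs D x y" by (simp_all add: same_signs_Un)
    show "x \<in> S \<inter> T \<longleftrightarrow> y \<in> S \<inter> T" using C(3)[OF xy(1)] D(3)[OF xy(2)] by blast
  qed (use C(1,2) D(1,2) in auto)
qed

lemma semialg_Un: "semialg V S \<Longrightarrow> semialg V T \<Longrightarrow> semialg V (S \<union> T)"
  using semialg_Compl[OF semialg_Int[OF semialg_Compl semialg_Compl], of V S T]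
  by (simp only: Compl_Int double_complement)

lemma
  assumes "f \<in> pol V"
  shows semialg_pos: "semialg V {x. f x > 0}" and semialg_zero: "semialg V {x. f x = 0}"
    and semialg_nonneg: "semialg V {x. f x \<ge> 0}"
proof -
  have *: "semialg V {x. R (f x)}" if "\<And>x y. sgn x = sgn y \<Longrightarrow> R x = R y" for R
    unfolding semialg_def same_signs_def
  proof (intro exI[of _ "{f}"] conjI allI impI)
    fix x y assume "\<forall>b\<in>{f}. sgn (b x) = sgn (b y)"
    then have "sgn (f x) = sgn (f y)" by simp
    from that[OF this] show "x \<in> {x. R (f x)} \<longleftrightarrow> y \<in> {x. R (f x)}" by simp
  qed (use assms in auto)
  show "semialg V {x. f x > 0}" using *[of "\<lambda>a. a > 0"] sgn_eq_pos by blast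
  show "semialg V {x. f x = 0}" using *[of "\<lambda>a. a = 0"] sgn_eq_0 by blast
  have "0 \<le> a \<longleftrightarrow> 0 \<le> b" if "sgn a = sgn b" for a b :: real
    using sgn_eq_neg[OF that] by linarith
  then show "semialg V {x. f x \<ge> 0}" using *[of "\<lambda>a. a \<ge> 0"] by blast
qed

theorem semialg_project:
  assumes "semialg (insert j V) S"
  shows "semialg V {x. \<exists>t. x(j := t) \<in> S}"
proof -
  obtain C where C: "C \<subseteq> pol (insert j V)" "finite C" "\<And>x y. same_signs C x y \<Longrightarrow> (x \<in> S \<longleftrightarrow> y \<in> S)"
    using assms(1) unfolding semialg_def by blast
  have "\<forall>c\<in>C. \<exists>P n. P \<in> poly_over (pol V) n \<and> (\<forall>x t. c (x(j := t)) = poly (P x) t)"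
  proof
    fix c assume "c \<in> C"
    then have "c \<in> pol (insert j V)" using C(1) by (rule rev_subsetD)
    then show "\<exists>P n. P \<in> poly_over (pol V) n \<and> (\<forall>x t. c (x(j := t)) = poly (P x) t)"
      by (rule pol_insert_poly)
  qed
  from bchoice[OF this] obtain P where
    "\<forall>c\<in>C. \<exists>n. P c \<in> poly_over (pol V) n \<and> (\<forall>x t. c (x(j := t)) = poly (P c x) t)" ..
  from bchoice[OF this] obtain n where n:
    "\<forall>c\<in>C. P c \<in> poly_over (pol V) (n c) \<and> (\<forall>x t. c (x(j := t)) = poly (P c x) t)" ..
  have P: "P c \<in> poly_over (pol V) (n c)" if "c \<in> C" for c
    by (rule conjunct1[OF bspec[OF n that]])
  have cP: "c (x(j := t)) = poly (P c x) t" if "c \<in> C" for c x t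
    by (rule spec[OF spec[OF conjunct2[OF bspec[OF n that]]]])
  have "P c \<in> poly_over (pol V) (Max (n ` C))" if "c \<in> C" for c
  proof (rule subsetD[OF poly_over_mono P[OF that]])
    show "n c \<le> Max (n ` C)" using C(2) that by simp
  qed
  then have "P ` C \<subseteq> poly_over (pol V) (Max (n ` C))" by (rule image_subsetI)
  with finite_imageI[OF C(2)] have "tame (pol V) (P ` C)" by (rule pol.tame_finite)
  then obtain B where B: "B \<subseteq> pol V" "finite B" "\<And>x y. same_signs B x y \<Longrightarrow> sign_iso (P ` C) x y"
    unfolding tame_def by blast
  have lift: "\<exists>t. y(j := t) \<in> S" if xy: "same_signs B x y" and x: "\<exists>t. x(j := t) \<in> S" for x y
  proof -
    obtain t where t: "x(j := t) \<in> S" using x by blast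
    obtain h where h: "\<forall>Q\<in>P ` C. \<forall>t. sgn (poly (Q x) t) = sgn (poly (Q y) (h t))"
      using B(3)[OF xy] unfolding sign_iso_def by blast
    have "same_signs C (x(j := t)) (y(j := h t))"
      unfolding same_signs_def
    proof
      fix c assume c: "c \<in> C"
      from bspec[OF h imageI[OF c]]
      have "sgn (poly (P c x) t) = sgn (poly (P c y) (h t))" by (rule spec)
      then show "sgn (c (x(j := t))) = sgn (c (y(j := h t)))" by (simp only: cP[OF c])
    qed
    from C(3)[OF this] t have "y(j := h t) \<in> S" by (rule iffD1)
    then show ?thesis by (rule exI)
  qed
  show ?thesis unfolding semialg_def
  proof (intro exI[of _ B] conjI allI impI B(1,2))
    fix x y assume xy: "same_signs B x y"
    then have "same_signs B y x" by (simp add: same_signs_def)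
    from lift[OF xy] lift[OF this]
    show "(x \<in> {x. \<exists>t. x(j := t) \<in> S}) = (y \<in> {x. \<exists>t. x(j := t) \<in> S})"
      unfolding mem_Collect_eq by (rule iffI)
  qed
qed

corollary semialg_project_finite:
  assumes "finite J" "semialg (V \<union> J) S"
  shows "semialg V {x. \<exists>y\<in>S. \<forall>i. i \<notin> J \<longrightarrow> y i = x i}"
  using assms
proof (induction J arbitrary: S rule: finite_induct)
  case empty
  have "{x. \<exists>y\<in>S. \<forall>i. y i = x i} = S" by (simp only: fun_eq_iff[symmetric]) blast
  then show ?case using empty by simp
next
  case (insert j J)
  let ?S = "{x. \<exists>t. x(j := t) \<in> S}"
  have "semialg (V \<union> J) ?S" by (rule semialg_project) (use insert.prems in simp)
  then have "semialg V {x. \<exists>y\<in>?S. \<forall>i. i \<notin> J \<longrightarrow> y i = x i}" by (rule insert.IH)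
  moreover have "{x. \<exists>y\<in>?S. \<forall>i. i \<notin> J \<longrightarrow> y i = x i} = {x. \<exists>y\<in>S. \<forall>i. i \<notin> insert j J \<longrightarrow> y i = x i}"
    (is "?L = ?R")
  proof
    show "?L \<subseteq> ?R"
    proof
      fix x assume "x \<in> ?L"
      then obtain y t where y: "y(j := t) \<in> S" "\<forall>i. i \<notin> J \<longrightarrow> y i = x i" by blast
      then have "\<forall>i. i \<notin> insert j J \<longrightarrow> (y(j := t)) i = x i" by simp
      then show "x \<in> ?R" using y(1) by blast
    qed
    show "?R \<subseteq> ?L"
    proof
      fix x assume "x \<in> ?R"
      then obtain y where y: "y \<in> S" "\<forall>i. i \<notin> insert j J \<longrightarrow> y i = x i" by blast
      have "(y(j := x j))(j := y j) \<in> S" using y by simp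
      then have "y(j := x j) \<in> ?S" by blast
      moreover have "\<forall>i. i \<notin> J \<longrightarrow> (y(j := x j)) i = x i" using y by simp
      ultimately show "x \<in> ?L" by blast
    qed
  qed
  ultimately show ?case by (simp only:)
qed

section \<open>Irreducible algebraic sets\<close>

lemma pol_continuous: "f \<in> pol V \<Longrightarrow> continuous_on UNIV f"
  by (induction f rule: pol.induct) (auto intro: continuous_intros)

lemma pol_on_line:
  assumes "f \<in> pol V"
  shows "\<exists>q::real poly. \<forall>t. f (\<lambda>i. a i + t * (b i - a i)) = poly q t"
  using assms
proof induction
  case (pol_const c)
  show ?case by (rule exI[of _ "[:c:]"]) simp
next
  case (pol_var i)
  show ?case by (rule exI[of _ "[:a i, b i - a i:]"]) simp
next
  case (pol_add f g)
  then obtain p q where "\<And>t. f (\<lambda>i. a i + t * (b i - a i)) = poly p t"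
    "\<And>t. g (\<lambda>i. a i + t * (b i - a i)) = poly q t" by blast
  then show ?case by (intro exI[of _ "p + q"]) simp
next
  case (pol_mult f g)
  then obtain p q where "\<And>t. f (\<lambda>i. a i + t * (b i - a i)) = poly p t"
    "\<And>t. g (\<lambda>i. a i + t * (b i - a i)) = poly q t" by blast
  then show ?case by (intro exI[of _ "p * q"]) simp
qed

text \<open>On the line from \<open>x\<close> to \<open>w\<close> the polynomial \<open>f\<close>
  becomes a nonzero univariate polynomial, which has only finitely many zeros near
  \<open>x\<close>.\<close>

lemma pol_nonzero_dense:
  assumes f: "f \<in> pol V" "f w \<noteq> 0" and O: "open U" "x \<in> U"
  shows "\<exists>y\<in>U. f y \<noteq> 0"
proof -
  define L where "L = (\<lambda>t::real. \<lambda>i. x i + t * (w i - x i))"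
  obtain q :: "real poly" where q: "\<And>t. f (L t) = poly q t"
    using pol_on_line[OF f(1), of x w] unfolding L_def by blast
  have "poly q 1 = f w" using q[of 1] by (simp add: L_def)
  then have "q \<noteq> 0" using f(2) by auto
  then have fin: "finite {t. poly q t = 0}" by (rule poly_roots_finite)
  have "continuous_on UNIV L" unfolding L_def by (intro continuous_intros)
  then have "open (L -` U)" using O(1) by (simp add: open_vimage)
  moreover have "0 \<in> L -` U" using O(2) by (simp add: L_def)
  ultimately have "infinite (L -` U)" using finite_imp_not_open by blast
  then obtain t where "t \<in> L -` U" "poly q t \<noteq> 0"
    using fin finite_subset[of "L -` U" "{t. poly q t = 0}"] by blast
  then show ?thesis by (intro bexI[of _ "L t"]) (auto simp: q)
qed

text \<open>Baire's theorem in the space of real sequences, which is completely metrizable: the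
  nonvanishing locus of each \<open>q\<close> is open and dense.\<close>

lemma pol_countable_nonzero:
  fixes V :: "nat set"
  assumes Q: "countable Q" "Q \<subseteq> pol V" "\<And>q. q \<in> Q \<Longrightarrow> \<exists>w. q w \<noteq> 0" and O: "open U" "U \<noteq> {}"
  shows "\<exists>x\<in>U. \<forall>q\<in>Q. q x \<noteq> 0"
proof -
  have "euclidean closure_of \<Inter>((\<lambda>q. {x. q x \<noteq> 0}) ` Q) = topspace (euclidean :: (nat \<Rightarrow> real) topology)"
  proof (rule Baire_category)
    show "completely_metrizable_space (euclidean :: (nat \<Rightarrow> real) topology) \<or>
        locally_compact_space (euclidean :: (nat \<Rightarrow> real) topology) \<and>
        regular_space (euclidean :: (nat \<Rightarrow> real) topology)"
      using completely_metrizable_space_euclidean by blast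
    show "countable ((\<lambda>q. {x. q x \<noteq> 0}) ` Q)" using Q(1) by simp
    fix T assume "T \<in> (\<lambda>q. {x. q x \<noteq> 0}) ` Q"
    then obtain q where q: "q \<in> Q" "T = {x. q x \<noteq> 0}" by blast
    have qV: "q \<in> pol V" using q Q(2) by blast
    obtain w where w: "q w \<noteq> 0" using Q(3) q by blast
    have "open T" unfolding q(2)
      by (rule open_Collect_neq[OF pol_continuous[OF qV] continuous_on_const])
    moreover have "closure T = UNIV"
    proof (rule ccontr)
      assume "closure T \<noteq> UNIV"
      then obtain x where "x \<in> - closure T" by blast
      from pol_nonzero_dense[OF qV w open_Compl[OF closed_closure] this]
      obtain y where "y \<in> - closure T" "q y \<noteq> 0" by blast
      then show False using closure_subset[of T] q(2) by auto
    qed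
    ultimately show "openin euclidean T \<and> euclidean closure_of T = topspace euclidean"
      by simp
  qed
  then have "closure (\<Inter>((\<lambda>q. {x. q x \<noteq> 0}) ` Q)) = (UNIV :: (nat \<Rightarrow> real) set)" by simp
  then have "U \<inter> \<Inter>((\<lambda>q. {x. q x \<noteq> 0}) ` Q) \<noteq> {}"
    using O open_Int_closure_eq_empty[OF O(1)] by auto
  then show ?thesis by blast
qed

text \<open>\<open>G\<close> is the product of those describing polynomials that are not identically
  zero. Off the zero set of \<open>G\<close> their signs are locally constant, so a point of
  \<open>S\<close> there has a whole neighbourhood in \<open>S\<close>.\<close>

lemma semialg_dichotomy:
  fixes V :: "nat set"
  assumes "semialg V S"
  obtains (thin) G w where "G \<in> pol V" "G w \<noteq> 0" "\<And>x. x \<in> S \<Longrightarrow> G x = 0"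
    | (fat) U where "open U" "U \<noteq> {}" "U \<subseteq> S"
proof -
  obtain C where C: "C\<subseteq>pol V" "finite C" "\<And>x y. same_signs C x y \<Longrightarrow> (x \<in> S \<longleftrightarrow> y \<in> S)"
    using assms(1) unfolding semialg_def by blast
  define C0 where "C0 = {c \<in> C. \<exists>w. c w \<noteq> 0}"
  have C0: "finite C0" "C0 \<subseteq> pol V" using C(1,2) by (auto simp: C0_def)
  define G where "G = (\<lambda>x. \<Prod>c\<in>C0. c x)"
  have G: "G \<in> pol V" unfolding G_def by (rule pol.prod) (use C0 in blast)
  have "\<exists>w\<in>UNIV. \<forall>c\<in>C0. c w \<noteq> 0"
    by (rule pol_countable_nonzero[OF countable_finite[OF C0(1)] C0(2)]) (simp_all add: C0_def)
  then obtain w where "\<forall>c\<in>C0. c w \<noteq> 0" by blast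
  then have w: "G w \<noteq> 0" using C0(1) by (simp add: G_def)
  show thesis
  proof (cases "\<forall>x\<in>S. G x = 0")
    case True
    then show thesis using thin[OF G w] by blast
  next
    case False
    then obtain a where a: "a \<in> S" "G a \<noteq> 0" by blast
    define U where "U = (\<Inter>c\<in>C0. {x. c x * c a > 0})"
    have "open U" unfolding U_def
    proof (rule open_INT[OF C0(1)], rule ballI)
      fix c assume "c \<in> C0"
      then have "continuous_on UNIV c" using C0(2) by (intro pol_continuous) blast
      then show "open {x. 0 < c x * c a}"
        by (intro open_Collect_less continuous_intros)
    qed
    moreover have "a \<in> U" using a(2) C0(1) by (auto simp: U_def G_def zero_less_mult_iff not_less)
    moreover have "U \<subseteq> S"
    proof
      fix x assume x: "x \<in> U"
      have "same_signs C x a" unfolding same_signs_def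
      proof
        fix c assume c: "c \<in> C"
        show "sgn (c x) = sgn (c a)"
        proof (cases "c \<in> C0")
          case True
          then have "c x * c a > 0" using x by (auto simp: U_def)
          then show ?thesis by (auto simp: zero_less_mult_iff)
        next
          case False
          then show ?thesis using c by (simp add: C0_def)
        qed
      qed
      from C(3)[OF this] a(1) show "x \<in> S" by blast
    qed
    ultimately show thesis using fat[of U] by blast
  qed
qed

lemma semialg_cong:
  assumes "semialg V S" "\<And>i. i \<in> V \<Longrightarrow> x i = y i"
  shows "x \<in> S \<longleftrightarrow> y \<in> S"
proof -
  obtain C where C: "C\<subseteq>pol V" "finite C" "\<And>x y. same_signs C x y \<Longrightarrow> (x \<in> S \<longleftrightarrow> y \<in> S)"
    using assms(1) unfolding semialg_def by blast
  have "same_signs C x y"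
    unfolding same_signs_def using pol_cong[of _ V x y] C(1) assms(2) by (metis subsetD)
  then show ?thesis by (rule C(3))
qed

context function_ring
begin

lemma poly_over_eval:
  assumes "P \<in> poly_over A n" "q \<in> A"
  shows "(\<lambda>x. poly (P x) (q x)) \<in> A"
proof -
  have "poly (P x) (q x) = (\<Sum>i<n. coeff (P x) i * q x ^ i)" for x
  proof -
    have "(\<Sum>i\<le>degree (P x). coeff (P x) i * q x ^ i) = (\<Sum>i<n. coeff (P x) i * q x ^ i)"
    proof (rule sum.mono_neutral_cong)
      show "coeff (P x) i * q x ^ i = 0" if "i \<in> {..degree (P x)} - {..<n}" for i
        using that poly_overD(2)[OF assms(1)] by auto
      show "coeff (P x) i * q x ^ i = 0" if "i \<in> {..<n} - {..degree (P x)}" for i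
        using that by (auto simp: coeff_eq_0)
    qed auto
    then show ?thesis by (simp add: poly_altdef)
  qed
  moreover have "(\<lambda>x. \<Sum>i<n. coeff (P x) i * q x ^ i) \<in> A"
    by (intro sum mult power poly_overD(1)[OF assms(1)] assms(2))
  ultimately show ?thesis by simp
qed

end

lemma pol_insert_finite_roots:
  assumes "G \<in> pol (insert j S)" "G w \<noteq> 0"
  obtains l where "l \<in> pol S" "l w \<noteq> 0" "\<And>x. l x \<noteq> 0 \<Longrightarrow> finite {t. G (x(j := t)) = 0}"
proof -
  obtain P n where P: "P \<in> poly_over (pol S) n" "\<And>x t. G (x(j := t)) = poly (P x) t"
    using pol_insert_poly[OF assms(1)] by blast
  have "poly (P w) (w j) \<noteq> 0" using P(2)[of w "w j"] assms(2) by simp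
  then have "P w \<noteq> 0" by auto
  then obtain i where i: "coeff (P w) i \<noteq> 0" by (metis leading_coeff_0_iff)
  show thesis
  proof (rule that[of "\<lambda>x. coeff (P x) i"])
    show "(\<lambda>x. coeff (P x) i) \<in> pol S" by (rule poly_overD(1)[OF P(1)])
    fix x assume "coeff (P x) i \<noteq> 0"
    then have "P x \<noteq> 0" by auto
    then show "finite {t. G (x(j := t)) = 0}" unfolding P(2) by (rule poly_roots_finite)
  qed (rule i)
qed

section \<open>Algebraically independent coordinates on an irreducible set\<close>

definition override :: "'v set \<Rightarrow> ('v \<Rightarrow> real) \<Rightarrow> ('v \<Rightarrow> real) \<Rightarrow> 'v \<Rightarrow> real" where
  "override J u x = (\<lambda>i. if i \<in> J then u i else x i)"

text \<open>\<open>prime\<close> says that the polynomials in the variables \<open>X\<close>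
  vanishing on \<open>V\<close> form a prime ideal. Membership in \<open>V\<close> depends only on
  the coordinates in \<open>X\<close>, so \<open>V\<close> is a cylinder in sequence space.\<close>

locale irreducible_set =
  fixes X :: "nat set" and V :: "(nat \<Rightarrow> real) set"
  assumes finX: "finite X" and semialgV: "semialg X V" and nonempty: "V \<noteq> {}"
    and prime: "\<And>p q. p \<in> pol X \<Longrightarrow> q \<in> pol X \<Longrightarrow> (\<And>x. x \<in> V \<Longrightarrow> p x * q x = 0)
      \<Longrightarrow> (\<forall>x\<in>V. p x = 0) \<or> (\<forall>x\<in>V. q x = 0)"
begin

text \<open>Algebraic independence of the coordinates \<open>S\<close> modulo the polynomials
  vanishing on \<open>V\<close>; a maximal such \<open>S\<close> is a transcendence basis of the
  function field.\<close>

definition indep :: "nat set \<Rightarrow> bool" where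
  "indep S \<longleftrightarrow> S \<subseteq> X \<and> (\<forall>c\<in>pol S. (\<forall>x\<in>V. c x = 0) \<longrightarrow> (\<forall>x. c x = 0))"

lemma maximal_indep:
  obtains S where "indep S" "\<forall>j\<in>X - S. \<not> indep (insert j S)"
proof -
  have "indep {}" unfolding indep_def
  proof (intro conjI ballI impI allI)
    fix c x assume c: "c \<in> pol {}" "\<forall>x\<in>V. c x = 0"
    obtain v where "v \<in> V" using nonempty by blast
    moreover have "c x = c v" by (rule pol_cong[OF c(1)]) simp
    ultimately show "c x = 0" using c(2) by simp
  qed simp
  moreover have "finite {S. indep S}"
    by (rule finite_subset[of _ "Pow X"]) (auto simp: indep_def finX)
  ultimately obtain S where S: "indep S" "\<And>T. indep T \<Longrightarrow> S \<subseteq> T \<Longrightarrow> S = T"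
    using finite_has_maximal[of "{S. indep S}"] by blast
  have "\<forall>j\<in>X - S. \<not> indep (insert j S)"
    using S(2)[of "insert _ S"] by blast
  with S(1) show thesis by (rule that)
qed

text \<open>Algebraicity of \<open>q\<close> over a transcendence basis, by counting instead of
  resultants. If the projection of the graph of \<open>q\<close> to the coordinates \<open>S\<close>
  and \<open>y\<close> were fat, some choice of the \<open>S\<close>-coordinates would admit
  infinitely many values of \<open>q\<close>, although every other coordinate has then only finitely
  many possible values.\<close>

lemma algebraic_over_indep:
  assumes S: "indep S" "\<forall>j\<in>X - S. \<not> indep (insert j S)"
    and q: "q \<in> pol X" and y: "y \<notin> X"
  obtains G w where "G \<in> pol (insert y S)" "G w \<noteq> 0" "\<forall>x\<in>V. G (x(y := q x)) = 0"
proof -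
  have SX: "S \<subseteq> X" using S(1) by (simp add: indep_def)
  define J where "J = X - S"
  have finJ: "finite J" using finX by (simp add: J_def)
  have "\<exists>G w. G \<in> pol (insert j S) \<and> G w \<noteq> 0 \<and> (\<forall>x\<in>V. G x = 0)" if "j \<in> J" for j
    using S(2) that SX unfolding indep_def J_def by blast
  then obtain G0 w0 where G0: "\<And>j. j \<in> J \<Longrightarrow> G0 j \<in> pol (insert j S)"
    "\<And>j. j \<in> J \<Longrightarrow> G0 j (w0 j) \<noteq> 0" "\<And>j x. j \<in> J \<Longrightarrow> x \<in> V \<Longrightarrow> G0 j x = 0" by metis
  have "\<exists>l. l \<in> pol S \<and> (\<exists>w. l w \<noteq> 0) \<and> (\<forall>x. l x \<noteq> 0 \<longrightarrow> finite {t. G0 j (x(j := t)) = 0})"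
    if "j \<in> J" for j
    by (rule pol_insert_finite_roots[OF G0(1,2)[OF that]]) blast
  then obtain l where l: "\<And>j. j \<in> J \<Longrightarrow> l j \<in> pol S" "\<And>j. j \<in> J \<Longrightarrow> \<exists>w. l j w \<noteq> 0"
    "\<And>j x. j \<in> J \<Longrightarrow> l j x \<noteq> 0 \<Longrightarrow> finite {t. G0 j (x(j := t)) = 0}" by metis
  \<comment> \<open>The fresh variable \<open>y\<close> records the value of \<open>q\<close>, so
    that it survives the elimination of the variables in \<open>J\<close>.\<close>
  define E0 where "E0 = V \<inter> {x. x y - q x = 0}"
  have "insert y S \<union> J = insert y X" using SX by (auto simp: J_def)
  moreover have "semialg (insert y X) E0"
    unfolding E0_def
  proof (rule semialg_Int)
    show "semialg (insert y X) V" by (rule semialg_mono[OF semialgV]) auto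
    have "q \<in> pol (insert y X)" using pol_mono[of X "insert y X"] q by blast
    then show "semialg (insert y X) {x. x y - q x = 0}"
      by (intro semialg_zero pol.diff pol.pol_var) auto
  qed
  ultimately have E: "semialg (insert y S) {x. \<exists>z\<in>E0. \<forall>i. i \<notin> J \<longrightarrow> z i = x i}"
    by (intro semialg_project_finite[OF finJ]) simp
  show thesis
  proof (cases rule: semialg_dichotomy[OF E])
    case (1 G w)
    show thesis
    proof (rule that[OF 1(1,2)], rule ballI)
      fix x assume x: "x \<in> V"
      have "x(y := q x) \<in> V \<longleftrightarrow> x \<in> V"
        by (rule semialg_cong[OF semialgV]) (use y in auto)
      then have "x(y := q x) \<in> V" using x by blast
      moreover have "q (x(y := q x)) = q x"
        using y by (intro pol_cong[OF q]) auto
      ultimately have "x(y := q x) \<in> E0" by (simp add: E0_def)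
      then show "G (x(y := q x)) = 0" by (intro 1(3)) blast
    qed
  next
    case (2 U)
    have "countable (l ` J)" "l ` J \<subseteq> pol S" "\<And>q. q \<in> l ` J \<Longrightarrow> \<exists>w. q w \<noteq> 0"
      using finJ l(1,2) by (auto intro: countable_finite)
    from pol_countable_nonzero[OF this 2(1,2)]
    obtain a where a: "a \<in> U" "\<And>j. j \<in> J \<Longrightarrow> l j a \<noteq> 0" by blast
    define T where "T = (\<lambda>t. a(y := t)) -` U"
    have "continuous_on UNIV (\<lambda>t. (a(y := t)) i)" for i by (cases "i = y") simp_all
    then have "continuous_on UNIV (\<lambda>t. a(y := t))"
      by (rule continuous_on_coordinatewise_then_product)
    then have "open T" unfolding T_def using 2(1) by (simp add: open_vimage)
    moreover have "a y \<in> T" using a(1) by (simp add: T_def)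
    ultimately have inf: "infinite T" using finite_imp_not_open by blast
    define R where "R = (\<lambda>j. {t. G0 j (a(j := t)) = 0})"
    \<comment> \<open>Each \<open>t\<close> in the open slice is the value of \<open>q\<close> at a
      point whose \<open>S\<close>-part is that of \<open>a\<close> and whose coordinates in
      \<open>J\<close> are roots of the polynomials \<open>G0 j\<close>.\<close>
    have "T \<subseteq> (\<lambda>u. q (override J u a)) ` PiE J R"
    proof
      fix t assume "t \<in> T"
      then have "a(y := t) \<in> U" by (simp add: T_def)
      then obtain z where z: "z \<in> E0" "\<And>i. i \<notin> J \<Longrightarrow> z i = (a(y := t)) i" using 2(3) by blast
      have "y \<notin> J" "y \<notin> S" using y SX by (auto simp: J_def)
      then have "z y = t" using z(2)[of y] by simp
      then have t: "t = q z" and zV: "z \<in> V" using z(1) by (auto simp: E0_def)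
      have zS: "z i = a i" if "i \<in> S" for i
        using z(2)[of i] that \<open>y \<notin> S\<close> by (auto simp: J_def)
      have "restrict z J \<in> PiE J R"
      proof (rule restrict_PiE_iff[THEN iffD2], rule ballI)
        fix j assume j: "j \<in> J"
        have "G0 j (a(j := z j)) = G0 j z"
          by (rule pol_cong[OF G0(1)[OF j]]) (use zS in auto)
        then show "z j \<in> R j" using G0(3)[OF j zV] by (simp add: R_def)
      qed
      moreover have "t = q (override J (restrict z J) a)"
        unfolding t by (rule pol_cong[OF q]) (use zS in \<open>auto simp: override_def J_def\<close>)
      ultimately show "t \<in> (\<lambda>u. q (override J u a)) ` PiE J R" by blast
    qed
    moreover have "finite (PiE J R)"
      using finJ l(3) a(2) unfolding R_def by (intro finite_PiE) blast+
    ultimately show thesis using inf finite_surj by blast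
  qed
qed

text \<open>Take an algebraic equation for \<open>q\<close> over \<open>S\<close> and divide out the
  highest power of the unknown that divides it. By primality the reduced equation still holds on
  \<open>V\<close>; at a zero of \<open>q\<close> it says that its constant term vanishes, and this
  term is the required \<open>r\<close>.\<close>

lemma zero_projection:
  assumes S: "indep S" "\<forall>j\<in>X - S. \<not> indep (insert j S)"
    and q: "q \<in> pol X" "\<exists>x\<in>V. q x \<noteq> 0"
  obtains r where "r \<in> pol S" "\<exists>w. r w \<noteq> 0" "\<And>x. x \<in> V \<Longrightarrow> q x = 0 \<Longrightarrow> r x = 0"
proof -
  have SX: "S \<subseteq> X" using S(1) by (simp add: indep_def)
  obtain y where y: "y \<notin> X" using finX ex_new_if_finite[OF infinite_UNIV_nat] by blast
  obtain G w where G: "G \<in> pol (insert y S)" "G w \<noteq> 0" "\<forall>x\<in>V. G (x(y := q x)) = 0"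
    by (rule algebraic_over_indep[OF S q(1) y])
  obtain P n where P: "P \<in> poly_over (pol S) n" "\<And>x t. G (x(y := t)) = poly (P x) t"
    using pol_insert_poly[OF G(1)] by blast
  have "poly (P w) (w y) \<noteq> 0" using P(2)[of w "w y"] G(2) by simp
  then have "P w \<noteq> 0" by auto
  then have ex: "\<exists>i x. coeff (P x) i \<noteq> 0" by (metis leading_coeff_0_iff)
  define m where "m = (LEAST i. \<exists>x. coeff (P x) i \<noteq> 0)"
  have m: "\<exists>x. coeff (P x) m \<noteq> 0" unfolding m_def by (rule LeastI_ex) (rule ex)
  have below: "coeff (P x) i = 0" if "i < m" for i x
    using not_less_Least[of i "\<lambda>i. \<exists>x. coeff (P x) i \<noteq> 0"] that unfolding m_def by blast
  have split: "P x = monom 1 m * poly_shift m (P x)" for x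
    by (rule poly_eqI) (simp add: coeff_monom_mult coeff_poly_shift below)
  have "(\<lambda>x. poly_shift m (P x)) \<in> poly_over (pol S) n"
    using P(1) by (auto simp: poly_over_def coeff_poly_shift)
  then have sh: "(\<lambda>x. poly_shift m (P x)) \<in> poly_over (pol X) n"
    using pol_mono[OF SX] by (auto simp: poly_over_def)
  define D where "D = (\<lambda>x. poly (poly_shift m (P x)) (q x))"
  have D: "D \<in> pol X" unfolding D_def by (rule pol.poly_over_eval[OF sh q(1)])
  have "q x ^ m * D x = 0" if "x \<in> V" for x
  proof -
    have "poly (P x) (q x) = 0" using bspec[OF G(3) that] P(2) by simp
    then show ?thesis using arg_cong[OF split[of x], of "\<lambda>p. poly p (q x)"]
      by (simp add: D_def poly_monom)
  qed
  then have "(\<forall>x\<in>V. q x ^ m = 0) \<or> (\<forall>x\<in>V. D x = 0)"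
    by (rule prime[OF pol.power[OF q(1)] D])
  \<comment> \<open>\<open>q\<close> is nonzero somewhere on \<open>V\<close>, hence so is its
    power, and only the second alternative remains.\<close>
  then have D0: "D x = 0" if "x \<in> V" for x using q(2) that by auto
  show thesis
  proof (rule that[of "\<lambda>x. coeff (P x) m"])
    show "(\<lambda>x. coeff (P x) m) \<in> pol S" by (rule poly_overD(1)[OF P(1)])
    show "coeff (P x) m = 0" if "x \<in> V" "q x = 0" for x
      using D0[OF that(1)] that(2) by (simp add: D_def poly_0_coeff_0 coeff_poly_shift)
  qed (rule m)
qed

text \<open>A maximal algebraically independent set \<open>S\<close> of coordinates projects \<open>V\<close> onto a set with interior,
  whereas a proper algebraic subset of \<open>V\<close> projects into a hypersurface; Baire's theorem applies.\<close>

theorem countable_nonvanishing: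
  assumes Q: "countable Q" "Q \<subseteq> pol X" "\<And>q. q \<in> Q \<Longrightarrow> \<exists>x\<in>V. q x \<noteq> 0"
  shows "\<exists>x\<in>V. \<forall>q\<in>Q. q x \<noteq> 0"
proof -
  obtain S where S: "indep S" "\<forall>j\<in>X - S. \<not> indep (insert j S)"
    by (rule maximal_indep)
  have SX: "S \<subseteq> X" using S(1) by (simp add: indep_def)
  have "\<exists>r. r \<in> pol S \<and> (\<exists>w. r w \<noteq> 0) \<and> (\<forall>x\<in>V. q x = 0 \<longrightarrow> r x = 0)" if "q \<in> Q" for q
    by (rule zero_projection[OF S subsetD[OF Q(2) that] Q(3)[OF that]]) blast
  then obtain r where r: "\<And>q. q \<in> Q \<Longrightarrow> r q \<in> pol S" "\<And>q. q \<in> Q \<Longrightarrow> \<exists>w. r q w \<noteq> 0"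
    "\<And>q x. q \<in> Q \<Longrightarrow> x \<in> V \<Longrightarrow> q x = 0 \<Longrightarrow> r q x = 0" by metis
  have "S \<union> (X - S) = X" using SX by blast
  then have E: "semialg S {x. \<exists>z\<in>V. \<forall>i. i \<notin> X - S \<longrightarrow> z i = x i}"
    using semialgV finX by (intro semialg_project_finite) auto
  show ?thesis
  proof (cases rule: semialg_dichotomy[OF E])
    \<comment> \<open>A thin projection would give a nontrivial relation among the coordinates
      \<open>S\<close> on \<open>V\<close>.\<close>
    case (1 G w)
    have "G x = 0" if "x \<in> V" for x using 1(3)[of x] that by blast
    then show ?thesis using S(1) 1(1,2) unfolding indep_def by blast
  next
    case (2 U)
    have "countable (r ` Q)" "r ` Q \<subseteq> pol S" "\<And>f. f \<in> r ` Q \<Longrightarrow> \<exists>w. f w \<noteq> 0"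
      using Q(1) r(1,2) by auto
    from pol_countable_nonzero[OF this 2(1,2)]
    obtain a where a: "a \<in> U" "\<And>q. q \<in> Q \<Longrightarrow> r q a \<noteq> 0" by blast
    then obtain z where z: "z \<in> V" "\<And>i. i \<notin> X - S \<Longrightarrow> z i = a i" using 2(3) by blast
    have "q z \<noteq> 0" if "q \<in> Q" for q
    proof
      assume "q z = 0"
      then have "r q z = 0" using r(3) that z(1) by blast
      moreover have "r q z = r q a" by (rule pol_cong[OF r(1)[OF that]]) (use z(2) in blast)
      ultimately show False using a(2) that by simp
    qed
    then show ?thesis using z(1) by blast
  qed
qed

end

section \<open>Noetherianity\<close>

inductive_set ideal_gen :: "('x \<Rightarrow> real) set \<Rightarrow> ('x \<Rightarrow> real) set \<Rightarrow> ('x \<Rightarrow> real) set" for A F where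
  ideal_gen_zero: "(\<lambda>x. 0) \<in> ideal_gen A F"
| ideal_gen_step: "g \<in> ideal_gen A F \<Longrightarrow> a \<in> A \<Longrightarrow> f \<in> F \<Longrightarrow> (\<lambda>x. g x + a x * f x) \<in> ideal_gen A F"

lemma ideal_gen_mono: "F \<subseteq> G \<Longrightarrow> ideal_gen A F \<subseteq> ideal_gen A G"
proof
  fix f assume FG: "F \<subseteq> G" and "f \<in> ideal_gen A F"
  from this(2) show "f \<in> ideal_gen A G" by induction (use FG in \<open>auto intro: ideal_gen.intros\<close>)
qed

lemma ideal_gen_finite_sub:
  assumes "f \<in> ideal_gen A (range h)"
  shows "\<exists>N::nat. f \<in> ideal_gen A (h ` {..<N})"
  using assms
proof induction
  case ideal_gen_zero
  then show ?case by (blast intro: ideal_gen.ideal_gen_zero)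
next
  case (ideal_gen_step g a f)
  then obtain N k where N: "g \<in> ideal_gen A (h ` {..<N})" and k: "f = h k" by blast
  have "g \<in> ideal_gen A (h ` {..<max N (Suc k)})"
    using N ideal_gen_mono[of "h ` {..<N}" "h ` {..<max N (Suc k)}" A] by force
  moreover have "f \<in> h ` {..<max N (Suc k)}" using k by force
  ultimately show ?case using ideal_gen_step.hyps by (blast intro: ideal_gen.ideal_gen_step)
qed

text \<open>The ascending chain condition for chains of ideals that grow by one generator at a
  time.\<close>

definition noetherian :: "('x \<Rightarrow> real) set \<Rightarrow> bool" where
  "noetherian A \<longleftrightarrow> (\<forall>f::nat \<Rightarrow> _. (\<forall>n. f n \<in> A) \<longrightarrow> (\<exists>n. f n \<in> ideal_gen A (f ` {..<n})))"

context function_ring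
begin

lemma ideal_gen_add:
  assumes "g \<in> ideal_gen A F" "f \<in> ideal_gen A F"
  shows "(\<lambda>x. f x + g x) \<in> ideal_gen A F"
  using assms
proof induction
  case ideal_gen_zero
  then show ?case by simp
next
  case (ideal_gen_step g a h)
  have "(\<lambda>x. (f x + g x) + a x * h x) \<in> ideal_gen A F"
    by (rule ideal_gen.ideal_gen_step[OF ideal_gen_step.IH]) (use ideal_gen_step in auto)
  then show ?case by (simp add: add.assoc)
qed

lemma ideal_gen_mult:
  assumes "f \<in> ideal_gen A F" "b \<in> A"
  shows "(\<lambda>x. b x * f x) \<in> ideal_gen A F"
  using assms
proof induction
  case ideal_gen_zero
  then show ?case by (simp add: ideal_gen.ideal_gen_zero)
next
  case (ideal_gen_step g a f)
  have "(\<lambda>x. b x * g x + (b x * a x) * f x) \<in> ideal_gen A F"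
    by (rule ideal_gen.ideal_gen_step) (use ideal_gen_step in auto)
  then show ?case by (simp add: distrib_left mult.assoc)
qed

lemma ideal_gen_base: "f \<in> F \<Longrightarrow> f \<in> ideal_gen A F"
  using ideal_gen.ideal_gen_step[OF ideal_gen.ideal_gen_zero const[of 1], of f F] by simp

lemma ideal_gen_in:
  assumes "f \<in> ideal_gen A F" "F \<subseteq> A"
  shows "f \<in> A"
  using assms(1)
proof induction
  case (ideal_gen_step g a f)
  then show ?case using assms(2) by (intro add mult) blast+
qed simp

lemma ideal_gen_hull:
  assumes "f \<in> ideal_gen A G" "G \<subseteq> ideal_gen A F"
  shows "f \<in> ideal_gen A F"
  using assms
proof induction
  case ideal_gen_zero
  show ?case by (rule ideal_gen.ideal_gen_zero)
next
  case (ideal_gen_step g a f)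
  have "(\<lambda>x. g x + a x * f x) \<in> ideal_gen A F"
    by (rule ideal_gen_add[OF ideal_gen_mult]) (use ideal_gen_step in auto)
  then show ?case .
qed

lemma ideal_gen_sum:
  assumes "\<And>i. i \<in> I \<Longrightarrow> f i \<in> ideal_gen A F"
  shows "(\<lambda>x. \<Sum>i\<in>I. f i x) \<in> ideal_gen A F"
  using assms
  by (induction I rule: infinite_finite_induct) (auto simp: ideal_gen.ideal_gen_zero intro!: ideal_gen_add)

lemma ideal_gen_image_sum:
  assumes "f \<in> ideal_gen A (a ` {..<n::nat})"
  shows "\<exists>b. (\<forall>i. b i \<in> A) \<and> f = (\<lambda>x. \<Sum>i<n. b i x * a i x)"
  using assms
proof induction
  case ideal_gen_zero
  show ?case by (rule exI[of _ "\<lambda>i x. 0"]) auto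
next
  case (ideal_gen_step g c f)
  then obtain b k where b: "\<And>i. b i \<in> A" "g = (\<lambda>x. \<Sum>i<n. b i x * a i x)"
    and k: "k < n" "f = a k" by blast
  define b' where "b' = b(k := (\<lambda>x. b k x + c x))"
  have "(\<lambda>x. g x + c x * f x) = (\<lambda>x. \<Sum>i<n. b' i x * a i x)"
  proof
    fix x
    have "(\<Sum>i<n. b' i x * a i x) = (\<Sum>i<n. b i x * a i x + (if i = k then c x * a k x else 0))"
      by (rule sum.cong) (auto simp: b'_def algebra_simps)
    also have "\<dots> = g x + c x * f x" using k by (simp add: sum.distrib b(2))
    finally show "g x + c x * f x = (\<Sum>i<n. b' i x * a i x)" by simp
  qed
  moreover have "b' i \<in> A" for i using b(1) ideal_gen_step.hyps add by (simp add: b'_def)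
  ultimately show ?case by blast
qed

end

text \<open>Hilbert's argument: choose elements of least degree outside the ideal of the previous
  ones; a relation among their leading coefficients yields an element of smaller degree, still
  outside. The ring consists of functions, so \<open>t\<close> may satisfy equations over
  \<open>A\<close> and representations as polynomials in \<open>t\<close> need not be unique;
  \<open>deg\<close> is therefore the least bound over all of them.\<close>

theorem hilbert_basis_adjoin:
  fixes A A' :: "('x \<Rightarrow> real) set"
  assumes "function_ring A" "function_ring A'" and AA: "A \<subseteq> A'" and t: "t \<in> A'"
    and gen: "\<And>f. f \<in> A' \<Longrightarrow> \<exists>P n. P \<in> poly_over A n \<and> (\<forall>x. f x = poly (P x) (t x))"
    and noeth: "noetherian A"
  shows "noetherian A'"
proof (rule ccontr)
  interpret A: function_ring A by fact
  interpret A': function_ring A' by fact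
  assume "\<not> noetherian A'"
  then obtain f :: "nat \<Rightarrow> _" where f: "\<And>n. f n \<in> A'" "\<And>n. f n \<notin> ideal_gen A' (f ` {..<n})"
    unfolding noetherian_def by blast
  define J where "J = ideal_gen A' (range f)"
  have JA: "g \<in> A'" if "g \<in> J" for g
    using that A'.ideal_gen_in f(1) unfolding J_def by blast
  define rep where "rep d g \<longleftrightarrow> (\<exists>P\<in>poly_over A d. \<forall>x. g x = poly (P x) (t x))" for d g
  define deg where "deg g = (LEAST d. rep d g)" for g
  have rep_deg: "rep (deg g) g" if "g \<in> J" for g
    unfolding deg_def by (rule LeastI_ex) (use gen[OF JA[OF that]] in \<open>auto simp: rep_def\<close>)
  have deg_le: "deg g \<le> d" if "rep d g" for g d
    unfolding deg_def using that by (rule Least_le)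
  \<comment> \<open>Finitely many generators of \<open>J\<close> would lie in the ideal of
    \<open>f 0, ..., f (N - 1)\<close> for some \<open>N\<close>, and then so would
    \<open>f N\<close>.\<close>
  have not_fg: "\<not> J \<subseteq> ideal_gen A' (g ` {..<n})" if g: "\<And>i. i < n \<Longrightarrow> g i \<in> J" for g and n :: nat
  proof
    assume J: "J \<subseteq> ideal_gen A' (g ` {..<n})"
    have "\<exists>N. \<forall>i<n. g i \<in> ideal_gen A' (f ` {..<N})"
      using g
    proof (induction n)
      case (Suc n)
      then obtain N where N: "\<forall>i<n. g i \<in> ideal_gen A' (f ` {..<N})" by auto
      obtain M where M: "g n \<in> ideal_gen A' (f ` {..<M})"
        using ideal_gen_finite_sub Suc.prems[of n] unfolding J_def by blast
      have "ideal_gen A' (f ` {..<N}) \<subseteq> ideal_gen A' (f ` {..<max M N})"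
        "ideal_gen A' (f ` {..<M}) \<subseteq> ideal_gen A' (f ` {..<max M N})"
        by (intro ideal_gen_mono image_mono; simp)+
      then have "\<forall>i<Suc n. g i \<in> ideal_gen A' (f ` {..<max M N})"
        using N M by (auto simp: less_Suc_eq)
      then show ?case by blast
    qed simp
    then obtain N where N: "g ` {..<n} \<subseteq> ideal_gen A' (f ` {..<N})" by blast
    have "f N \<in> J" unfolding J_def by (rule A'.ideal_gen_base) simp
    then have "f N \<in> ideal_gen A' (g ` {..<n})" using J by blast
    then have "f N \<in> ideal_gen A' (f ` {..<N})" using N by (rule A'.ideal_gen_hull)
    then show False using f(2) by blast
  qed
  define pick where "pick g n r \<longleftrightarrow> r \<in> J \<and> r \<notin> ideal_gen A' (g ` {..<n}) \<and>
      (\<forall>s\<in>J. s \<notin> ideal_gen A' (g ` {..<n}) \<longrightarrow> deg r \<le> deg s)" for g and n :: nat and r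
  have "\<exists>g. \<forall>n. pick g n (g n)"
  proof (rule dependent_wellorder_choice)
    fix r :: "'x \<Rightarrow> real" and g h :: "nat \<Rightarrow> 'x \<Rightarrow> real" and n :: nat
    assume "\<And>m. m < n \<Longrightarrow> g m = h m"
    then have "g ` {..<n} = h ` {..<n}" by (intro image_cong) auto
    then show "pick g n r = pick h n r" unfolding pick_def by simp
  next
    fix n :: nat and g :: "nat \<Rightarrow> 'x \<Rightarrow> real"
    assume "\<And>m. m < n \<Longrightarrow> pick g m (g m)"
    then have "\<not> J \<subseteq> ideal_gen A' (g ` {..<n})" by (intro not_fg) (auto simp: pick_def)
    then obtain s where "s \<in> J \<and> s \<notin> ideal_gen A' (g ` {..<n})" by blast
    from ex_has_least_nat[of "\<lambda>s. s \<in> J \<and> s \<notin> ideal_gen A' (g ` {..<n})", OF this, of deg]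
    show "\<exists>r. pick g n r" unfolding pick_def by blast
  qed
  then obtain g where g: "\<And>n. pick g n (g n)" by blast
  have gJ: "g n \<in> J" and gh: "g n \<notin> ideal_gen A' (g ` {..<n})"
    and gmin: "\<And>s. s \<in> J \<Longrightarrow> s \<notin> ideal_gen A' (g ` {..<n}) \<Longrightarrow> deg (g n) \<le> deg s" for n
    using g[of n] unfolding pick_def by blast+
  define d where "d n = deg (g n)" for n
  have mono: "d i \<le> d n" if "i \<le> n" for i n
  proof -
    have "ideal_gen A' (g ` {..<i}) \<subseteq> ideal_gen A' (g ` {..<n})"
      using that by (intro ideal_gen_mono image_mono) auto
    then show ?thesis unfolding d_def using gh[of n] by (intro gmin gJ) blast
  qed
  have "\<forall>n. \<exists>P. P \<in> poly_over A (d n) \<and> (\<forall>x. g n x = poly (P x) (t x))"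
    using rep_deg[OF gJ] unfolding rep_def d_def by blast
  then obtain P where P: "\<And>n. P n \<in> poly_over A (d n)" "\<And>n x. g n x = poly (P n x) (t x)"
    by metis
  have dpos: "d n > 0" for n
  proof (rule ccontr)
    assume "\<not> d n > 0"
    then have "P n x = 0" for x
      using poly_overD(2)[OF P(1)[of n], of _ x] by (intro poly_eqI) simp
    then have "g n = (\<lambda>x. 0)" using P(2)[of n] by auto
    then show False using gh[of n] ideal_gen.ideal_gen_zero by metis
  qed
  \<comment> \<open>\<open>d n\<close> is a strict bound on the degree, so the leading coefficient
    has index \<open>d n - 1\<close>.\<close>
  define a where "a n = (\<lambda>x. coeff (P n x) (d n - 1))" for n
  have aA: "a n \<in> A" for n unfolding a_def by (rule poly_overD(1)[OF P(1)])
  then obtain n where "a n \<in> ideal_gen A (a ` {..<n})" using noeth unfolding noetherian_def by blast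
  then obtain b where b: "\<And>i. b i \<in> A" "a n = (\<lambda>x. \<Sum>i<n. b i x * a i x)"
    using A.ideal_gen_image_sum by blast
  \<comment> \<open>The powers of \<open>t\<close> raise all \<open>g i\<close> to the degree of
    \<open>g n\<close>, so that \<open>c\<close> has the same leading coefficient as
    \<open>g n\<close>.\<close>
  define c where "c = (\<lambda>x. \<Sum>i<n. (b i x * t x ^ (d n - d i)) * g i x)"
  have c: "c \<in> ideal_gen A' (g ` {..<n})" unfolding c_def
  proof (rule A'.ideal_gen_sum, rule A'.ideal_gen_mult)
    show "g i \<in> ideal_gen A' (g ` {..<n})" if "i \<in> {..<n}" for i
      using that by (intro A'.ideal_gen_base) blast
    show "(\<lambda>x. b i x * t x ^ (d n - d i)) \<in> A'" for i
      using b(1) AA by (intro A'.mult A'.power t) blast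
  qed
  have gn_split: "g n = (\<lambda>x. (g n x + (-1) * c x) + c x)" by simp
  have mc: "(\<lambda>x. (-1) * c x) \<in> ideal_gen A' (g ` {..<n})"
    by (rule A'.ideal_gen_mult[OF c]) simp
  define r where "r = (\<lambda>x. g n x + (-1) * c x)"
  have "r \<notin> ideal_gen A' (g ` {..<n})"
  proof
    assume "r \<in> ideal_gen A' (g ` {..<n})"
    then have "(\<lambda>x. r x + c x) \<in> ideal_gen A' (g ` {..<n})" by (rule A'.ideal_gen_add[OF c])
    then show False using gh[of n] gn_split unfolding r_def by simp
  qed
  moreover have "r \<in> J"
  proof -
    have "(\<lambda>x. (-1) * c x) \<in> J" unfolding J_def
      by (rule A'.ideal_gen_hull[OF mc]) (use gJ in \<open>auto simp: J_def\<close>)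
    then show ?thesis unfolding r_def J_def by (rule A'.ideal_gen_add) (use gJ in \<open>simp add: J_def\<close>)
  qed
  ultimately have "d n \<le> deg r" unfolding d_def by (intro gmin)
  moreover have "rep (d n - 1) r"
  proof -
    define R where "R = (\<lambda>x. P n x - (\<Sum>i<n. smult (b i x) (monom 1 (d n - d i) * P i x)))"
    have cR: "coeff (R x) k = coeff (P n x) k - (\<Sum>i<n. b i x *
        (if d n - d i \<le> k then coeff (P i x) (k - (d n - d i)) else 0))" for x k
    proof -
      have "coeff (smult (b i x) (monom 1 (d n - d i) * P i x)) k = b i x *
        (if d n - d i \<le> k then coeff (P i x) (k - (d n - d i)) else 0)" for i
        by (auto simp: coeff_monom_mult)
      then show ?thesis by (simp only: R_def coeff_diff coeff_sum)
    qed
    have "(\<lambda>x. coeff (R x) k) \<in> A" for k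
      unfolding cR
    proof (intro A.diff A.sum A.mult b(1) poly_overD(1)[OF P(1)])
      fix i
      show "(\<lambda>x. if d n - d i \<le> k then coeff (P i x) (k - (d n - d i)) else 0) \<in> A"
        using poly_overD(1)[OF P(1)] by (cases "d n - d i \<le> k") auto
    qed
    moreover have "coeff (R x) k = 0" if k: "k \<ge> d n - 1" for x k
    proof (cases "k = d n - 1")
      case True
      have "coeff (R x) k = a n x - (\<Sum>i<n. b i x * a i x)"
        unfolding cR a_def True
      proof (intro arg_cong2[of _ _ _ _ "(-)"] sum.cong refl)
        fix i assume "i \<in> {..<n}"
        then have "d i \<le> d n" by (intro mono) simp
        then have "d n - d i \<le> d n - 1" "d n - 1 - (d n - d i) = d i - 1" using dpos[of i] by auto
        then show "b i x * (if d n - d i \<le> d n - 1 then coeff (P i x) (d n - 1 - (d n - d i)) else 0)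
            = b i x * coeff (P i x) (d i - 1)" by simp
      qed
      then show ?thesis using fun_cong[OF b(2), of x] by simp
    next
      case False
      then have kn: "k \<ge> d n" using k by simp
      have "coeff (P i x) (k - (d n - d i)) = 0" if "i < n" for i
        using mono[of i n] that kn by (intro poly_overD(2)[OF P(1)]) simp
      then show ?thesis unfolding cR using poly_overD(2)[OF P(1) kn] by (simp add: sum.neutral)
    qed
    ultimately have "R \<in> poly_over A (d n - 1)" by (simp add: poly_over_def)
    moreover have "r x = poly (R x) (t x)" for x
      by (simp add: r_def c_def R_def P(2) poly_sum poly_monom mult.assoc)
    ultimately show ?thesis unfolding rep_def by blast
  qed
  ultimately show False using deg_le[of "d n - 1" r] dpos[of n] by simp
qed

lemma pol_noetherian:
  assumes "finite V"
  shows "noetherian (pol V)"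
  using assms
proof (induction V rule: finite_induct)
  case empty
  show ?case unfolding noetherian_def
  proof (intro allI impI)
    fix f :: "nat \<Rightarrow> ('a \<Rightarrow> real) \<Rightarrow> real"
    assume f: "\<forall>n. f n \<in> pol {}"
    have const: "f n x = f n y" for n x y by (rule pol_cong) (use f in auto)
    show "\<exists>n. f n \<in> ideal_gen (pol {}) (f ` {..<n})"
    proof (cases "f 0 = (\<lambda>x. 0)")
      case True
      then show ?thesis using ideal_gen.ideal_gen_zero by metis
    next
      case False
      then obtain y where "f 0 y \<noteq> 0" by blast
      then have nz: "f 0 x \<noteq> 0" for x using const by metis
      have "(\<lambda>x. 0 + (f 1 y / f 0 y) * f 0 x) \<in> ideal_gen (pol {}) (f ` {..<1})"
        by (intro ideal_gen.ideal_gen_step ideal_gen.ideal_gen_zero pol.pol_const) simp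
      moreover have "(\<lambda>x. 0 + (f 1 y / f 0 y) * f 0 x) = f 1"
      proof
        fix x
        show "0 + (f 1 y / f 0 y) * f 0 x = f 1 x"
          using nz[of y] by (simp only: const[of 0 x y] const[of 1 x y]) simp
      qed
      ultimately show ?thesis by metis
    qed
  qed
next
  case (insert j V)
  show ?case
  proof (rule hilbert_basis_adjoin[OF _ _ _ _ _ insert.IH])
    show "pol V \<subseteq> pol (insert j V)" by (rule pol_mono) blast
    show "(\<lambda>x. x j) \<in> pol (insert j V)" by (rule pol.pol_var) simp
    fix f assume "f \<in> pol (insert j V)"
    from pol_insert_poly[OF this] obtain P n where
      P: "P \<in> poly_over (pol V) n" "\<And>x t. f (x(j := t)) = poly (P x) t" by blast
    have "f x = poly (P x) (x j)" for x using P(2)[of x "x j"] by simp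
    then show "\<exists>P n. P \<in> poly_over (pol V) n \<and> (\<forall>x. f x = poly (P x) (x j))" using P(1) by blast
  qed unfold_locales
qed

section \<open>Zero sets of rational continuous functions\<close>

text \<open>The coordinate \<open>i\<close> of a point of \<open>real ^ 'n\<close> corresponds to the variable number \<open>to_nat i\<close>; the
  remaining natural numbers serve as auxiliary variables.\<close>

definition pt :: "(nat \<Rightarrow> real) \<Rightarrow> real ^ 'n" where
  "pt x = (\<chi> i. x (to_nat i))"

definition emb :: "real ^ 'n \<Rightarrow> nat \<Rightarrow> real" where
  "emb v = (\<lambda>j. v $ from_nat j)"

abbreviation coords :: "'n::finite itself \<Rightarrow> nat set" where
  "coords _ \<equiv> range (to_nat :: 'n \<Rightarrow> nat)"

lemma pt_emb [simp]: "pt (emb v) = v"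
  by (simp add: pt_def emb_def vec_eq_iff)

lemma rpf_pol:
  fixes q :: "real ^ 'n \<Rightarrow> real"
  assumes "real_polynomial_function q"
  shows "(\<lambda>x. q (pt x)) \<in> pol (coords TYPE('n))"
  using assms
proof induction
  case (linear f)
  have "f (pt x) = (\<Sum>i\<in>UNIV. x (to_nat i) * f (axis i 1))" for x
  proof -
    have "pt x = (\<Sum>i\<in>UNIV. x (to_nat i) *\<^sub>R (axis i 1 :: real ^ 'n))"
      by (simp add: vec_eq_iff pt_def axis_def if_distrib cong: if_cong)
    moreover have "linear f" using linear by (rule bounded_linear.linear)
    ultimately show ?thesis by (simp add: linear_sum linear_scale)
  qed
  moreover have "(\<lambda>x. \<Sum>i\<in>UNIV. x (to_nat i) * f (axis i 1)) \<in> pol (coords TYPE('n))"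
    by (intro pol.sum pol.pol_mult pol.pol_var pol.pol_const) simp
  ultimately show ?case by simp
qed (auto intro: pol.intros)

lemma pol_rpf:
  fixes c :: "(nat \<Rightarrow> real) \<Rightarrow> real"
  assumes "c \<in> pol (coords TYPE('n::finite))"
  obtains q :: "real ^ 'n \<Rightarrow> real" where "real_polynomial_function q" "\<And>x. c x = q (pt x)"
proof -
  have "\<exists>q :: real ^ 'n \<Rightarrow> real. real_polynomial_function q \<and> (\<forall>x. c x = q (pt x))"
    using assms
  proof induction
    case (pol_const c)
    show ?case by (rule exI[of _ "\<lambda>x. c"]) auto
  next
    case (pol_var i)
    then obtain k :: 'n where "i = to_nat k" by blast
    then show ?case
      by (intro exI[of _ "\<lambda>v. v $ k"]) (auto simp: pt_def bounded_linear_vec_nth)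
  next
    case (pol_add f g)
    then obtain p q :: "real ^ 'n \<Rightarrow> real" where
      "real_polynomial_function p" "\<And>x. f x = p (pt x)"
      "real_polynomial_function q" "\<And>x. g x = q (pt x)" by blast
    then show ?case by (intro exI[of _ "\<lambda>v. p v + q v"]) auto
  next
    case (pol_mult f g)
    then obtain p q :: "real ^ 'n \<Rightarrow> real" where
      "real_polynomial_function p" "\<And>x. f x = p (pt x)"
      "real_polynomial_function q" "\<And>x. g x = q (pt x)" by blast
    then show ?case by (intro exI[of _ "\<lambda>v. p v * q v"]) auto
  qed
  then show thesis using that by blast
qed

lemma ideal_gen_vanish: "f \<in> ideal_gen A F \<Longrightarrow> (\<And>g. g \<in> F \<Longrightarrow> g x = 0) \<Longrightarrow> f x = 0"
  by (induction rule: ideal_gen.induct) auto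

lemma polynomial_sequence:
  fixes p :: "nat \<Rightarrow> real ^ 'n \<Rightarrow> real"
  assumes "\<And>n. real_polynomial_function (p n)"
  shows "\<exists>n. \<forall>v. (\<forall>i<n. p i v = 0) \<longrightarrow> p n v = 0"
proof -
  define f where "f n = (\<lambda>x. p n (pt x))" for n
  have "f n \<in> pol (coords TYPE('n))" for n unfolding f_def by (rule rpf_pol[OF assms])
  moreover have "noetherian (pol (coords TYPE('n)))" by (rule pol_noetherian) simp
  ultimately obtain n where n: "f n \<in> ideal_gen (pol (coords TYPE('n))) (f ` {..<n})"
    unfolding noetherian_def by blast
  have "p n v = 0" if "\<forall>i<n. p i v = 0" for v
  proof -
    have "f n (emb v) = 0"
      by (rule ideal_gen_vanish[OF n]) (use that in \<open>auto simp: f_def\<close>)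
    then show ?thesis by (simp add: f_def)
  qed
  then show ?thesis by blast
qed

text \<open>In an infinite descent choose \<open>p n\<close> vanishing on the next set but not at
  some \<open>x n\<close> of the current one. All earlier \<open>p i\<close> vanish at
  \<open>x n\<close>, so \<open>polynomial_sequence\<close> forces \<open>p n\<close> to vanish
  there at some stage.\<close>

lemma zariski_minimal:
  fixes C :: "(real ^ 'n) set set"
  assumes ne: "C \<noteq> {}" and cl: "\<And>V. V \<in> C \<Longrightarrow> zariski_closed V"
  obtains V where "V \<in> C" "\<forall>W\<in>C. \<not> W \<subset> V"
proof (rule ccontr)
  assume neg: "\<not> thesis"
  have "\<forall>V\<in>C. \<exists>W. W \<in> C \<and> W \<subset> V" using neg that by blast
  then obtain f where f: "\<And>V. V \<in> C \<Longrightarrow> f V \<in> C \<and> f V \<subset> V" by metis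
  obtain V0 where V0: "V0 \<in> C" using ne by blast
  define V where "V n = (f ^^ n) V0" for n
  have VC: "V n \<in> C" for n by (induction n) (use V0 f in \<open>auto simp: V_def\<close>)
  have V: "V (Suc n) \<subset> V n" for n using f[OF VC[of n]] by (simp add: V_def)
  have dec: "V n \<subseteq> V i" if "i \<le> n" for i n
    using that by (induction n rule: dec_induct) (use V in auto)
  have "\<forall>n. \<exists>x p. x \<in> V n \<and> real_polynomial_function p \<and> p x \<noteq> 0 \<and> (\<forall>y\<in>V (Suc n). p y = 0)"
  proof
    fix n
    obtain x where x: "x \<in> V n" "x \<notin> V (Suc n)" using V[of n] by blast
    obtain P where P: "\<forall>p\<in>P. real_polynomial_function p" "V (Suc n) = {x. \<forall>p\<in>P. p x = 0}"
      using cl[OF VC[of "Suc n"]] unfolding zariski_closed_def by blast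
    obtain p where "p \<in> P" "p x \<noteq> 0" using x(2) unfolding P(2) by blast
    moreover have "\<forall>y\<in>V (Suc n). p y = 0" using \<open>p \<in> P\<close> unfolding P(2) by blast
    ultimately show "\<exists>x p. x \<in> V n \<and> real_polynomial_function p \<and> p x \<noteq> 0 \<and> (\<forall>y\<in>V (Suc n). p y = 0)"
      using x(1) P(1) by blast
  qed
  from choice[OF this] obtain x where
    "\<forall>n. \<exists>p. x n \<in> V n \<and> real_polynomial_function p \<and> p (x n) \<noteq> 0 \<and> (\<forall>y\<in>V (Suc n). p y = 0)" ..
  from choice[OF this] obtain p where
    "\<forall>n. x n \<in> V n \<and> real_polynomial_function (p n) \<and> p n (x n) \<noteq> 0 \<and> (\<forall>y\<in>V (Suc n). p n y = 0)" ..
  then have xp: "\<And>n. x n \<in> V n" "\<And>n. real_polynomial_function (p n)"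
    "\<And>n. p n (x n) \<noteq> 0" "\<And>n. \<forall>y\<in>V (Suc n). p n y = 0" by blast+
  from polynomial_sequence[OF xp(2)]
  obtain n where n: "\<forall>v. (\<forall>i<n. p i v = 0) \<longrightarrow> p n v = 0" ..
  have "p i (x n) = 0" if "i < n" for i
  proof -
    have "x n \<in> V (Suc i)" using xp(1)[of n] dec[of "Suc i" n] that by auto
    with xp(4)[of i] show ?thesis by (rule bspec)
  qed
  then have "p n (x n) = 0" by (intro n[rule_format])
  then show False using xp(3)[of n] by simp
qed

text \<open>A minimal set among the zero sets of finite subfamilies cannot be cut further by any
  member of \<open>P\<close>. Finiteness is what makes algebraic sets semialgebraic.\<close>

lemma zariski_closed_finite:
  fixes V :: "(real ^ 'n) set"
  assumes "zariski_closed V"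
  obtains F where "finite F" "\<forall>p\<in>F. real_polynomial_function p" "V = {x. \<forall>p\<in>F. p x = 0}"
proof -
  obtain P where P: "\<forall>p\<in>P. real_polynomial_function p" "V = {x. \<forall>p\<in>P. p x = 0}"
    using assms unfolding zariski_closed_def by blast
  define Z where "Z F = {x. \<forall>p\<in>F. p x = 0}" for F :: "(real ^ 'n \<Rightarrow> real) set"
  define C where "C = Z ` {F. finite F \<and> F \<subseteq> P}"
  have "C \<noteq> {}" unfolding C_def by blast
  moreover have "zariski_closed W" if "W \<in> C" for W
    using that P(1) unfolding C_def Z_def zariski_closed_def by blast
  ultimately obtain W where W: "W \<in> C" "\<forall>W'\<in>C. \<not> W' \<subset> W" by (rule zariski_minimal)
  obtain F where F: "finite F" "F \<subseteq> P" "W = Z F" using W(1) unfolding C_def by blast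
  have "p x = 0" if "p \<in> P" "x \<in> W" for p x
  proof -
    have "Z (insert p F) \<in> C" unfolding C_def using F that by blast
    moreover have "Z (insert p F) \<subseteq> W" unfolding F(3) Z_def by blast
    ultimately have "Z (insert p F) = W" using W(2) by blast
    then have "x \<in> Z (insert p F)" using that(2) by blast
    then show ?thesis unfolding Z_def by blast
  qed
  then have "V = Z F" using F(2,3) unfolding P(2) Z_def by blast
  then show thesis using that[of F] F(1,2) P(1) unfolding Z_def by blast
qed

lemma zariski_closed_Int_zero:
  assumes "zariski_closed V" "real_polynomial_function q"
  shows "zariski_closed (V \<inter> {x. q x = 0})"
proof -
  obtain P where P: "\<forall>p\<in>P. real_polynomial_function p" "V = {x. \<forall>p\<in>P. p x = 0}"
    using assms unfolding zariski_closed_def by blast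
  show ?thesis unfolding zariski_closed_def
    by (rule exI[of _ "insert q P"]) (use P assms(2) in auto)
qed

lemma zariski_closed_UNIV: "zariski_closed UNIV"
  unfolding zariski_closed_def by (rule exI[of _ "{}"]) simp

interpretation rpf: function_ring "Collect real_polynomial_function"
  by unfold_locales auto

lemma rpf_along_direction:
  fixes r :: "real ^ 'n \<Rightarrow> real"
  assumes "real_polynomial_function r"
  shows "\<exists>R n. R \<in> poly_over (Collect real_polynomial_function) n \<and>
    (\<forall>x s. r (x + s *\<^sub>R v) = poly (R x) s)"
  using assms
proof induction
  case (linear f)
  have f: "real_polynomial_function f" using linear by blast
  interpret bounded_linear f by (rule linear)
  have "(\<lambda>x. coeff [:f x, f v:] i) \<in> Collect real_polynomial_function" for i
    using f by (cases i; cases "i - 1") (auto simp: coeff_pCons split: nat.split)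
  then have "(\<lambda>x. [:f x, f v:]) \<in> poly_over (Collect real_polynomial_function) 2"
    by (auto simp: poly_over_def coeff_pCons split: nat.split)
  moreover have "f (x + s *\<^sub>R v) = poly [:f x, f v:] s" for x s
    by (simp add: add scale)
  ultimately show ?case by blast
next
  case (const c)
  have "(\<lambda>x. [:c:]) \<in> poly_over (Collect real_polynomial_function) 1"
    by (rule rpf.poly_over_const) auto
  moreover have "c = poly [:c:] s" for s by simp
  ultimately show ?case by blast
next
  case (add f g)
  then obtain P m Q n where PQ: "P \<in> poly_over (Collect real_polynomial_function) m"
    "\<And>x s. f (x + s *\<^sub>R v) = poly (P x) s" "Q \<in> poly_over (Collect real_polynomial_function) n"
    "\<And>x s. g (x + s *\<^sub>R v) = poly (Q x) s" by blast
  show ?case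
    by (rule exI[of _ "\<lambda>x. P x + Q x"], rule exI[of _ "max m n"], intro conjI allI)
      (rule rpf.poly_over_add[OF PQ(1,3)], simp only: PQ poly_add)
next
  case (mult f g)
  then obtain P m Q n where PQ: "P \<in> poly_over (Collect real_polynomial_function) m"
    "\<And>x s. f (x + s *\<^sub>R v) = poly (P x) s" "Q \<in> poly_over (Collect real_polynomial_function) n"
    "\<And>x s. g (x + s *\<^sub>R v) = poly (Q x) s" by blast
  show ?case
    by (rule exI[of _ "\<lambda>x. P x * Q x"], rule exI[of _ "m + n"], intro conjI allI)
      (rule rpf.poly_over_mult[OF PQ(1,3)], simp only: PQ poly_mult)
qed

text \<open>The existence of the limit forces the coefficients below \<open>a\<close> to vanish one
  after another, and each can be removed by dividing by \<open>s\<close>.\<close>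

lemma coeff_eq_limit:
  fixes p :: "real poly"
  assumes "((\<lambda>s. poly p s / s ^ a) \<longlongrightarrow> L) (at 0)"
  shows "coeff p a = L"
  using assms
proof (induction a arbitrary: p)
  case 0
  have "(poly p \<longlongrightarrow> poly p 0) (at 0)" by (intro isContD poly_isCont)
  moreover have "(poly p \<longlongrightarrow> L) (at 0)" using 0 by simp
  ultimately show ?case using tendsto_unique[OF trivial_limit_at] by (metis poly_0_coeff_0)
next
  case (Suc a)
  have "((\<lambda>s. (poly p s / s ^ Suc a) * s ^ Suc a) \<longlongrightarrow> L * 0 ^ Suc a) (at 0)"
    by (intro tendsto_intros Suc.prems)
  moreover have "\<forall>\<^sub>F s in at 0. (poly p s / s ^ Suc a) * s ^ Suc a = poly p s"
    by (auto simp: eventually_at_filter)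
  ultimately have "(poly p \<longlongrightarrow> 0) (at 0)" by (simp add: tendsto_cong)
  moreover have "(poly p \<longlongrightarrow> poly p 0) (at 0)" by (intro isContD poly_isCont)
  ultimately have "poly p 0 = 0" using tendsto_unique[OF trivial_limit_at] by blast
  then obtain p' where p': "p = pCons 0 p'" by (metis poly_0_coeff_0 coeff_pCons_0 pCons_cases)
  have "\<forall>\<^sub>F s in at 0. poly p s / s ^ Suc a = poly p' s / s ^ a"
    by (auto simp: eventually_at_filter p')
  then have "((\<lambda>s. poly p' s / s ^ a) \<longlongrightarrow> L) (at 0)"
    using Suc.prems by (simp only: tendsto_cong)
  from Suc.IH[OF this] show ?case by (simp add: p')
qed

text \<open>Write \<open>f = p/q\<close> and expand \<open>p (x + s v)\<close> and \<open>q (x + s v)\<close> in powers of \<open>s\<close>, for a direction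
  \<open>v\<close> that leaves the zero set of \<open>q\<close>. The lowest coefficient of the denominator that does not
  vanish identically on \<open>V\<close> is a denominator for the restriction of \<open>f\<close> to \<open>V\<close>.\<close>

lemma rational_restriction:
  fixes f :: "real ^ 'n \<Rightarrow> real"
  assumes cont: "continuous_on UNIV f" and rat: "rational_function f" and ne: "V \<noteq> {}"
  obtains p q where "real_polynomial_function p" "real_polynomial_function q"
    "\<exists>x\<in>V. q x \<noteq> 0" "\<forall>x\<in>V. q x \<noteq> 0 \<longrightarrow> f x = p x / q x"
proof -
  obtain p0 q0 z where pq: "real_polynomial_function p0" "real_polynomial_function q0"
    "q0 z \<noteq> 0" "\<And>x. q0 x \<noteq> 0 \<Longrightarrow> f x = p0 x / q0 x"
    using rat unfolding rational_function_iff by blast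
  obtain x0 where x0: "x0 \<in> V" using ne by blast
  \<comment> \<open>The line from \<open>x0\<close> in this direction passes through
    \<open>z\<close>, where \<open>q0\<close> is nonzero; hence \<open>Q x0\<close> is not the zero
    polynomial, even if \<open>q0\<close> vanishes on all of \<open>V\<close>.\<close>
  define v where "v = z - x0"
  obtain P m where P: "P \<in> poly_over (Collect real_polynomial_function) m"
    "\<And>x s. p0 (x + s *\<^sub>R v) = poly (P x) s" using rpf_along_direction[OF pq(1)] by blast
  obtain Q n where Q: "Q \<in> poly_over (Collect real_polynomial_function) n"
    "\<And>x s. q0 (x + s *\<^sub>R v) = poly (Q x) s" using rpf_along_direction[OF pq(2)] by blast
  have "poly (Q x0) 1 \<noteq> 0" using pq(3) Q(2)[of x0 1] by (simp add: v_def)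
  then have "Q x0 \<noteq> 0" by auto
  then have ex: "\<exists>i. \<exists>x\<in>V. coeff (Q x) i \<noteq> 0" using x0 by (metis leading_coeff_0_iff)
  define a where "a = (LEAST i. \<exists>x\<in>V. coeff (Q x) i \<noteq> 0)"
  have a: "\<exists>x\<in>V. coeff (Q x) a \<noteq> 0" unfolding a_def by (rule LeastI_ex[OF ex])
  have below: "coeff (Q x) i = 0" if "i < a" "x \<in> V" for i x
    using not_less_Least[of i "\<lambda>i. \<exists>x\<in>V. coeff (Q x) i \<noteq> 0"] that unfolding a_def by blast
  have "f x = coeff (P x) a / coeff (Q x) a" if x: "x \<in> V" "coeff (Q x) a \<noteq> 0" for x
  proof -
    define Q' where "Q' = poly_shift a (Q x)"
    have split: "Q x = monom 1 a * Q'" unfolding Q'_def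
      by (rule poly_eqI) (simp add: coeff_monom_mult coeff_poly_shift below[OF _ x(1)])
    have Q0: "poly Q' 0 = coeff (Q x) a" by (simp add: Q'_def poly_0_coeff_0 coeff_poly_shift)
    have Q'lim: "(poly Q' \<longlongrightarrow> coeff (Q x) a) (at 0)"
      using poly_isCont[of 0 Q'] unfolding isCont_def Q0 .
    have ev: "\<forall>\<^sub>F s in at 0. poly Q' s \<noteq> 0"
      using tendsto_imp_eventually_ne[OF Q'lim x(2)] .
    have "continuous_on UNIV (\<lambda>s. f (x + s *\<^sub>R v))"
      by (intro continuous_on_compose2[OF cont] continuous_intros) auto
    then have "isCont (\<lambda>s. f (x + s *\<^sub>R v)) 0"
      by (simp add: continuous_on_eq_continuous_at)
    then have "((\<lambda>s. f (x + s *\<^sub>R v)) \<longlongrightarrow> f (x + 0 *\<^sub>R v)) (at 0)"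
      unfolding isCont_def .
    then have lim: "((\<lambda>s. f (x + s *\<^sub>R v) * poly Q' s) \<longlongrightarrow> f x * coeff (Q x) a) (at 0)"
      using Q'lim by (auto intro: tendsto_mult)
    have "\<forall>\<^sub>F s in at 0. s \<noteq> (0::real)" by (simp add: eventually_at_filter)
    \<comment> \<open>For small nonzero \<open>s\<close> the point \<open>x + s v\<close> avoids the
      zeros of \<open>q0\<close>, so the quotient formula holds there; continuity of
      \<open>f\<close> then carries it to \<open>x\<close>.\<close>
    with ev have "\<forall>\<^sub>F s in at 0. f (x + s *\<^sub>R v) * poly Q' s = poly (P x) s / s ^ a"
    proof eventually_elim
      case (elim s)
      have "q0 (x + s *\<^sub>R v) = s ^ a * poly Q' s" unfolding Q(2) split by (simp add: poly_monom)
      then show ?case using elim pq(4)[of "x + s *\<^sub>R v"] P(2)[of x s] by simp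
    qed
    then have "((\<lambda>s. poly (P x) s / s ^ a) \<longlongrightarrow> f x * coeff (Q x) a) (at 0)"
      using lim by (simp only: tendsto_cong)
    then have "coeff (P x) a = f x * coeff (Q x) a" by (rule coeff_eq_limit)
    then show ?thesis using x(2) by simp
  qed
  then show thesis
    using that[of "\<lambda>x. coeff (P x) a" "\<lambda>x. coeff (Q x) a"] a poly_overD(1)[OF P(1)] poly_overD(1)[OF Q(1)]
    by simp
qed

section \<open>Continuous rational functions as finite stratified quotients\<close>

fun piecewise :: "(('a \<Rightarrow> real) \<times> ('a \<Rightarrow> real)) list \<Rightarrow> 'a \<Rightarrow> real" where
  "piecewise [] x = 0"
| "piecewise ((p, q) # l) x = (if q x \<noteq> 0 then p x / q x else piecewise l x)"

text \<open>On a minimal closed set without such a list, the restriction of \<open>f\<close> is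
  \<open>p/q\<close> off the proper closed subset where \<open>q\<close> vanishes. That subset has a
  list by minimality, and prepending \<open>(p, q)\<close> gives one for the whole set.\<close>

lemma rational_piecewise:
  fixes f :: "real ^ 'n \<Rightarrow> real"
  assumes cont: "continuous_on UNIV f" and rat: "rational_function f"
  obtains l where "\<forall>(p, q)\<in>set l. real_polynomial_function p \<and> real_polynomial_function q"
    "f = piecewise l"
proof -
  define good where "good V \<longleftrightarrow> (\<exists>l. (\<forall>(p, q)\<in>set l. real_polynomial_function p \<and>
    real_polynomial_function q) \<and> (\<forall>x\<in>V. f x = piecewise l x))" for V
  have "good V" if "zariski_closed V" for V
  proof (rule ccontr)
    assume "\<not> good V"
    then have "{V. zariski_closed V \<and> \<not> good V} \<noteq> {}" using that by blast
    then obtain W where W: "W \<in> {V. zariski_closed V \<and> \<not> good V}"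
      "\<forall>W'\<in>{V. zariski_closed V \<and> \<not> good V}. \<not> W' \<subset> W"
      by (rule zariski_minimal) blast
    have "good {}" unfolding good_def by (rule exI[of _ "[]"]) simp
    then have "W \<noteq> {}" using W(1) by blast
    then obtain p q where pq: "real_polynomial_function p" "real_polynomial_function q"
      "\<exists>x\<in>W. q x \<noteq> 0" "\<forall>x\<in>W. q x \<noteq> 0 \<longrightarrow> f x = p x / q x"
      by (rule rational_restriction[OF cont rat])
    have "zariski_closed (W \<inter> {x. q x = 0})"
      using W(1) pq(2) by (intro zariski_closed_Int_zero) auto
    moreover have "W \<inter> {x. q x = 0} \<subset> W" using pq(3) by blast
    ultimately have "good (W \<inter> {x. q x = 0})" using W(2) by blast
    then obtain l where l: "\<forall>(p, q)\<in>set l. real_polynomial_function p \<and> real_polynomial_function q"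
      "\<forall>x\<in>W \<inter> {x. q x = 0}. f x = piecewise l x" unfolding good_def by blast
    have "good W" unfolding good_def
      by (rule exI[of _ "(p, q) # l"]) (use l pq in auto)
    then show False using W(1) by blast
  qed
  from this[OF zariski_closed_UNIV] show thesis using that unfolding good_def by (metis UNIV_I ext)
qed

lemma semialg_INT:
  assumes "finite F" "\<And>i. i \<in> F \<Longrightarrow> semialg V (S i)"
  shows "semialg V (\<Inter>i\<in>F. S i)"
  using assms
proof (induction F rule: finite_induct)
  case empty
  have "semialg V UNIV" unfolding semialg_def by (rule exI[of _ "{}"]) simp
  then show ?case by simp
next
  case (insert i F)
  then show ?case by (simp add: semialg_Int)
qed

lemma zariski_closed_semialg:
  fixes V :: "(real ^ 'n) set"
  assumes "zariski_closed V"
  shows "semialg (coords TYPE('n)) {x. pt x \<in> V}"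
proof -
  obtain F where F: "finite F" "\<forall>p\<in>F. real_polynomial_function p" "V = {x. \<forall>p\<in>F. p x = 0}"
    by (rule zariski_closed_finite[OF assms])
  have "semialg (coords TYPE('n)) (\<Inter>p\<in>F. {x. p (pt x) = 0})"
    by (rule semialg_INT[OF F(1)], rule semialg_zero, rule rpf_pol) (use F(2) in blast)
  moreover have "(\<Inter>p\<in>F. {x. p (pt x) = 0}) = {x. pt x \<in> V}" unfolding F(3) by auto
  ultimately show ?thesis by simp
qed

section \<open>Generic points and reduction to a single function\<close>

definition zariski_irreducible :: "(real ^ 'n) set \<Rightarrow> bool" where
  "zariski_irreducible V \<longleftrightarrow> V \<noteq> {} \<and>
    (\<forall>p q. real_polynomial_function p \<longrightarrow> real_polynomial_function q \<longrightarrow> (\<forall>x\<in>V. p x * q x = 0)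
      \<longrightarrow> (\<forall>x\<in>V. p x = 0) \<or> (\<forall>x\<in>V. q x = 0))"

text \<open>A countable base reduces the uncountably many \<open>q\<close> to countably many: for
  each basic open \<open>U\<close> pick, if possible, one \<open>q\<close> that vanishes on
  \<open>V \<inter> U\<close> but not on \<open>V\<close>. A point of \<open>V\<close> off the zeros
  of all these and of \<open>q0\<close> cannot have a neighbourhood in which some admissible set
  \<open>{y\<in>V. q y \<noteq> 0}\<close> is missed.\<close>

lemma generic_point:
  fixes V :: "(real ^ 'n) set"
  assumes V: "zariski_closed V" "zariski_irreducible V"
    and q0: "real_polynomial_function q0" "\<exists>x\<in>V. q0 x \<noteq> 0"
  obtains x where "x \<in> V" "q0 x \<noteq> 0"
    "\<forall>q. real_polynomial_function q \<and> (\<exists>y\<in>V. q y \<noteq> 0) \<longrightarrow> x \<in> closure {y\<in>V. q y \<noteq> 0}"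
proof -
  define W where "W = {x. pt x \<in> V}"
  have ptW: "emb v \<in> W \<longleftrightarrow> v \<in> V" for v by (simp add: W_def)
  interpret irreducible_set "coords TYPE('n)" W
  proof
    show "finite (coords TYPE('n))" by simp
    show "semialg (coords TYPE('n)) W" unfolding W_def by (rule zariski_closed_semialg[OF V(1)])
    obtain v where "v \<in> V" using V(2) unfolding zariski_irreducible_def by blast
    then show "W \<noteq> {}" using ptW by blast
    fix p q assume "p \<in> pol (coords TYPE('n))" "q \<in> pol (coords TYPE('n))"
      and pq: "\<And>x. x \<in> W \<Longrightarrow> p x * q x = 0"
    then obtain p' q' :: "real ^ 'n \<Rightarrow> real" where
      p': "real_polynomial_function p'" "\<And>x. p x = p' (pt x)" and
      q': "real_polynomial_function q'" "\<And>x. q x = q' (pt x)" by (metis pol_rpf)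
    have "\<forall>v\<in>V. p' v * q' v = 0" using pq p'(2) q'(2) ptW by (metis pt_emb)
    then have "(\<forall>v\<in>V. p' v = 0) \<or> (\<forall>v\<in>V. q' v = 0)"
      using V(2) p'(1) q'(1) unfolding zariski_irreducible_def by blast
    then show "(\<forall>x\<in>W. p x = 0) \<or> (\<forall>x\<in>W. q x = 0)" unfolding W_def p'(2) q'(2) by blast
  qed
  obtain B :: "(real ^ 'n) set set" where B: "countable B" "topological_basis B"
    using ex_countable_basis by blast
  define bad where "bad U q \<longleftrightarrow> real_polynomial_function q \<and> (\<exists>y\<in>V. q y \<noteq> 0) \<and> (\<forall>y\<in>V \<inter> U. q y = 0)"
    for U q
  define r where "r U = (SOME q. bad U q)" for U
  define B' where "B' = {U\<in>B. \<exists>q. bad U q}"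
  have r: "bad U (r U)" if "U \<in> B'" for U
  proof -
    have "\<exists>q. bad U q" using that unfolding B'_def by blast
    then show ?thesis unfolding r_def by (rule someI_ex)
  qed
  define Q where "Q = (\<lambda>q x. q (pt x)) ` insert q0 (r ` B')"
  have "\<exists>x\<in>W. \<forall>q\<in>Q. q x \<noteq> 0"
  proof (rule countable_nonvanishing)
    have "countable B'" using B(1) unfolding B'_def by simp
    then show "countable Q" unfolding Q_def by simp
    show "Q \<subseteq> pol (coords TYPE('n))"
      unfolding Q_def using rpf_pol q0(1) r unfolding bad_def by blast
    fix q assume "q \<in> Q"
    then obtain q' where q': "q = (\<lambda>x. q' (pt x))" "q' \<in> insert q0 (r ` B')" unfolding Q_def by blast
    then have "\<exists>y\<in>V. q' y \<noteq> 0" using q0(2) r unfolding bad_def by blast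
    then obtain y where "y \<in> V" "q' y \<noteq> 0" by blast
    then show "\<exists>x\<in>W. q x \<noteq> 0" unfolding q'(1) using ptW by (intro bexI[of _ "emb y"]) simp_all
  qed
  then obtain x where x: "x \<in> W" "\<forall>q\<in>Q. q x \<noteq> 0" by blast
  have xV: "pt x \<in> V" using x(1) by (simp add: W_def)
  have xQ: "q (pt x) \<noteq> 0" if "q \<in> insert q0 (r ` B')" for q
    by (rule bspec[OF x(2)[unfolded Q_def] imageI[OF that]])
  have xq: "q0 (pt x) \<noteq> 0" by (rule xQ) simp
  have "pt x \<in> closure {y\<in>V. q y \<noteq> 0}"
    if q: "real_polynomial_function q" "\<exists>y\<in>V. q y \<noteq> 0" for q
  proof (rule ccontr)
    assume "pt x \<notin> closure {y\<in>V. q y \<noteq> 0}"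
    then have "pt x \<in> - closure {y\<in>V. q y \<noteq> 0}" by simp
    then obtain U where U: "U \<in> B" "pt x \<in> U" "U \<subseteq> - closure {y\<in>V. q y \<noteq> 0}"
      using topological_basisE[OF B(2) open_Compl[OF closed_closure]] by blast
    have "bad U q" unfolding bad_def using q U(3) closure_subset[of "{y\<in>V. q y \<noteq> 0}"] by blast
    then have UB: "U \<in> B'" using U(1) unfolding B'_def by blast
    then have "r U (pt x) = 0" using r[OF UB] xV U(2) unfolding bad_def by blast
    moreover have "r U (pt x) \<noteq> 0" using UB by (intro xQ) blast
    ultimately show False by blast
  qed
  then show thesis using that[OF xV xq] by blast
qed

theorem zero_set_single_function:
  fixes I :: "(real ^ 'n \<Rightarrow> real) set"
  assumes I: "\<And>f. f \<in> I \<Longrightarrow> continuous_on UNIV f \<and> rational_function f" "I \<noteq> {}"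
    "\<And>f h. f \<in> I \<Longrightarrow> h \<in> I \<Longrightarrow> (\<lambda>x. f x * f x + h x * h x) \<in> I"
    and g: "continuous_on UNIV g" "rational_function g" "\<And>x. x \<in> zero_set I \<Longrightarrow> g x = 0"
  obtains f where "f \<in> I" "\<forall>x. f x = 0 \<longrightarrow> g x = 0"
proof -
  define good where "good V \<longleftrightarrow> (\<exists>f\<in>I. \<forall>x\<in>V. f x = 0 \<longrightarrow> g x = 0)" for V
  have good_cover: "good V" if c: "good V1" "good V2" "f \<in> I" "\<And>x. x \<in> V \<Longrightarrow> f x = 0 \<Longrightarrow> g x \<noteq> 0 \<Longrightarrow> x \<in> V1 \<or> x \<in> V2"
    for V V1 V2 f
  proof -
    obtain f1 f2 where f12: "f1 \<in> I" "\<forall>x\<in>V1. f1 x = 0 \<longrightarrow> g x = 0" "f2 \<in> I" "\<forall>x\<in>V2. f2 x = 0 \<longrightarrow> g x = 0"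
      using c(1,2) unfolding good_def by blast
    \<comment> \<open>The common witness is the sum of the squares of \<open>f\<close> and of this
      sum of squares; it vanishes exactly where \<open>f\<close>, \<open>f1\<close> and
      \<open>f2\<close> all do.\<close>
    define h where "h = (\<lambda>x. f1 x * f1 x + f2 x * f2 x)"
    have h: "h \<in> I" unfolding h_def by (rule I(3)[OF f12(1,3)])
    have "\<forall>x\<in>V. f x * f x + h x * h x = 0 \<longrightarrow> g x = 0"
    proof (intro ballI impI)
      fix x assume x: "x \<in> V" and "f x * f x + h x * h x = 0"
      then have "f x = 0" "h x = 0" by (simp_all only: sum_squares_eq_zero_iff)
      then have "f1 x = 0" "f2 x = 0" unfolding h_def by (simp_all only: sum_squares_eq_zero_iff)
      then show "g x = 0" using c(4)[OF x \<open>f x = 0\<close>] f12(2,4) by blast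
    qed
    then show ?thesis unfolding good_def by (rule bexI[OF _ I(3)[OF c(3) h]])
  qed
  have "good UNIV"
  proof (rule ccontr)
    assume "\<not> good UNIV"
    then have "{V. zariski_closed V \<and> \<not> good V} \<noteq> {}" using zariski_closed_UNIV by blast
    then obtain V where V: "V \<in> {V. zariski_closed V \<and> \<not> good V}"
      "\<forall>W\<in>{V. zariski_closed V \<and> \<not> good V}. \<not> W \<subset> V"
      by (rule zariski_minimal) blast
    have Vc: "zariski_closed V" and ngV: "\<not> good V" using V(1) by auto
    obtain f0 where f0: "f0 \<in> I" using I(2) by blast
    have cut: "good (V \<inter> {x. p x = 0})" if "real_polynomial_function p" "\<exists>x\<in>V. p x \<noteq> 0" for p
    proof -
      have "V \<inter> {x. p x = 0} \<subset> V" using that(2) by blast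
      then show ?thesis using V(2) zariski_closed_Int_zero[OF Vc that(1)] by blast
    qed
    have "good {}" using f0 unfolding good_def by blast
    then have ne: "V \<noteq> {}" using ngV by blast
    have irr: "zariski_irreducible V"
      unfolding zariski_irreducible_def
    proof (intro conjI ne allI impI, rule ccontr)
      fix p q assume pq: "real_polynomial_function p" "real_polynomial_function q" "\<forall>x\<in>V. p x * q x = 0"
        and n: "\<not> ((\<forall>x\<in>V. p x = 0) \<or> (\<forall>x\<in>V. q x = 0))"
      have "good (V \<inter> {x. p x = 0})" "good (V \<inter> {x. q x = 0})" using cut pq n by blast+
      from good_cover[OF this f0, of V] have "good V" using pq(3) by auto
      then show False using ngV by blast
    qed
    obtain p' q' where g': "real_polynomial_function p'" "real_polynomial_function q'"
      "\<exists>x\<in>V. q' x \<noteq> 0" "\<forall>x\<in>V. q' x \<noteq> 0 \<longrightarrow> g x = p' x / q' x"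
      by (rule rational_restriction[OF g(1,2) ne])
    have p': "\<exists>x\<in>V. p' x \<noteq> 0"
    proof (rule ccontr)
      assume n: "\<not> (\<exists>x\<in>V. p' x \<noteq> 0)"
      have c: "good (V \<inter> {x. q' x = 0})" using cut g'(2,3) by blast
      \<comment> \<open>If \<open>p'\<close> vanished on \<open>V\<close>, so would \<open>g\<close>
        off the zeros of \<open>q'\<close>; only this proper closed part remains, and it serves as
        both members of the cover.\<close>
      have "good V" by (rule good_cover[OF c c f0]) (use n g'(4) in force)
      then show False using ngV by blast
    qed
    have nz: "\<exists>x\<in>V. p' x * q' x \<noteq> 0"
      using irr p' g'(1-3) unfolding zariski_irreducible_def by blast
    have rp: "real_polynomial_function (\<lambda>x. p' x * q' x)" using g'(1,2) by blast
    obtain x where x: "x \<in> V" "p' x * q' x \<noteq> 0"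
      "\<forall>q. real_polynomial_function q \<and> (\<exists>y\<in>V. q y \<noteq> 0) \<longrightarrow> x \<in> closure {y\<in>V. q y \<noteq> 0}"
      by (rule generic_point[OF Vc irr rp nz])
    have "f x = 0" if f: "f \<in> I" for f
    proof -
      obtain p q where pq: "real_polynomial_function p" "real_polynomial_function q"
        "\<exists>x\<in>V. q x \<noteq> 0" "\<forall>x\<in>V. q x \<noteq> 0 \<longrightarrow> f x = p x / q x"
        using I(1)[OF f] by (elim conjE) (rule rational_restriction[OF _ _ ne])
      \<comment> \<open>The zeros of \<open>f\<close> on \<open>V\<close> lie where \<open>p\<close>
        or \<open>q\<close> vanishes. If neither locus is all of \<open>V\<close>, both are good by
        minimality, and then \<open>V\<close> is good too.\<close>
      have "\<forall>y\<in>V. p y = 0"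
      proof (rule ccontr)
        assume "\<not> (\<forall>y\<in>V. p y = 0)"
        then have "good (V \<inter> {x. p x = 0})" "good (V \<inter> {x. q x = 0})" using cut pq by blast+
        from good_cover[OF this f, of V] have "good V" using pq(4) by force
        then show False using ngV by blast
      qed
      then have "{y\<in>V. q y \<noteq> 0} \<subseteq> {y. f y = 0}" using pq(4) by auto
      moreover have "closed {y. f y = 0}"
        using I(1)[OF f] by (intro closed_Collect_eq continuous_on_const) blast
      ultimately have "closure {y\<in>V. q y \<noteq> 0} \<subseteq> {y. f y = 0}" by (rule closure_minimal)
      then show ?thesis using x(3) pq(2,3) by blast
    qed
    then have "g x = 0" by (intro g(3)) (simp add: zero_set_def)
    then show False using x(1,2) g'(4) by auto
  qed
  then show thesis using that unfolding good_def by blast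
qed

section \<open>The Lojasiewicz inequality\<close>

lemma poly_eventually_le_power:
  fixes a :: "real poly"
  shows "\<exists>e. \<forall>\<^sub>F r in at_top. \<bar>poly a r\<bar> \<le> r ^ e"
proof (induction a)
  case 0
  show ?case by (rule exI[of _ 0]) simp
next
  case (pCons b p)
  then obtain e where e: "\<forall>\<^sub>F r in at_top. \<bar>poly p r\<bar> \<le> r ^ e" by blast
  have "\<forall>\<^sub>F r in at_top. \<bar>poly (pCons b p) r\<bar> \<le> r ^ (e + 2)"
    using e eventually_ge_at_top[of "max 2 \<bar>b\<bar>"]
  proof eventually_elim
    case (elim r)
    have r: "r \<ge> 2" "\<bar>b\<bar> \<le> r" using elim(2) by auto
    have "r ^ 1 \<le> r ^ (e + 1)" using r by (intro power_increasing) auto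
    with r(2) have "\<bar>b\<bar> \<le> r ^ (e + 1)" unfolding power_one_right by (rule order_trans)
    moreover have "\<bar>r * poly p r\<bar> \<le> r * r ^ e"
      unfolding abs_mult using r elim(1) by (intro mult_mono) auto
    moreover have "2 * r ^ (e + 1) \<le> r * r ^ (e + 1)" using r by (intro mult_right_mono) auto
    ultimately have "\<bar>b + r * poly p r\<bar> \<le> r * r ^ (e + 1)" by simp
    then show ?case by simp
  qed
  then show ?case by blast
qed

lemma poly_eventually_ge:
  fixes a :: "real poly"
  assumes "a \<noteq> 0"
  shows "\<exists>d>0. \<forall>\<^sub>F r in at_top. \<bar>poly a r\<bar> \<ge> d"
proof -
  have *: "\<exists>d>0. \<forall>\<^sub>F r in at_top. \<bar>poly a r\<bar> \<ge> d" if lc: "lead_coeff a > 0" for a :: "real poly"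
  proof -
    obtain n where n: "\<And>x. x \<ge> n \<Longrightarrow> poly a x \<ge> lead_coeff a" using poly_pinfty_gt_lc[OF lc] by blast
    have "\<forall>\<^sub>F r in at_top. \<bar>poly a r\<bar> \<ge> lead_coeff a"
      using eventually_ge_at_top[of n] by eventually_elim (use n in force)
    then show ?thesis using lc by blast
  qed
  have "x > 0 \<or> - x > 0" if "x \<noteq> 0" for x :: real using that by linarith
  moreover have "lead_coeff a \<noteq> 0" using assms by (simp only: leading_coeff_0_iff not_False_eq_True)
  ultimately have "lead_coeff a > 0 \<or> lead_coeff (- a) > 0"
    unfolding degree_minus coeff_minus by blast
  then show ?thesis using *[of a] *[of "- a"] by (auto simp: poly_minus)
qed

text \<open>Here \<open>poly c [:s:]\<close> is a polynomial in \<open>r\<close>. In the Horner form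
  \<open>a + s c\<close> the second summand dominates once \<open>s\<close> exceeds a suitable power
  of \<open>r\<close>, because \<open>\<bar>c\<bar> \<ge> d\<close> there while \<open>a\<close>
  grows at most like a power of \<open>r\<close>. The lower bound \<open>d\<close> is part of the
  claim for the sake of the induction.\<close>

lemma bivariate_stable_sign:
  fixes c :: "real poly poly"
  assumes "c \<noteq> 0"
  shows "\<exists>M d. d > 0 \<and> (\<forall>\<^sub>F r in at_top. \<forall>s>r ^ M. \<bar>poly (poly c [:s:]) r\<bar> \<ge> d \<and>
    (\<forall>s'>r ^ M. sgn (poly (poly c [:s:]) r) = sgn (poly (poly c [:s':]) r)))"
  using assms
proof (induction c)
  case 0
  then show ?case by simp
next
  case (pCons a c)
  have e: "poly (poly (pCons a c) [:s:]) r = poly a r + s * poly (poly c [:s:]) r" for s r by simp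
  show ?case
  proof (cases "c = 0")
    case True
    then have "a \<noteq> 0" using pCons.hyps by auto
    then obtain d where "d > 0" "\<forall>\<^sub>F r in at_top. \<bar>poly a r\<bar> \<ge> d" using poly_eventually_ge by blast
    then show ?thesis unfolding e True by (intro exI[of _ 0] exI[of _ d]) simp
  next
    case False
    from pCons.IH[OF this] obtain M d where d: "d > 0" and M: "\<forall>\<^sub>F r in at_top. \<forall>s>r ^ M.
        \<bar>poly (poly c [:s:]) r\<bar> \<ge> d \<and>
        (\<forall>s'>r ^ M. sgn (poly (poly c [:s:]) r) = sgn (poly (poly c [:s':]) r))" by blast
    obtain k where k: "\<forall>\<^sub>F r in at_top. \<bar>poly (smult (1 / d) a) r\<bar> \<le> r ^ k"
      using poly_eventually_le_power by blast
    \<comment> \<open>The extra factor \<open>r \<ge> 2\<close> beyond \<open>r ^ k\<close> leaves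
      room for \<open>d\<close> itself, which preserves the lower bound.\<close>
    define M' where "M' = max M (k + 1)"
    have "\<forall>\<^sub>F r in at_top. \<forall>s>r ^ M'. \<bar>poly (poly (pCons a c) [:s:]) r\<bar> \<ge> d \<and>
        sgn (poly (poly (pCons a c) [:s:]) r) = sgn (poly (poly c [:s:]) r) \<and>
        (\<forall>s'>r ^ M'. sgn (poly (poly c [:s:]) r) = sgn (poly (poly c [:s':]) r))"
      using M k eventually_ge_at_top[of 2]
    proof eventually_elim
      case (elim r)
      have le: "r ^ M \<le> r ^ M'" "r ^ (k + 1) \<le> r ^ M'"
        unfolding M'_def using elim(3) by (intro power_increasing; simp)+
      have "\<bar>poly a r\<bar> \<le> d * r ^ k" using elim(2) d by (simp add: abs_mult field_simps)
      moreover have "d * 2 * r ^ k \<le> d * r * r ^ k"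
        using elim(3) d by (intro mult_right_mono mult_left_mono) auto
      moreover have "1 \<le> r ^ k" using elim(3) by (intro one_le_power) simp
      then have "d * 1 \<le> d * r ^ k" using d by (intro mult_left_mono) auto
      ultimately have A: "\<bar>poly a r\<bar> + d \<le> d * r ^ (k + 1)" by (simp add: algebra_simps)
      show ?case
      proof (intro allI impI)
        fix s assume s: "r ^ M' < s"
        let ?C = "poly (poly c [:s:]) r"
        have sM: "r ^ M < s" "r ^ (k + 1) < s" using s le by auto
        have C: "\<bar>?C\<bar> \<ge> d" using elim(1) sM(1) by blast
        have spos: "s > 0" using sM(2) elim(3) by (meson le_less_trans zero_le_power zero_le_numeral order_trans)
        have "d * r ^ (k + 1) \<le> \<bar>?C\<bar> * s"
          using C d sM(2) elim(3) by (intro mult_mono) auto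
        then have B: "\<bar>poly a r\<bar> + d \<le> \<bar>s * ?C\<bar>" using A spos by (simp add: abs_mult mult.commute)
        have "\<bar>poly a r + s * ?C\<bar> \<ge> d" using B by linarith
        moreover have "sgn (poly a r + s * ?C) = sgn (s * ?C)"
          using B d by (auto simp: sgn_real_def abs_if split: if_splits)
        then have "sgn (poly a r + s * ?C) = sgn ?C" using spos by (simp add: sgn_mult)
        moreover have "\<forall>s'>r ^ M'. sgn ?C = sgn (poly (poly c [:s':]) r)"
          using elim(1) sM(1) le(1) by (meson le_less_trans)
        ultimately show "d \<le> \<bar>poly (poly (pCons a c) [:s:]) r\<bar> \<and>
            sgn (poly (poly (pCons a c) [:s:]) r) = sgn ?C \<and>
            (\<forall>s'>r ^ M'. sgn ?C = sgn (poly (poly c [:s':]) r))" unfolding e by blast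
      qed
    qed
    then have "\<forall>\<^sub>F r in at_top. \<forall>s>r ^ M'. \<bar>poly (poly (pCons a c) [:s:]) r\<bar> \<ge> d \<and>
        (\<forall>s'>r ^ M'. sgn (poly (poly (pCons a c) [:s:]) r) = sgn (poly (poly (pCons a c) [:s':]) r))"
      by eventually_elim metis
    then show ?thesis using d by blast
  qed
qed

lemma pol_bivariate:
  assumes "f \<in> pol {a, b}"
  shows "\<exists>c :: real poly poly. \<forall>x. f x = poly (poly c [:x b:]) (x a)"
  using assms
proof induction
  case (pol_const c)
  show ?case by (rule exI[of _ "[:[:c:]:]"]) simp
next
  case (pol_var i)
  then consider "i = a" | "i = b" by blast
  then show ?case
  proof cases
    case 1
    then show ?thesis by (intro exI[of _ "[:[:0, 1:]:]"]) simp
  next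
    case 2
    then show ?thesis by (intro exI[of _ "[:0, 1:]"]) simp
  qed
next
  case (pol_add f g)
  then obtain c d :: "real poly poly" where "\<And>x. f x = poly (poly c [:x b:]) (x a)"
    "\<And>x. g x = poly (poly d [:x b:]) (x a)" by blast
  then show ?case by (intro exI[of _ "c + d"]) simp
next
  case (pol_mult f g)
  then obtain c d :: "real poly poly" where "\<And>x. f x = poly (poly c [:x b:]) (x a)"
    "\<And>x. g x = poly (poly d [:x b:]) (x a)" by blast
  then show ?case by (intro exI[of _ "c * d"]) simp
qed

lemma pol_stable_sign:
  assumes "f \<in> pol {a, b}"
  shows "\<exists>M. \<forall>\<^sub>F r in at_top. \<forall>x y. x a = r \<and> y a = r \<and> x b > r ^ M \<and> y b > r ^ M
    \<longrightarrow> sgn (f x) = sgn (f y)"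
proof -
  obtain c :: "real poly poly" where c: "\<And>x. f x = poly (poly c [:x b:]) (x a)"
    using pol_bivariate[OF assms] by blast
  show ?thesis
  proof (cases "c = 0")
    case True
    then show ?thesis by (simp add: c)
  next
    case False
    from bivariate_stable_sign[OF this] obtain M d where
      M: "\<forall>\<^sub>F r in at_top. \<forall>s>r ^ M. \<bar>poly (poly c [:s:]) r\<bar> \<ge> d \<and>
        (\<forall>s'>r ^ M. sgn (poly (poly c [:s:]) r) = sgn (poly (poly c [:s':]) r))" by blast
    have "\<forall>\<^sub>F r in at_top. \<forall>x y. x a = r \<and> y a = r \<and> x b > r ^ M \<and> y b > r ^ M
        \<longrightarrow> sgn (f x) = sgn (f y)"
      using M by eventually_elim (simp add: c)
    then show ?thesis by blast
  qed
qed

text \<open>For large \<open>r\<close> all describing signs are constant on the part of the vertical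
  line above \<open>r ^ M\<close>. One point of \<open>T\<close> there would bring the whole ray
  into \<open>T\<close>, against boundedness.\<close>

lemma semialg_plane_growth:
  assumes T: "semialg {a, b} T" and ab: "a \<noteq> b"
    and bdd: "\<And>r. \<exists>B. \<forall>x\<in>T. x a = r \<longrightarrow> x b \<le> B"
  obtains M R where "\<forall>x\<in>T. x a \<ge> R \<longrightarrow> x b \<le> x a ^ M"
proof -
  obtain C where C: "C\<subseteq>pol {a, b}" "finite C" "\<And>x y. same_signs C x y \<Longrightarrow> (x \<in> T \<longleftrightarrow> y \<in> T)"
    using T unfolding semialg_def by blast
  have "\<exists>M. \<forall>\<^sub>F r in at_top. \<forall>c\<in>C. \<forall>x y. x a = r \<and> y a = r \<and> x b > r ^ M \<and> y b > r ^ M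
      \<longrightarrow> sgn (c x) = sgn (c y)"
    using C(2,1)
  proof (induction C rule: finite_induct)
    case empty
    show ?case by simp
  next
    case (insert c C)
    then obtain M where M: "\<forall>\<^sub>F r in at_top. \<forall>c\<in>C. \<forall>x y. x a = r \<and> y a = r \<and> x b > r ^ M \<and> y b > r ^ M
      \<longrightarrow> sgn (c x) = sgn (c y)" by auto
    obtain N where N: "\<forall>\<^sub>F r in at_top. \<forall>x y. x a = r \<and> y a = r \<and> x b > r ^ N \<and> y b > r ^ N
      \<longrightarrow> sgn (c x) = sgn (c y)" using pol_stable_sign[of c a b] insert.prems by blast
    have "\<forall>\<^sub>F r in at_top. \<forall>c'\<in>insert c C. \<forall>x y. x a = r \<and> y a = r \<and> x b > r ^ max M N \<and> y b > r ^ max M N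
      \<longrightarrow> sgn (c' x) = sgn (c' y)"
      using M N eventually_ge_at_top[of 1]
    proof eventually_elim
      case (elim r)
      have le: "r ^ M \<le> r ^ max M N" "r ^ N \<le> r ^ max M N"
        using elim(3) by (intro power_increasing; simp)+
      show ?case
      proof (intro ballI allI impI, elim conjE)
        fix c' x y assume c': "c' \<in> insert c C" and xy: "x a = r" "y a = r"
          "x b > r ^ max M N" "y b > r ^ max M N"
        have "x b > r ^ M" "y b > r ^ M" "x b > r ^ N" "y b > r ^ N" using xy(3,4) le by linarith+
        then show "sgn (c' x) = sgn (c' y)" using c' elim(1,2) xy(1,2) by blast
      qed
    qed
    then show ?case by blast
  qed
  then obtain M R where MR: "\<And>r c x y. r \<ge> R \<Longrightarrow> c \<in> C \<Longrightarrow> x a = r \<Longrightarrow> y a = r \<Longrightarrow>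
      x b > r ^ M \<Longrightarrow> y b > r ^ M \<Longrightarrow> sgn (c x) = sgn (c y)"
    unfolding eventually_at_top_linorder by blast
  have "x b \<le> x a ^ M" if x: "x \<in> T" "x a \<ge> R" for x
  proof (rule ccontr)
    assume n: "\<not> x b \<le> x a ^ M"
    obtain B where B: "\<forall>y\<in>T. y a = x a \<longrightarrow> y b \<le> B" using bdd by blast
    define y where "y = x(b := max B (x b) + 1)"
    have y: "y a = x a" "y b > x a ^ M" "y b > B" using ab n by (auto simp: y_def)
    have "same_signs C x y"
      unfolding same_signs_def
    proof
      fix c assume "c \<in> C"
      then show "sgn (c x) = sgn (c y)" by (rule MR[OF x(2)]) (use y n in auto)
    qed
    from C(3)[OF this] x(1) have "y \<in> T" by blast
    then show False using B y(1,3) by force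
  qed
  then show thesis using that by blast
qed

text \<open>Inequalities affine in the square of the function cover both conditions needed for the
  Lojasiewicz inequality, and a denominator is cleared by the positive factor
  \<open>Q\<^sup>2\<close>, whatever its sign.\<close>

lemma semialg_piecewise:
  fixes l :: "((real ^ 'n \<Rightarrow> real) \<times> (real ^ 'n \<Rightarrow> real)) list"
  assumes "\<forall>(p, q)\<in>set l. real_polynomial_function p \<and> real_polynomial_function q"
    and cd: "c \<in> pol W" "d \<in> pol W" and W: "coords TYPE('n) \<subseteq> W"
  shows "semialg W {x. c x * (piecewise l (pt x))\<^sup>2 + d x \<ge> 0}"
  using assms(1)
proof (induction l)
  case Nil
  show ?case using semialg_nonneg[OF cd(2)] by simp
next
  case (Cons pq l)
  obtain p q where pq: "pq = (p, q)" by (cases pq)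
  have p: "(\<lambda>x. p (pt x)) \<in> pol W" and q: "(\<lambda>x. q (pt x)) \<in> pol W"
    using Cons.prems pq rpf_pol pol_mono[OF W] by auto
  have r: "(\<lambda>x. c x * (p (pt x))\<^sup>2 + d x * (q (pt x))\<^sup>2) \<in> pol W"
    by (intro pol.add pol.mult pol.power cd p q)
  have IH: "semialg W {x. c x * (piecewise l (pt x))\<^sup>2 + d x \<ge> 0}"
    using Cons.prems by (intro Cons.IH) simp
  have "semialg W ((- {x. q (pt x) = 0} \<inter> {x. c x * (p (pt x))\<^sup>2 + d x * (q (pt x))\<^sup>2 \<ge> 0}) \<union>
      ({x. q (pt x) = 0} \<inter> {x. c x * (piecewise l (pt x))\<^sup>2 + d x \<ge> 0}))"
    by (intro semialg_Un semialg_Int semialg_Compl semialg_zero[OF q] semialg_nonneg[OF r] IH)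
  moreover have nz: "c x * (P / Q)\<^sup>2 + d x \<ge> 0 \<longleftrightarrow> c x * P\<^sup>2 + d x * Q\<^sup>2 \<ge> 0" if "Q \<noteq> 0" for x P Q
  proof -
    have "c x * P\<^sup>2 + d x * Q\<^sup>2 = (c x * (P / Q)\<^sup>2 + d x) * Q\<^sup>2"
      using that by (simp add: power_divide distrib_right)
    then show ?thesis using that by (simp add: zero_le_mult_iff)
  qed
  have "(- {x. q (pt x) = 0} \<inter> {x. c x * (p (pt x))\<^sup>2 + d x * (q (pt x))\<^sup>2 \<ge> 0}) \<union>
      ({x. q (pt x) = 0} \<inter> {x. c x * (piecewise l (pt x))\<^sup>2 + d x \<ge> 0}) =
      {x. c x * (piecewise (pq # l) (pt x))\<^sup>2 + d x \<ge> 0}" (is "?A = ?B")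
  proof (rule Set.set_eqI)
    show "x \<in> ?A \<longleftrightarrow> x \<in> ?B" for x
      using nz[of "q (pt x)" x "p (pt x)"] unfolding pq by (cases "q (pt x) = 0") auto
  qed
  ultimately show ?case by simp
qed

text \<open>The largest value of \<open>1/|f|\<close> on the compact set where \<open>|v|\<^sup>2 \<le> r\<close> and \<open>r |g v| \<ge> 1\<close> is a
  semialgebraic function of \<open>r\<close>, hence bounded by a power of \<open>r\<close>.\<close>

theorem lojasiewicz:
  fixes f g :: "real ^ 'n \<Rightarrow> real"
  assumes f: "continuous_on UNIV f" "rational_function f"
    and g: "continuous_on UNIV g" "rational_function g"
    and zero: "\<And>x. f x = 0 \<Longrightarrow> g x = 0"
  obtains M where "M \<ge> 1" "\<And>\<rho>. \<exists>C\<ge>0. \<forall>v. norm v \<le> \<rho> \<longrightarrow> \<bar>g v\<bar> ^ M \<le> C * \<bar>f v\<bar>"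
proof -
  obtain lf where lf: "\<forall>(p, q)\<in>set lf. real_polynomial_function p \<and> real_polynomial_function q"
    "f = piecewise lf" by (rule rational_piecewise[OF f])
  obtain lg where lg: "\<forall>(p, q)\<in>set lg. real_polynomial_function p \<and> real_polynomial_function q"
    "g = piecewise lg" by (rule rational_piecewise[OF g])
  let ?X = "coords TYPE('n)"
  obtain a where a: "a \<notin> ?X" using ex_new_if_finite[OF infinite_UNIV_nat, of ?X] by auto
  obtain b where b: "b \<notin> insert a ?X" using ex_new_if_finite[OF infinite_UNIV_nat, of "insert a ?X"] by auto
  define W where "W = {a, b} \<union> ?X"
  have aW: "(\<lambda>x. x a) \<in> pol W" and bW: "(\<lambda>x. x b) \<in> pol W" and XW: "?X \<subseteq> W"
    by (auto simp: W_def intro: pol.pol_var)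
  define sq where "sq = (\<lambda>x. \<Sum>i\<in>UNIV. (x (to_nat (i::'n)))\<^sup>2 :: real)"
  have sqW: "sq \<in> pol W" unfolding sq_def
    by (intro pol.sum pol.power pol.pol_var) (auto simp: W_def)
  have sq: "sq x = (norm (pt x :: real ^ 'n))\<^sup>2" for x
    unfolding sq_def norm_vec_def L2_set_def by (simp add: pt_def sum_nonneg)
  \<comment> \<open>The variable \<open>a\<close> stands for the parameter \<open>r\<close> and
    \<open>b\<close> for a positive number \<open>s\<close> with
    \<open>s \<bar>f v\<bar> \<le> 1\<close>, where \<open>v\<close> is \<open>pt x\<close>;
    absolute values are replaced by squares.\<close>
  define T0 where "T0 = {x. x a > 0} \<inter> ({x. x b > 0} \<inter> ({x. x a - sq x \<ge> 0} \<inter>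
    ({x. (x a)\<^sup>2 * (g (pt x))\<^sup>2 + (-1) \<ge> 0} \<inter> {x. (-1) * (x b)\<^sup>2 * (f (pt x))\<^sup>2 + 1 \<ge> 0})))"
  have "semialg W T0"
    unfolding T0_def lf(2) lg(2)
    by (intro semialg_Int semialg_pos semialg_nonneg semialg_piecewise lf(1) lg(1) XW aW bW sqW
        pol.diff pol.power pol.mult pol.const)
  then have T: "semialg {a, b} {x. \<exists>z\<in>T0. \<forall>i. i \<notin> ?X \<longrightarrow> z i = x i}"
    unfolding W_def by (intro semialg_project_finite) simp_all
  define T where "T = {x. \<exists>z\<in>T0. \<forall>i. i \<notin> ?X \<longrightarrow> z i = x i}"
  have TD: "\<exists>v::real ^ 'n. (norm v)\<^sup>2 \<le> x a \<and> (x a)\<^sup>2 * (g v)\<^sup>2 \<ge> 1 \<and> x b > 0 \<and> (x b)\<^sup>2 * (f v)\<^sup>2 \<le> 1"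
    if x: "x \<in> T" for x
  proof -
    obtain z where z: "z \<in> T0" "\<And>i. i \<notin> ?X \<Longrightarrow> z i = x i" using x unfolding T_def by blast
    have "z a = x a" "z b = x b" using z(2) a b by auto
    then show ?thesis using z(1) sq[of z] by (intro exI[of _ "pt z"]) (auto simp: T0_def)
  qed
  have TI: "s \<le> r ^ M" if MR: "\<forall>x\<in>T. x a \<ge> R \<longrightarrow> x b \<le> x a ^ M" and
      r: "r \<ge> R" "r > 0" "s > 0" "(norm v)\<^sup>2 \<le> r" "r\<^sup>2 * (g v)\<^sup>2 \<ge> 1" "s\<^sup>2 * (f v)\<^sup>2 \<le> 1"
    for r s R M and v :: "real ^ 'n"
  proof -
    define z where "z = (emb v)(a := r, b := s)"
    have "pt z = v"
    proof -
      have "z (to_nat i) = emb v (to_nat i)" for i :: 'n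
        using a b by (auto simp: z_def)
      then have "(\<lambda>i::'n. z (to_nat i)) = (\<lambda>i. emb v (to_nat i))" by (rule ext)
      then have "pt z = (pt (emb v) :: real ^ 'n)" unfolding pt_def by simp
      then show ?thesis by simp
    qed
    moreover have z: "z a = r" "z b = s" using b by (auto simp: z_def)
    ultimately have "z \<in> T0" using r sq[of z] by (simp add: T0_def)
    then have "z \<in> T" unfolding T_def by blast
    then show ?thesis using MR z r(1) by auto
  qed
  \<comment> \<open>For fixed \<open>r\<close> the points \<open>v\<close> range over a compact set
    on which \<open>g\<close>, hence \<open>f\<close>, has no zero; the minimum of
    \<open>\<bar>f\<bar>\<close> bounds \<open>s\<close>.\<close>
  have bdd: "\<exists>B. \<forall>x\<in>T. x a = r \<longrightarrow> x b \<le> B" for r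
  proof -
    define K where "K = cball 0 (sqrt r) \<inter> {v :: real ^ 'n. r\<^sup>2 * (g v)\<^sup>2 \<ge> 1}"
    have "closed {v :: real ^ 'n. r\<^sup>2 * (g v)\<^sup>2 \<ge> 1}"
      by (intro closed_Collect_le continuous_intros g(1))
    then have K: "compact K" unfolding K_def by (intro compact_Int_closed compact_cball)
    have inK: "v \<in> K" if "(norm v)\<^sup>2 \<le> r" "r\<^sup>2 * (g v)\<^sup>2 \<ge> 1" for v
      using that real_le_rsqrt[of "norm v" r] by (auto simp: K_def)
    show ?thesis
    proof (cases "K = {}")
      case True
      have "\<forall>x\<in>T. x a = r \<longrightarrow> x b \<le> 0"
      proof (intro ballI impI)
        fix x assume x: "x \<in> T" "x a = r"
        obtain v :: "real ^ 'n" where "(norm v)\<^sup>2 \<le> r" "r\<^sup>2 * (g v)\<^sup>2 \<ge> 1" using TD[OF x(1)] x(2) by auto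
        then show "x b \<le> 0" using inK True by blast
      qed
      then show ?thesis by blast
    next
      case False
      have "continuous_on K (\<lambda>v. \<bar>f v\<bar>)"
        by (intro continuous_intros continuous_on_subset[OF f(1)]) auto
      from continuous_attains_inf[OF K False this]
      obtain w where w: "w \<in> K" "\<And>v. v \<in> K \<Longrightarrow> \<bar>f w\<bar> \<le> \<bar>f v\<bar>" by blast
      have "g w \<noteq> 0" using w(1) by (auto simp: K_def)
      then have fw: "\<bar>f w\<bar> > 0" using zero by auto
      have "\<forall>x\<in>T. x a = r \<longrightarrow> x b \<le> 1 / \<bar>f w\<bar>"
      proof (intro ballI impI)
        fix x assume x: "x \<in> T" "x a = r"
        obtain v :: "real ^ 'n" where v: "(norm v)\<^sup>2 \<le> r" "r\<^sup>2 * (g v)\<^sup>2 \<ge> 1" "x b > 0"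
          "(x b)\<^sup>2 * (f v)\<^sup>2 \<le> 1" using TD[OF x(1)] x(2) by auto
        have "(x b * \<bar>f v\<bar>)\<^sup>2 \<le> 1\<^sup>2" using v(4) by (simp add: power_mult_distrib)
        then have "x b * \<bar>f v\<bar> \<le> 1" by (rule power2_le_imp_le) simp
        moreover have "x b * \<bar>f w\<bar> \<le> x b * \<bar>f v\<bar>"
          using w(2)[OF inK[OF v(1,2)]] v(3) by (intro mult_left_mono) auto
        ultimately show "x b \<le> 1 / \<bar>f w\<bar>" using fw by (simp add: field_simps)
      qed
      then show ?thesis by blast
    qed
  qed
  have "a \<noteq> b" using b by auto
  from semialg_plane_growth[OF T[folded T_def] this bdd]
  obtain M R where MR: "\<forall>x\<in>T. x a \<ge> R \<longrightarrow> x b \<le> x a ^ M" by blast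
  \<comment> \<open>This is the growth bound at \<open>s = 1 / \<bar>f v\<bar>\<close>; passing to
    \<open>Suc M\<close> ensures that the final exponent is at least \<open>1\<close>.\<close>
  have key: "1 \<le> r ^ Suc M * \<bar>f v\<bar>"
    if r: "r \<ge> max R 1" "(norm v)\<^sup>2 \<le> r" "r * \<bar>g v\<bar> \<ge> 1" for r v
  proof -
    have "g v \<noteq> 0" using r(3) by auto
    then have fv: "f v \<noteq> 0" using zero by blast
    have "(r * \<bar>g v\<bar>)\<^sup>2 \<ge> 1\<^sup>2" using r(3) by (intro power_mono) auto
    then have "r\<^sup>2 * (g v)\<^sup>2 \<ge> 1" by (simp add: power_mult_distrib)
    then have "1 / \<bar>f v\<bar> \<le> r ^ M"
      by (intro TI[OF MR, of r _ v]) (use r fv in \<open>auto simp: power_divide\<close>)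
    also have "\<dots> \<le> r ^ Suc M" using r(1) by (intro power_increasing) auto
    finally show ?thesis using fv by (simp add: field_simps)
  qed
  show thesis
  proof (rule that[of "Suc M"])
    fix \<rho> :: real
    have "compact (g ` cball 0 \<rho>)"
      by (intro compact_continuous_image compact_cball continuous_on_subset[OF g(1)]) simp
    from compact_imp_bounded[OF this] obtain G where "\<forall>y\<in>g ` cball 0 \<rho>. norm y \<le> G"
      unfolding bounded_iff by blast
    then have G: "\<bar>g v\<bar> \<le> G" if "norm v \<le> \<rho>" for v using that by simp
    define K where "K = max R 1 + \<rho>\<^sup>2"
    have K: "K \<ge> max R 1" "K \<ge> \<rho>\<^sup>2" "K \<ge> 0" by (auto simp: K_def)
    have "\<bar>g v\<bar> ^ Suc M \<le> (K * \<bar>G\<bar> + 1) ^ Suc M * \<bar>f v\<bar>" if v: "norm v \<le> \<rho>" for v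
    proof (cases "g v = 0")
      case True
      then show ?thesis using K(3) by simp
    next
      case False
      \<comment> \<open>\<open>K\<close> makes \<open>r\<close> large enough for \<open>key\<close>,
        and \<open>1 / \<bar>g v\<bar>\<close> gives \<open>r \<bar>g v\<bar> \<ge> 1\<close>; the
        product equals \<open>K \<bar>g v\<bar> + 1\<close>, which is bounded on the ball. Only the
        factor, not the exponent, depends on the radius.\<close>
      define r where "r = K + 1 / \<bar>g v\<bar>"
      have "(norm v)\<^sup>2 \<le> \<rho>\<^sup>2" using v by (intro power_mono) auto
      then have r: "r \<ge> max R 1" "(norm v)\<^sup>2 \<le> r" "r \<ge> 0"
        using K by (auto simp: r_def add_increasing2)
      have rg: "r * \<bar>g v\<bar> = K * \<bar>g v\<bar> + 1" using False by (simp add: r_def distrib_right)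
      then have "1 \<le> r ^ Suc M * \<bar>f v\<bar>" using K(3) by (intro key r) simp
      then have "\<bar>g v\<bar> ^ Suc M * 1 \<le> \<bar>g v\<bar> ^ Suc M * (r ^ Suc M * \<bar>f v\<bar>)"
        by (intro mult_left_mono) auto
      also have "\<dots> = (r * \<bar>g v\<bar>) ^ Suc M * \<bar>f v\<bar>"
        by (simp only: power_mult_distrib mult_ac)
      also have "\<dots> \<le> (K * \<bar>G\<bar> + 1) ^ Suc M * \<bar>f v\<bar>"
        unfolding rg using G[OF v] K(3)
        by (intro mult_right_mono power_mono add_mono mult_left_mono) auto
      finally show ?thesis by simp
    qed
    moreover have "(K * \<bar>G\<bar> + 1) ^ Suc M \<ge> 0" using K(3) by simp
    ultimately show "\<exists>C\<ge>0. \<forall>v. norm v \<le> \<rho> \<longrightarrow> \<bar>g v\<bar> ^ Suc M \<le> C * \<bar>f v\<bar>" by blast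
  qed simp
qed

section \<open>Regulous quotients\<close>

text \<open>The \<open>j\<close>-th power of the inequality absorbs \<open>M * j\<close> factors of
  \<open>g\<close>. At zeros of \<open>f\<close> the convention \<open>inverse 0 = 0\<close>
  together with \<open>j \<ge> 1\<close> is the extension by zero.\<close>

lemma loj_quotient_bound:
  fixes f g :: "real ^ 'n \<Rightarrow> real"
  assumes C: "C \<ge> 0" "\<bar>g x\<bar> ^ M \<le> C * \<bar>f x\<bar>" and j: "j \<ge> 1" and m: "m \<ge> M * j"
  shows "\<bar>g x ^ m * inverse (f x) ^ j\<bar> \<le> C ^ j * \<bar>g x\<bar> ^ (m - M * j)"
proof (cases "f x = 0")
  case True
  then show ?thesis using j C(1) by (simp add: power_0_left)
next
  case False
  have "(\<bar>g x\<bar> ^ M) ^ j \<le> (C * \<bar>f x\<bar>) ^ j" by (intro power_mono C(2)) simp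
  then have "\<bar>g x\<bar> ^ (M * j) \<le> C ^ j * \<bar>f x\<bar> ^ j" by (simp add: power_mult power_mult_distrib)
  then have "\<bar>g x\<bar> ^ (M * j) * inverse (\<bar>f x\<bar>) ^ j \<le> C ^ j"
    using False by (simp add: field_simps)
  then have "\<bar>g x\<bar> ^ (m - M * j) * (\<bar>g x\<bar> ^ (M * j) * inverse (\<bar>f x\<bar>) ^ j) \<le> \<bar>g x\<bar> ^ (m - M * j) * C ^ j"
    by (intro mult_left_mono) auto
  moreover have "\<bar>g x\<bar> ^ m = \<bar>g x\<bar> ^ (m - M * j) * \<bar>g x\<bar> ^ (M * j)"
    using m by (simp flip: power_add)
  ultimately show ?thesis by (simp add: abs_mult power_abs abs_inverse mult_ac)
qed

text \<open>At a zero of \<open>f\<close> also \<open>g\<close> vanishes, and the spare factor of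
  \<open>g\<close> guaranteed by \<open>m \<ge> M * j + 1\<close> drives the quotient to
  \<open>0\<close>.\<close>

lemma isCont_quotient:
  fixes f g u :: "real ^ 'n \<Rightarrow> real"
  assumes loj: "\<And>\<rho>. \<exists>C\<ge>0. \<forall>v. norm v \<le> \<rho> \<longrightarrow> \<bar>g v\<bar> ^ M \<le> C * \<bar>f v\<bar>"
    and M: "M \<ge> 1" and j: "j \<ge> 1" and m: "m \<ge> M * j + 1"
    and cont: "isCont f z" "isCont g z" "isCont u z"
  shows "isCont (\<lambda>x. u x * (g x ^ m * inverse (f x) ^ j)) z"
proof (cases "f z = 0")
  case False
  then show ?thesis by (intro continuous_intros cont)
next
  case True
  obtain C where C: "C \<ge> 0" "\<And>v. norm v \<le> norm z + 1 \<Longrightarrow> \<bar>g v\<bar> ^ M \<le> C * \<bar>f v\<bar>"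
    using loj[of "norm z + 1"] by blast
  have "\<bar>g z\<bar> ^ M \<le> 0" using C(2)[of z] True by simp
  then have "\<bar>g z\<bar> ^ M = 0" by (intro antisym) simp_all
  then have gz: "g z = 0" using M by simp
  define e where "e = m - M * j"
  have e: "e \<ge> 1" using m by (simp add: e_def)
  have lim: "((\<lambda>x. \<bar>u x\<bar> * (C ^ j * \<bar>g x\<bar> ^ e)) \<longlongrightarrow> \<bar>u z\<bar> * (C ^ j * \<bar>g z\<bar> ^ e)) (at z)"
    using cont unfolding isCont_def by (intro tendsto_intros)
  have "\<forall>\<^sub>F x in at z. x \<in> ball z 1" by (intro eventually_at_in_open' open_ball) simp
  then have "\<forall>\<^sub>F x in at z. norm (u x * (g x ^ m * inverse (f x) ^ j)) \<le> \<bar>u x\<bar> * (C ^ j * \<bar>g x\<bar> ^ e)"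
  proof eventually_elim
    case (elim x)
    then have "norm x \<le> norm z + 1"
      using norm_triangle_ineq2[of x z] by (simp add: dist_norm norm_minus_commute)
    from loj_quotient_bound[where f = f and g = g and x = x, OF C(1) C(2)[OF this] j, of m] m
    have "\<bar>g x ^ m * inverse (f x) ^ j\<bar> \<le> C ^ j * \<bar>g x\<bar> ^ e" by (simp add: e_def)
    then show ?case by (simp only: real_norm_def abs_mult[of "u x"]) (intro mult_left_mono, auto)
  qed
  moreover have "((\<lambda>x. \<bar>u x\<bar> * (C ^ j * \<bar>g x\<bar> ^ e)) \<longlongrightarrow> 0) (at z)" using lim gz e by (simp add: power_0_left)
  ultimately have "((\<lambda>x. u x * (g x ^ m * inverse (f x) ^ j)) \<longlongrightarrow> 0) (at z)"
    by (rule Lim_null_comparison)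
  then show ?thesis using True j gz by (simp add: isCont_def power_0_left)
qed

text \<open>Near \<open>z\<close> the factor \<open>g\<close> is at most a constant times the
  distance, and \<open>h\<close> tends to \<open>0\<close>; so the product is of smaller order
  although \<open>h\<close> is merely continuous.\<close>

lemma has_derivative_mult_vanishing:
  fixes g h :: "real ^ 'n \<Rightarrow> real"
  assumes g: "(g has_derivative G) (at z)" "g z = 0" and h: "isCont h z" "h z = 0"
  shows "((\<lambda>x. g x * h x) has_derivative (\<lambda>v. 0)) (at z)"
proof -
  obtain B where B: "\<And>v. norm (G v) \<le> norm v * B"
    using bounded_linear.bounded[OF has_derivative_bounded_linear[OF g(1)]] by blast
  have lim: "((\<lambda>y. norm ((g y - g z) - G (y - z)) / norm (y - z)) \<longlongrightarrow> 0) (at z)"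
    using g(1) unfolding has_derivative_iff_norm by blast
  have "((\<lambda>y. \<bar>h y\<bar> * (norm ((g y - g z) - G (y - z)) / norm (y - z) + B)) \<longlongrightarrow> \<bar>h z\<bar> * (0 + B)) (at z)"
    using h(1) unfolding isCont_def by (intro tendsto_intros lim)
  then have lim0: "((\<lambda>y. \<bar>h y\<bar> * (norm ((g y - g z) - G (y - z)) / norm (y - z) + B)) \<longlongrightarrow> 0) (at z)"
    using h(2) by simp
  have "\<forall>\<^sub>F y in at z. y \<noteq> z" by (simp add: eventually_at_filter)
  then have "\<forall>\<^sub>F y in at z. norm (norm ((g y * h y - g z * h z) - 0) / norm (y - z))
      \<le> \<bar>h y\<bar> * (norm ((g y - g z) - G (y - z)) / norm (y - z) + B)"
  proof eventually_elim
    case (elim y)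
    then have n: "norm (y - z) > 0" by simp
    have "\<bar>g y\<bar> \<le> norm ((g y - g z) - G (y - z)) + norm (G (y - z))" using g(2) by simp
    also have "\<dots> \<le> norm ((g y - g z) - G (y - z)) + norm (y - z) * B" using B by simp
    finally have "\<bar>g y\<bar> / norm (y - z) \<le> norm ((g y - g z) - G (y - z)) / norm (y - z) + B"
      using n by (simp add: field_simps)
    then have "\<bar>h y\<bar> * (\<bar>g y\<bar> / norm (y - z)) \<le> \<bar>h y\<bar> * (norm ((g y - g z) - G (y - z)) / norm (y - z) + B)"
      by (rule mult_left_mono) simp
    then show ?case using g(2) by (simp add: abs_mult mult_ac)
  qed
  then have "((\<lambda>y. norm ((g y * h y - g z * h z) - 0) / norm (y - z)) \<longlongrightarrow> 0) (at z)"
    using lim0 by (rule Lim_null_comparison)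
  then show ?thesis unfolding has_derivative_iff_norm by simp
qed

text \<open>One formula covers both cases: at zeros of \<open>f\<close> all its terms vanish. There
  one factor \<open>g\<close> is split off, and \<open>m \<ge> M * j + 2\<close> keeps the remaining
  quotient continuous.\<close>

lemma quotient_has_derivative:
  fixes f g u :: "real ^ 'n \<Rightarrow> real"
  assumes loj: "\<And>\<rho>. \<exists>C\<ge>0. \<forall>v. norm v \<le> \<rho> \<longrightarrow> \<bar>g v\<bar> ^ M \<le> C * \<bar>f v\<bar>"
    and M: "M \<ge> 1" and j: "j \<ge> 1" and m: "m \<ge> M * j + 2"
    and d: "(f has_derivative F) (at z)" "(g has_derivative G) (at z)" "(u has_derivative U) (at z)"
  shows "((\<lambda>x. u x * (g x ^ m * inverse (f x) ^ j)) has_derivative (\<lambda>v.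
     U v * (g z ^ m * inverse (f z) ^ j) +
     real m * u z * G v * (g z ^ (m - 1) * inverse (f z) ^ j) +
     - real j * u z * F v * (g z ^ m * inverse (f z) ^ (j + 1)))) (at z)"
proof (cases "f z = 0")
  case False
  have w: "((\<lambda>x. inverse (f x)) has_derivative (\<lambda>v. - (inverse (f z) * F v * inverse (f z)))) (at z)"
    by (rule Deriv.has_derivative_inverse[OF False d(1)])
  have "((\<lambda>x. u x * (g x ^ m * inverse (f x) ^ j)) has_derivative (\<lambda>v.
     u z * (g z ^ m * (of_nat j * - (inverse (f z) * F v * inverse (f z)) * inverse (f z) ^ (j - 1)) +
       of_nat m * G v * g z ^ (m - 1) * inverse (f z) ^ j) + U v * (g z ^ m * inverse (f z) ^ j))) (at z)"
    by (intro has_derivative_mult has_derivative_power d w)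
  moreover obtain i where i: "j = Suc i" using j by (cases j) auto
  ultimately show ?thesis unfolding i by (simp add: algebra_simps)
next
  case True
  have "\<bar>g z\<bar> ^ M \<le> 0" using loj[of "norm z"] True by force
  then have "\<bar>g z\<bar> ^ M = 0" by (intro antisym) simp_all
  then have gz: "g z = 0" using M by simp
  have "isCont (\<lambda>x. u x * (g x ^ (m - 1) * inverse (f x) ^ j)) z"
    by (rule isCont_quotient[OF loj M j]) (use m d has_derivative_continuous in auto)
  moreover have "u z * (g z ^ (m - 1) * inverse (f z) ^ j) = 0" using True j by (simp add: power_0_left)
  ultimately have "((\<lambda>x. g x * (u x * (g x ^ (m - 1) * inverse (f x) ^ j))) has_derivative (\<lambda>v. 0)) (at z)"
    by (rule has_derivative_mult_vanishing[OF d(2) gz])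
  moreover have "(\<lambda>x. g x * (u x * (g x ^ (m - 1) * inverse (f x) ^ j))) =
      (\<lambda>x. u x * (g x ^ m * inverse (f x) ^ j))"
    using m by (cases m) (simp_all add: mult_ac)
  ultimately have "((\<lambda>x. u x * (g x ^ m * inverse (f x) ^ j)) has_derivative (\<lambda>v. 0)) (at z)"
    by (simp only:)
  then show ?thesis using True j by (simp add: power_0_left)
qed

text \<open>Differentiating \<open>u g\<^sup>m / f\<^sup>j\<close> lowers \<open>m\<close> by at most one and raises \<open>j\<close> by at most one; after \<open>k\<close>
  steps continuity still needs \<open>m > M j\<close>.\<close>

lemma class_C_quotient:
  fixes f g u :: "real ^ 'n \<Rightarrow> real"
  assumes loj: "\<And>\<rho>. \<exists>C\<ge>0. \<forall>v. norm v \<le> \<rho> \<longrightarrow> \<bar>g v\<bar> ^ M \<le> C * \<bar>f v\<bar>" and M: "M \<ge> 1"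
    and "class_C k f" "class_C k g" "class_C k u" "j \<ge> 1" "m \<ge> M * (j + k) + k + 1"
  shows "class_C k (\<lambda>x. u x * (g x ^ m * inverse (f x) ^ j))"
  using assms(3-)
\<comment> \<open>The factor \<open>u\<close> varies because it absorbs the partial derivatives of
  \<open>f\<close>, \<open>g\<close> and \<open>u\<close>, so that each summand of the derivative
  has the same shape.\<close>
proof (induction k arbitrary: u j m)
  case 0
  then show ?case
    using isCont_quotient[OF loj M, of j m] by (auto simp: continuous_on_eq_continuous_at)
next
  case (Suc k)
  have kk: "class_C k f" "class_C k g" "class_C k u"
    using Suc.prems(1-3) by (blast intro: class_C_Suc_imp)+
  have d: "f differentiable at x" "g differentiable at x" "u differentiable at x" for x
    using Suc.prems(1-3) by (simp_all add: differentiable_on_eq_differentiable_at)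
  have m2: "m \<ge> M * j + 2" using Suc.prems(5) M by (simp add: algebra_simps)
  note D = quotient_has_derivative[OF loj M Suc.prems(4) m2 d[unfolded frechet_derivative_works]]
  have "class_C k (\<lambda>x. frechet_derivative (\<lambda>x. u x * (g x ^ m * inverse (f x) ^ j)) (at x) (axis i 1))" for i
  proof -
    let ?F = "\<lambda>x. frechet_derivative f (at x) (axis i 1)"
    let ?G = "\<lambda>x. frechet_derivative g (at x) (axis i 1)"
    let ?U = "\<lambda>x. frechet_derivative u (at x) (axis i 1)"
    have "class_C k ?F" "class_C k ?G" "class_C k ?U" using Suc.prems(1-3) by simp_all
    then have "class_C k (\<lambda>x. ?U x * (g x ^ m * inverse (f x) ^ j) +
        real m * u x * ?G x * (g x ^ (m - 1) * inverse (f x) ^ j) +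
        - real j * u x * ?F x * (g x ^ m * inverse (f x) ^ (j + 1)))"
      using Suc.prems(4,5) M
      by (intro class_C_add Suc.IH class_C_mult class_C_const kk) (simp_all add: algebra_simps)
    then show ?thesis unfolding frechet_derivative_at[OF D, symmetric] .
  qed
  moreover have "(\<lambda>x. u x * (g x ^ m * inverse (f x) ^ j)) differentiable_on UNIV"
    using D by (auto simp: differentiable_on_eq_differentiable_at differentiable_def)
  ultimately show ?case by simp
qed

lemma class_C_continuous: "class_C k f \<Longrightarrow> continuous_on UNIV f"
  by (cases k) (auto intro: differentiable_imp_continuous_on)

lemma rational_function_power:
  assumes "rational_function f"
  shows "rational_function (\<lambda>x. f x ^ m)"
  by (induction m) (simp_all add: rational_function_const rational_function_mult assms)

text \<open>When the numerator is identically zero, \<open>f\<close> vanishes wherever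
  \<open>q\<close> does not, and \<open>inverse 0 = 0\<close> makes the inverse generically zero as
  well.\<close>

lemma rational_function_inverse:
  assumes "rational_function f"
  shows "rational_function (\<lambda>x. inverse (f x))"
proof -
  obtain p q z where pq: "real_polynomial_function p" "real_polynomial_function q" "q z \<noteq> 0"
    "\<And>x. q x \<noteq> 0 \<Longrightarrow> f x = p x / q x"
    using assms unfolding rational_function_iff by blast
  show ?thesis
  proof (cases "\<exists>w. p w \<noteq> 0")
    case True
    then obtain w where "p w \<noteq> 0" by blast
    then obtain y where y: "p y \<noteq> 0" "q y \<noteq> 0"
      using real_polynomial_function_mult_nonzero[OF pq(1) _ pq(2,3)] by blast
    show ?thesis unfolding rational_function_iff
      by (rule exI[of _ "\<lambda>x. q x * q x"], rule exI[of _ "\<lambda>x. p x * q x"])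
        (use pq y in auto)
  next
    case False
    show ?thesis unfolding rational_function_iff
      by (rule exI[of _ "\<lambda>x. 0"], rule exI[of _ q]) (use pq False in auto)
  qed
qed

lemma regulous_ring_nat_pow: "f [^]\<^bsub>regulous_ring k\<^esub> (m::nat) = (\<lambda>x. f x ^ m)"
  by (induction m) (simp_all add: regulous_ring_def nat_pow_def mult.commute)

theorem theorem3p16:
  fixes k :: nat and I :: "(real ^ 'n \<Rightarrow> real) set"
  assumes "ideal I (regulous_ring k)"
  shows "ideal_radical (regulous_ring k) I = vanishing_ideal k (zero_set I)"
proof (rule subset_antisym)
  have car: "carrier (regulous_ring k) = {f :: real ^ 'n \<Rightarrow> real. regulous k f}"
    by (simp add: regulous_ring_def)
  have reg: "regulous k f" if "f \<in> I" for f
    using ideal.Icarr[OF assms that] by (simp add: car)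
  have mult_I: "(\<lambda>x. h x * f x) \<in> I" if "regulous k h" "f \<in> I" for h f
    using ideal.I_l_closed[OF assms that(2), of h] that(1) by (simp add: regulous_ring_def)
  have add_I: "(\<lambda>x. f x + h x) \<in> I" if "f \<in> I" "h \<in> I" for f h
    using additive_subgroup.a_closed[OF ideal.axioms(1)[OF assms] that] by (simp add: regulous_ring_def)
  have zero_I: "(\<lambda>x. 0) \<in> I"
    using additive_subgroup.zero_closed[OF ideal.axioms(1)[OF assms]] by (simp add: regulous_ring_def)
  have cr: "continuous_on UNIV f \<and> rational_function f" if "regulous k f" for f :: "real ^ 'n \<Rightarrow> real"
    using that class_C_continuous by (auto simp: regulous_def)
  show "ideal_radical (regulous_ring k) I \<subseteq> vanishing_ideal k (zero_set I)"
    unfolding ideal_radical_def vanishing_ideal_def regulous_ring_nat_pow zero_set_def by force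
  show "vanishing_ideal k (zero_set I) \<subseteq> ideal_radical (regulous_ring k) I"
  proof
    fix g assume "g \<in> vanishing_ideal k (zero_set I)"
    then have g: "regulous k g" "\<And>x. x \<in> zero_set I \<Longrightarrow> g x = 0"
      by (auto simp: vanishing_ideal_def car)
    obtain f where f: "f \<in> I" "\<forall>x. f x = 0 \<longrightarrow> g x = 0"
    proof (rule zero_set_single_function[of I g])
      show "continuous_on UNIV f \<and> rational_function f" if "f \<in> I" for f
        by (rule cr[OF reg[OF that]])
      show "I \<noteq> {}" using zero_I by blast
      show "(\<lambda>x. f x * f x + h x * h x) \<in> I" if "f \<in> I" "h \<in> I" for f h
        by (intro add_I mult_I reg that)
    qed (use g cr[OF g(1)] in auto)
    have rf: "regulous k f" by (rule reg[OF f(1)])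
    obtain M where M: "M \<ge> 1"
      "\<And>\<rho>. \<exists>C\<ge>0. \<forall>v. norm v \<le> \<rho> \<longrightarrow> \<bar>g v\<bar> ^ M \<le> C * \<bar>f v\<bar>"
      by (rule lojasiewicz[of f g]) (use cr[OF rf] cr[OF g(1)] f(2) in auto)
    \<comment> \<open>This is the bound of \<open>class_C_quotient\<close> for \<open>j = 1\<close>;
      the factors \<open>1\<close> and the exponent \<open>1\<close> in \<open>h\<close> below give
      it the required shape.\<close>
    define m where "m = M * (1 + k) + k + 1"
    define h where "h = (\<lambda>x. 1 * (g x ^ m * inverse (f x) ^ 1))"
    have "class_C k h" unfolding h_def
      by (rule class_C_quotient[OF M(2,1)])
        (use rf g(1) in \<open>auto simp: regulous_def class_C_const m_def\<close>)
    moreover have "rational_function h" unfolding h_def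
      using rf g(1) by (auto simp: regulous_def intro!: rational_function_mult
          rational_function_power rational_function_inverse)
    ultimately have "(\<lambda>x. h x * f x) \<in> I" by (intro mult_I f(1)) (simp add: regulous_def)
    \<comment> \<open>At a zero of \<open>f\<close> both sides vanish, since \<open>g\<close>
      vanishes there and \<open>m \<ge> 1\<close>.\<close>
    moreover have "h x * f x = g x ^ m" for x
      using f(2) by (cases "f x = 0") (auto simp: h_def m_def)
    ultimately have "(\<lambda>x. g x ^ m) \<in> I" by simp
    moreover have "m \<ge> 1" by (simp add: m_def)
    ultimately show "g \<in> ideal_radical (regulous_ring k) I"
      unfolding ideal_radical_def regulous_ring_nat_pow using g(1) car by blast
  qed
qed

end
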